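(* Let $W_h^0$ denote the space $W_h^g$ (defined in the context) for $g\equiv 0$. Provided $h$ is sufficiently small, there exists a constant $\alpha>0$ independent of $h$ such that for every $w\in W_h^0$, $w\neq 0$, $$\sup_{v\in V_h\setminus\{0\}}\frac{a_h(w,v)}{\|\mathbf{grad}_h w\|_{0,h}\,\|\mathbf{grad}\,v\|_{0,h}}\ \ge\ \alpha .$$
   Context: Domain. $\Omega\subset\mathbb{R}^3$ is a bounded domain with boundary $\Gamma$, which is at least of class $C^1$ and whose principal curvatures are uniquely defined almost everywhere. $k\ge 2$ is a fixed integer. Meshes. $(\mathcal{T}_h)_h$ is a regular family (in Ciarlet's sense: uniformly shape-regular with $h\to0$; not necessarily quasi-uniform) of meshes consisting of closed straight-edged tetrahedra satisfying the usual compatibility (conformity) conditions. $\Omega_h$ is the interior of $\bigcup_{T\in\mathcal{T}_h}T$, with boundary $\Gamma_h$; all vertices of this polyhedron lie on $\Gamma$. $h_T$ is the diameter of $T$, $h=\max_T h_T$. Every element has at most either one edge or one face contained in $\Gamma_h$. $\mathcal{S}_h$ is the set of tetrahedra having one face on $\Gamma_h$ (this face is denoted $F_T$); $\mathcal{R}_h$ is the set of tetrahedra in $\mathcal{T}_h\setminus\mathcal{S}_h$ having exactly one edge on $\Gamma_h$; $\mathcal{O}_h=\mathcal{S}_h\cup\mathcal{R}_h$. For $T\in\mathcal{S}_h$, $O_T$ is the vertex of $T$ not belonging to $\Gamma$. Plane sets. With every edge $e$ of $\Gamma_h$ is associated a plane set $\delta_e$ containing $e$ and delimited by $\Gamma$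 and $e$ itself, whose plane is close to the bisector of the faces of the pair of elements of $\mathcal{S}_h$ intersecting at $e$ (it can be a face shared by both), and does not lie in the plane of a face common to a tetrahedron in $\mathcal{S}_h$ and a tetrahedron in $\mathcal{R}_h$. Spaces. $\mathcal{P}_k(D)$ is the space of polynomials of degree $\le k$ on $D$. The Lagrangian nodes (of order $k$) of $T$ are the vertices of the partition of $T$ into $k^3$ equal tetrahedra. $V_h$ is the space of continuous functions on $\Omega_h$ vanishing on $\Gamma_h$ whose restriction to every $T\in\mathcal{T}_h$ is in $\mathcal{P}_k(T)$. For a continuous function $g$ on $\Gamma$, $W_h^g$ is the set of functions $w$ such that (polynomials on $T$ being evaluated outside $T$ by their natural extension): 1. $w_{|T}\in\mathcal{P}_k(T)$ for all $T\in\mathcal{T}_h$; 2. $w$ is single-valued at all Lagrangian nodes of the mesh except those located on $\Gamma_h$ which are not vertices of $\Omega_h$; 3. $w(S)=g(S)$ at every vertex $S$ of $\Gamma_h$; 4. for all $T\in\mathcal{S}_h$, $w_{|T}(P)=g(P)$ at every $P$ among the $(k-1)(k-2)/2$ nearest intersections with $\Gamma$ of the lines through $O_T$ and the $(k-1)(k-2)/2$ points $M$ not belonging to any edge of $F_T$ among the $(k+2)(k+1)/2$ points of $F_T$ that subdivide this face into $k^2$ equal triangles; 5. for all $T\in\mathcal{O}_h$ and every edge $e$ of $T$ contained in $\Gamma_h$, $w_{|T}(Q)=g(Q)$ at every $Q$ among the $k-1$ nearest intersections with $\Gamma$ of the lines orthogonal to $e$ in $\delta_e$ passing through the $k-1$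 interior points $M$ of $e$ subdividing $e$ into $k$ equal segments. Forms and norms. $\mathbf{grad}_h$ is the broken gradient, $(\mathbf{grad}_h w)_{|T}=\mathbf{grad}\,(w_{|T})$ for all $T\in\mathcal{T}_h$; $a_h(w,v)=\int_{\Omega_h}\mathbf{grad}_h w\cdot\mathbf{grad}\,v$; $\|\cdot\|_{0,h}$ is the norm of $L^2(\Omega_h)$. *)

theory Defs
  imports "HOL-Analysis.Analysis"
begin

type_synonym pt = "real ^ 3"

section \<open>The curved domain\<close>

text \<open>Near every boundary point the set lies strictly above the graph of a \<open>C\<^sup>1\<close> function,
  in suitable Cartesian coordinates centred at that point.\<close>

definition C1_boundary :: "pt set \<Rightarrow> bool" where
  "C1_boundary \<Omega> \<longleftrightarrow>
    (\<forall>p\<in>frontier \<Omega>. \<exists>(A :: (real^2) \<times> real \<Rightarrow> pt) \<phi> D r.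
        linear A \<and> (\<forall>z. norm (A z) = norm z) \<and> 0 < r \<and>
        (\<forall>y. GDERIV \<phi> y :> D y) \<and> continuous_on UNIV D \<and>
        \<Omega> \<inter> ball p r = {x \<in> ball p r. \<exists>y t. x = p + A (y, t) \<and> \<phi> y < t})"

definition outward_normal :: "pt set \<Rightarrow> pt \<Rightarrow> pt" where
  "outward_normal \<Omega> x = (THE \<nu>. norm \<nu> = 1 \<and>
      ((\<lambda>y. (\<nu> \<bullet> (y - x)) / norm (y - x)) \<longlongrightarrow> 0) (at x within frontier \<Omega>) \<and>
      (\<forall>\<^sub>F t in at_right (0::real). x - t *\<^sub>R \<nu> \<in> \<Omega> \<and> x + t *\<^sub>R \<nu> \<notin> \<Omega>))"

text \<open>The principal curvatures are the eigenvalues, on the tangent plane, of the differential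
  along the boundary of the Gauss map (they are positive for a ball).  The derivative \<open>L\<close> within the
  boundary is only determined on tangent vectors, which is all that is used.\<close>

definition principal_curvatures :: "pt set \<Rightarrow> pt \<Rightarrow> real \<times> real \<Rightarrow> bool" where
  "principal_curvatures \<Omega> x \<kappa> \<longleftrightarrow> fst \<kappa> \<le> snd \<kappa> \<and>
    (\<exists>L d1 d2. (outward_normal \<Omega> has_derivative L) (at x within frontier \<Omega>) \<and>
        norm d1 = 1 \<and> norm d2 = 1 \<and> d1 \<bullet> d2 = 0 \<and>
        d1 \<bullet> outward_normal \<Omega> x = 0 \<and> d2 \<bullet> outward_normal \<Omega> x = 0 \<and>
        L d1 = fst \<kappa> *\<^sub>R d1 \<and> L d2 = snd \<kappa> *\<^sub>R d2)"

text \<open>Null sets of the two-dimensional Hausdorff measure, which is the surface measure on a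
  \<open>C\<^sup>1\<close> boundary.\<close>

definition surface_null :: "pt set \<Rightarrow> bool" where
  "surface_null N \<longleftrightarrow> (\<forall>\<epsilon>>0. \<exists>(c :: nat \<Rightarrow> pt) r. (\<forall>n. 0 \<le> r n) \<and>
      N \<subseteq> (\<Union>n. cball (c n) (r n)) \<and> summable (\<lambda>n. (r n)\<^sup>2) \<and> (\<Sum>n. (r n)\<^sup>2) < \<epsilon>)"

definition curved_domain :: "pt set \<Rightarrow> bool" where
  "curved_domain \<Omega> \<longleftrightarrow> open \<Omega> \<and> connected \<Omega> \<and> \<Omega> \<noteq> {} \<and> bounded \<Omega> \<and> C1_boundary \<Omega> \<and>
    surface_null {x \<in> frontier \<Omega>. \<not> (\<exists>!\<kappa>. principal_curvatures \<Omega> x \<kappa>)}"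

section \<open>Meshes\<close>

type_synonym mesh = "pt set set"

definition mesh_domain :: "mesh \<Rightarrow> pt set" where
  "mesh_domain \<T> = interior (\<Union>\<T>)"

definition mesh_boundary :: "mesh \<Rightarrow> pt set" where
  "mesh_boundary \<T> = frontier (mesh_domain \<T>)"

definition mesh_size :: "mesh \<Rightarrow> real" where
  "mesh_size \<T> = Max (diameter ` \<T>)"

definition mesh_vertices :: "mesh \<Rightarrow> pt set" where
  "mesh_vertices \<T> = {S. \<exists>T\<in>\<T>. S extreme_point_of T}"

text \<open>The vertices of the polyhedron are understood as those of its triangulated boundary, so that
  a mesh vertex in the interior of a flat part of the boundary counts as well.\<close>

definition boundary_vertices :: "mesh \<Rightarrow> pt set" where
  "boundary_vertices \<T> = mesh_vertices \<T> \<inter> mesh_boundary \<T>"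

definition boundary_edges :: "mesh \<Rightarrow> pt set set" where
  "boundary_edges \<T> = {e. e \<subseteq> mesh_boundary \<T> \<and> (\<exists>T\<in>\<T>. e edge_of T)}"

definition face_elements :: "mesh \<Rightarrow> pt set set" where
  "face_elements \<T> = {T \<in> \<T>. \<exists>F. F facet_of T \<and> F \<subseteq> mesh_boundary \<T>}"

definition edge_elements :: "mesh \<Rightarrow> pt set set" where
  "edge_elements \<T> = {T \<in> \<T> - face_elements \<T>. \<exists>!e. e edge_of T \<and> e \<subseteq> mesh_boundary \<T>}"

definition boundary_face :: "mesh \<Rightarrow> pt set \<Rightarrow> pt set" where
  "boundary_face \<T> T = (THE F. F facet_of T \<and> F \<subseteq> mesh_boundary \<T>)"

definition inner_vertex :: "pt set \<Rightarrow> pt set \<Rightarrow> pt" where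
  "inner_vertex \<Omega> T = (THE S. S extreme_point_of T \<and> S \<notin> frontier \<Omega>)"

definition fitted_mesh :: "pt set \<Rightarrow> mesh \<Rightarrow> bool" where
  "fitted_mesh \<Omega> \<T> \<longleftrightarrow>
    triangulation \<T> \<and> \<T> \<noteq> {} \<and> (\<forall>T\<in>\<T>. 3 simplex T) \<and>
    mesh_vertices \<T> \<subseteq> closure \<Omega> \<and> boundary_vertices \<T> \<subseteq> frontier \<Omega> \<and>
    (\<forall>T\<in>\<T>. (\<forall>e. e edge_of T \<longrightarrow> \<not> e \<subseteq> mesh_boundary \<T>) \<or>
             (\<exists>!e. e edge_of T \<and> e \<subseteq> mesh_boundary \<T>) \<or>
             (\<exists>F. F facet_of T \<and> F \<subseteq> mesh_boundary \<T> \<and>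
                  (\<forall>e. e edge_of T \<and> e \<subseteq> mesh_boundary \<T> \<longrightarrow> e \<subseteq> F))) \<and>
    (\<forall>T\<in>face_elements \<T>. \<exists>!S. S extreme_point_of T \<and> S \<notin> frontier \<Omega>)"

definition inball_diameter :: "pt set \<Rightarrow> real" where
  "inball_diameter T = Sup {2 * r | r. 0 \<le> r \<and> (\<exists>c. cball c r \<subseteq> T)}"

definition regular_family :: "'i set \<Rightarrow> ('i \<Rightarrow> mesh) \<Rightarrow> bool" where
  "regular_family I \<T> \<longleftrightarrow>
    (\<exists>\<sigma>. \<forall>i\<in>I. \<forall>T\<in>\<T> i. diameter T \<le> \<sigma> * inball_diameter T) \<and>
    (\<forall>\<epsilon>>0. \<exists>i\<in>I. mesh_size (\<T> i) < \<epsilon>)"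

section \<open>Planes attached to the boundary edges\<close>

definition face_normal :: "pt set \<Rightarrow> mesh \<Rightarrow> pt set \<Rightarrow> pt" where
  "face_normal \<Omega> \<T> T = (THE \<nu>. norm \<nu> = 1 \<and>
      (\<forall>x\<in>boundary_face \<T> T. \<forall>y\<in>boundary_face \<T> T. \<nu> \<bullet> (x - y) = 0) \<and>
      (\<forall>x\<in>boundary_face \<T> T. \<nu> \<bullet> (inner_vertex \<Omega> T - x) < 0))"

text \<open>The angle between the plane \<open>\<Delta>\<close> through \<open>e\<close> and the plane bisecting the boundary faces
  of \<open>T\<close> and \<open>T'\<close> is at most \<open>\<theta>\<close>.  The bisecting plane is spanned by \<open>e\<close> and the sum of the outward
  unit normals, which also covers coplanar faces.\<close>

definition close_to_bisector ::
  "pt set \<Rightarrow> mesh \<Rightarrow> real \<Rightarrow> pt set \<Rightarrow> pt set \<Rightarrow> pt set \<Rightarrow> pt set \<Rightarrow> bool" where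
  "close_to_bisector \<Omega> \<T> \<theta> e \<Delta> T T' \<longleftrightarrow>
    (let b = face_normal \<Omega> \<T> T + face_normal \<Omega> \<T> T' in
     \<forall>x\<in>\<Delta>. \<forall>y\<in>\<Delta>. (\<forall>p\<in>e. \<forall>q\<in>e. (x - y) \<bullet> (p - q) = 0) \<longrightarrow>
        cos \<theta> * (norm (x - y) * norm b) \<le> \<bar>(x - y) \<bullet> b\<bar>)"

text \<open>The plane set attached to a boundary edge \<open>e\<close> is the part, delimited by \<open>e\<close> and the boundary
  of \<open>\<Omega>\<close>, of a plane \<open>\<Delta> e\<close> through \<open>e\<close>.  Only the lines orthogonal to \<open>e\<close> in that plane enter the
  finite element space, and the plane set itself degenerates to \<open>e\<close> if \<open>e\<close> lies in the boundary of
  \<open>\<Omega>\<close>; therefore the plane is the datum.\<close>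

definition admissible_planes ::
  "pt set \<Rightarrow> mesh \<Rightarrow> real \<Rightarrow> (pt set \<Rightarrow> pt set) \<Rightarrow> bool" where
  "admissible_planes \<Omega> \<T> \<theta> \<Delta> \<longleftrightarrow>
    (\<forall>e\<in>boundary_edges \<T>. affine (\<Delta> e) \<and> aff_dim (\<Delta> e) = 2 \<and> e \<subseteq> \<Delta> e \<and>
      (\<exists>T\<in>face_elements \<T>. \<exists>T'\<in>face_elements \<T>. T \<noteq> T' \<and>
          boundary_face \<T> T \<inter> boundary_face \<T> T' = e \<and>
          (close_to_bisector \<Omega> \<T> \<theta> e (\<Delta> e) T T' \<or>
           (\<exists>G. G facet_of T \<and> G facet_of T' \<and> \<Delta> e = affine hull G))) \<and>
      \<not> (\<exists>T\<in>face_elements \<T>. \<exists>T'\<in>edge_elements \<T>. \<exists>G.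
            G facet_of T \<and> G facet_of T' \<and> e \<subseteq> G \<and> \<Delta> e = affine hull G))"

section \<open>Finite element spaces\<close>

definition polys :: "nat \<Rightarrow> (pt \<Rightarrow> real) set" where
  "polys k = {p. \<exists>c. \<forall>x. p x = (\<Sum>a | (\<Sum>i\<in>UNIV. a i) \<le> k. c a * (\<Prod>i\<in>UNIV. (x $ i) ^ a i))}"

text \<open>For a tetrahedron, a triangle or a segment: the vertices of its partition into
  \<open>k\<^sup>3\<close>, \<open>k\<^sup>2\<close> or \<open>k\<close> equal simplices, i.e. the points whose barycentric coordinates are
  multiples of \<open>1 / k\<close>.\<close>

definition lattice_points :: "nat \<Rightarrow> pt set \<Rightarrow> pt set" where
  "lattice_points k T = {x. \<exists>a :: pt \<Rightarrow> nat. (\<Sum>S | S extreme_point_of T. a S) = k \<and>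
      x = (\<Sum>S | S extreme_point_of T. (real (a S) / real k) *\<^sub>R S)}"

definition nearest_intersection :: "pt set \<Rightarrow> pt set \<Rightarrow> pt \<Rightarrow> pt \<Rightarrow> bool" where
  "nearest_intersection \<Gamma> l M P \<longleftrightarrow> is_arg_min (dist M) (\<lambda>Q. Q \<in> l \<inter> \<Gamma>) P"

definition orthogonal_line :: "pt set \<Rightarrow> pt set \<Rightarrow> pt \<Rightarrow> pt set" where
  "orthogonal_line \<Delta> e M = {x \<in> \<Delta>. \<forall>p\<in>e. \<forall>q\<in>e. (x - M) \<bullet> (p - q) = 0}"

text \<open>Functions on the closed polyhedron are represented by their extension by zero.\<close>

definition V_space :: "nat \<Rightarrow> mesh \<Rightarrow> (pt \<Rightarrow> real) set" where
  "V_space k \<T> = {v. continuous_on (\<Union>\<T>) v \<and> (\<forall>x\<in>mesh_boundary \<T>. v x = 0) \<and>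
      (\<forall>T\<in>\<T>. \<exists>p\<in>polys k. \<forall>x\<in>T. v x = p x) \<and> (\<forall>x. x \<notin> \<Union>\<T> \<longrightarrow> v x = 0)}"

text \<open>A piecewise polynomial \<open>w\<close> is multivalued on the skeleton of the mesh, and its pieces are
  also evaluated outside their elements; \<open>w T\<close> is the polynomial on all of space that
  represents \<open>w\<close> on the element \<open>T\<close> (and is zero, by convention, if \<open>T\<close> is not an element).\<close>

definition W_space ::
  "nat \<Rightarrow> pt set \<Rightarrow> mesh \<Rightarrow> (pt set \<Rightarrow> pt set) \<Rightarrow> (pt \<Rightarrow> real) \<Rightarrow> (pt set \<Rightarrow> pt \<Rightarrow> real) set" where
  "W_space k \<Omega> \<T> \<Delta> g = {w.
      (\<forall>T. T \<notin> \<T> \<longrightarrow> w T = (\<lambda>_. 0)) \<and>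
      (\<forall>T\<in>\<T>. w T \<in> polys k) \<and>
      (\<forall>N \<in> (\<Union>T\<in>\<T>. lattice_points k T) - (mesh_boundary \<T> - boundary_vertices \<T>).
          \<forall>T\<in>\<T>. \<forall>T'\<in>\<T>. N \<in> T \<and> N \<in> T' \<longrightarrow> w T N = w T' N) \<and>
      (\<forall>S\<in>boundary_vertices \<T>. \<forall>T\<in>\<T>. S \<in> T \<longrightarrow> w T S = g S) \<and>
      (\<forall>T\<in>face_elements \<T>. \<forall>M\<in>lattice_points k (boundary_face \<T> T).
          (\<forall>e. e edge_of boundary_face \<T> T \<longrightarrow> M \<notin> e) \<longrightarrow>
          (\<forall>P. nearest_intersection (frontier \<Omega>) (affine hull {inner_vertex \<Omega> T, M}) M P
               \<longrightarrow> w T P = g P)) \<and>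
      (\<forall>T\<in>face_elements \<T> \<union> edge_elements \<T>. \<forall>e. e edge_of T \<and> e \<subseteq> mesh_boundary \<T> \<longrightarrow>
          (\<forall>M\<in>lattice_points k e. \<not> M extreme_point_of e \<longrightarrow>
            (\<forall>Q. nearest_intersection (frontier \<Omega>) (orthogonal_line (\<Delta> e) e M) M Q
                 \<longrightarrow> w T Q = g Q)))}"

section \<open>Forms and norms\<close>

definition gradient :: "(pt \<Rightarrow> real) \<Rightarrow> pt \<Rightarrow> pt" where
  "gradient f x = (if f differentiable (at x) then THE D. GDERIV f x :> D else 0)"

definition broken_gradient :: "mesh \<Rightarrow> (pt set \<Rightarrow> pt \<Rightarrow> real) \<Rightarrow> pt \<Rightarrow> pt" where
  "broken_gradient \<T> w x = (\<Sum>T\<in>\<T>. indicator (interior T) x *\<^sub>R gradient (w T) x)"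

text \<open>The functions of \<open>V_space\<close> are differentiable off the skeleton of the mesh, which is
  negligible, so that their gradient is the pointwise one almost everywhere; it is integrated with
  respect to the completed Lebesgue measure.\<close>

definition a_form :: "mesh \<Rightarrow> (pt set \<Rightarrow> pt \<Rightarrow> real) \<Rightarrow> (pt \<Rightarrow> real) \<Rightarrow> real" where
  "a_form \<T> w v = (LINT x:mesh_domain \<T>|lebesgue. broken_gradient \<T> w x \<bullet> gradient v x)"

definition L2_norm_on :: "pt set \<Rightarrow> (pt \<Rightarrow> pt) \<Rightarrow> real" where
  "L2_norm_on D u = sqrt (LINT x:D|lebesgue. (norm (u x))\<^sup>2)"

end

theory Submission
  imports Defs
begin

text \<open>
Let \<open>w\<close> be a non-conforming function with vanishing boundary data.  Its natural partner \<open>v\<close> in the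
conforming space is the Lagrange interpolant of \<open>w\<close> in which the values at all nodes lying on the
boundary \<open>\<Gamma>\<^sub>h\<close> of the polyhedron are replaced by zero (\<open>clipped\<close>, made into one function by
\<open>glue\<close>).  On an element \<open>T\<close> the difference \<open>w - v\<close> is the sum of \<open>w\<^sub>T(N) \<phi>\<^sub>N\<close> over the nodes
\<open>N \<in> T\<close> on \<open>\<Gamma>\<^sub>h\<close>, so everything depends on the smallness of the numbers \<open>w\<^sub>T(N)\<close>.

The conditions that define the non-conforming space say that \<open>w\<^sub>T\<close> vanishes at a point \<open>P\<close> of the
true boundary \<open>\<Gamma>\<close> close to \<open>N\<close>, and the distance of \<open>N\<close> and \<open>P\<close> is small compared with the diameter
\<open>h\<^sub>T\<close>.  Indeed, \<open>\<Gamma>\<close> is locally the zero set of a function \<open>f\<close> that differs from an affine function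
with unit gradient \<open>g\<close> only by a Lipschitz perturbation with small constant \<open>\<eta>\<close>
(\<open>uniform_local_chart\<close>).  Since \<open>f\<close> vanishes at the vertices of the face or edge that carries \<open>N\<close>,
it is \<open>O(\<eta> h\<^sub>T)\<close> at \<open>N\<close>.  The line along which \<open>P\<close> is sought is transversal to \<open>\<Gamma>\<close>: for faces, and
for edges whose plane contains a common face, because the inscribed ball keeps the apex away from
the tangent plane; for planes close to the bisector, because both outward normals are close to
\<open>- g\<close>, hence so is their direction.  The intermediate value theorem then produces a zero of
\<open>f\<close> at distance \<open>O(\<eta> h\<^sub>T)\<close> (\<open>face_intersection\<close>, \<open>edge_intersection\<close>).

It follows that \<open>w\<^sub>T(N)\<close> is bounded by the length of the segment from \<open>N\<close> to \<open>P\<close> times the maximum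
of the gradient near \<open>T\<close>.  The inverse estimate for polynomials on shape-regular tetrahedra
(\<open>inverse_estimate\<close>) and the Lipschitz bound for the basis functions turn this into an estimate of
\<open>grad (w - v)\<close> by \<open>grad w\<close> in \<open>L\<^sup>2(T)\<close> with a factor proportional to \<open>\<eta>\<close> (\<open>correction_estimate\<close>),
thus with factor \<open>1/2\<close> if \<open>h\<close> is small.  Summation over the elements gives
\<open>a\<^sub>h(w, v) \<ge> \<parallel>grad w\<parallel>\<^sup>2 / 2\<close> and \<open>\<parallel>grad v\<parallel> \<le> 2 \<parallel>grad w\<parallel>\<close>, hence the quotient is at least \<open>1/4\<close>
(\<open>inf_sup_quotient\<close>).  Finally \<open>\<parallel>grad w\<parallel>\<close> cannot vanish unless \<open>w = 0\<close>: otherwise \<open>v = w\<close> would be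
continuous, piecewise constant and zero on \<open>\<Gamma>\<^sub>h\<close>.

The estimates for polynomials rest on one identity.  Lagrange interpolation on the principal
lattice reproduces polynomials (\<open>polys_reproduction\<close>), also after a translation and dilation of the
argument.  It yields the unisolvence behind the construction of \<open>v\<close> as well as the inverse estimate,
with constants that depend on the degree and the shape parameter only.
\<close>

section \<open>Multi-indices and a multivariate Vandermonde identity\<close>

text \<open>
The support condition makes each multi-index on \<open>V\<close> a single function, so that summing over this
set counts every lattice point of a simplex once, and multi-indices on a face are multi-indices on
the whole simplex.
\<close>

definition multi_indices :: "'s set \<Rightarrow> nat \<Rightarrow> ('s \<Rightarrow> nat) set" where
  "multi_indices V n = {a. (\<forall>S. S \<notin> V \<longrightarrow> a S = 0) \<and> sum a V = n}"

lemma finite_multi_indices: "finite V \<Longrightarrow> finite (multi_indices V n)"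
proof -
  assume V: "finite V"
  have "multi_indices V n \<subseteq> {a. \<forall>S. (S \<in> V \<longrightarrow> a S \<in> {..n}) \<and> (S \<notin> V \<longrightarrow> a S = 0)}"
    using V by (auto simp: multi_indices_def member_le_sum)
  then show ?thesis
    by (rule finite_subset) (rule finite_set_of_finite_funs, use V in auto)
qed

lemma multi_indices_le: "finite V \<Longrightarrow> a \<in> multi_indices V n \<Longrightarrow> a S \<le> n"
  by (cases "S \<in> V") (auto simp: multi_indices_def member_le_sum)

lemma sum_multi_indices_insert:
  fixes f :: "('s \<Rightarrow> nat) \<Rightarrow> real"
  assumes V: "finite V" "S \<notin> V"
  shows "(\<Sum>a\<in>multi_indices (insert S V) n. f a) = (\<Sum>j\<le>n. \<Sum>a\<in>multi_indices V (n - j). f (a(S := j)))"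
proof -
  have *: "(\<Sum>R\<in>V. if R = S then j else b R) = sum b V" for b :: "'s \<Rightarrow> nat" and j
    using V by (intro sum.cong) auto
  have "(\<Sum>j\<le>n. \<Sum>a\<in>multi_indices V (n - j). f (a(S := j)))
      = (\<Sum>(j, a)\<in>Sigma {..n} (\<lambda>j. multi_indices V (n - j)). f (a(S := j)))"
    using V by (intro sum.Sigma) (auto simp: finite_multi_indices)
  also have "\<dots> = (\<Sum>a\<in>multi_indices (insert S V) n. f a)"
  proof (rule sum.reindex_bij_witness
      [where j = "\<lambda>(j, a). a(S := j)" and i = "\<lambda>a. (a S, a(S := 0))"], goal_cases)
    case (1 x)
    then show ?case using V by (auto simp: multi_indices_def)
  next
    case (2 x)
    show ?case using V 2 by (auto simp: multi_indices_def *)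
  next
    case (3 a)
    then show ?case by auto
  next
    case (4 a)
    show ?case using V 4 by (auto simp: multi_indices_def *)
  next
    case (5 x)
    then show ?case by auto
  qed
  finally show ?thesis by simp
qed

lemma multi_Vandermonde:
  fixes t :: "'s \<Rightarrow> real"
  assumes "finite V"
  shows "(\<Sum>a\<in>multi_indices V n. \<Prod>S\<in>V. t S gchoose a S) = sum t V gchoose n"
  using assms
proof (induction V arbitrary: n rule: finite_induct)
  case empty
  have "multi_indices ({} :: 's set) n = (if n = 0 then {\<lambda>_. 0} else {})" by (auto simp: multi_indices_def)
  then have "card (multi_indices ({} :: 's set) n) = (if n = 0 then 1 else 0)" by (simp only: split: if_splits) auto
  then show ?case by (simp add: gbinomial_0_left)
next
  case (insert S V)
  have *: "(\<Prod>R\<in>insert S V. t R gchoose (a(S := j)) R) = (t S gchoose j) * (\<Prod>R\<in>V. t R gchoose a R)"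
    for a j
  proof -
    have "(\<Prod>R\<in>V. t R gchoose (a(S := j)) R) = (\<Prod>R\<in>V. t R gchoose a R)"
      using insert by (intro prod.cong) auto
    then show ?thesis using insert by simp
  qed
  have "(\<Sum>a\<in>multi_indices (insert S V) n. \<Prod>R\<in>insert S V. t R gchoose a R)
     = (\<Sum>j\<le>n. \<Sum>a\<in>multi_indices V (n - j). (t S gchoose j) * (\<Prod>R\<in>V. t R gchoose a R))"
    using insert by (subst sum_multi_indices_insert) (simp_all only: * not_False_eq_True)
  also have "\<dots> = (\<Sum>j\<le>n. (t S gchoose j) * (sum t V gchoose (n - j)))"
    using insert by (simp flip: sum_distrib_left)
  also have "\<dots> = (t S + sum t V) gchoose n"
    using gbinomial_Vandermonde[of "t S" "sum t V" n] by (simp only: atLeast0AtMost)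
  finally show ?case using insert by simp
qed

text \<open>
The interpolation identity in binomial form, with \<open>t\<close> in the role of \<open>k\<close> times the barycentric
coordinates: the product of the \<open>t S gchoose b S\<close> is reproduced from its values \<open>t = a\<close> at the lattice
points.  Trinomial revision extracts this product from each summand, and the remaining sum is a
Vandermonde sum with value \<open>(k - m) gchoose (k - m) = 1\<close>.
\<close>

lemma gbinomial_partition_of_unity:
  fixes t :: "'s \<Rightarrow> real"
  assumes V: "finite V" and b: "b \<in> multi_indices V m" and m: "m \<le> k" and t: "sum t V = real k"
  shows "(\<Sum>a\<in>multi_indices V k. (\<Prod>S\<in>V. real (a S) gchoose b S) * (\<Prod>S\<in>V. t S gchoose a S))
       = (\<Prod>S\<in>V. t S gchoose b S)"
proof -
  let ?F = "\<lambda>a. (\<Prod>S\<in>V. real (a S) gchoose b S) * (\<Prod>S\<in>V. t S gchoose a S)"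
  have z: "?F a = 0" if "a \<in> multi_indices V k" and ab: "\<not> (\<forall>S. b S \<le> a S)" for a
  proof -
    obtain S where S: "a S < b S" using ab by (auto simp: not_le)
    with b have "S \<in> V" by (auto simp: multi_indices_def)
    moreover have "real (a S) gchoose b S = 0" using S by (simp flip: binomial_gbinomial)
    ultimately have "(\<Prod>S\<in>V. real (a S) gchoose b S) = 0" using V by (auto intro: prod_zero)
    then show ?thesis by simp
  qed
  have "(\<Sum>a\<in>multi_indices V k. ?F a) = (\<Sum>a\<in>{a \<in> multi_indices V k. \<forall>S. b S \<le> a S}. ?F a)"
    using z V by (intro sum.mono_neutral_right) (auto simp: finite_multi_indices)
  also have "\<dots> = (\<Sum>c\<in>multi_indices V (k - m). (\<Prod>S\<in>V. t S gchoose b S) * (\<Prod>S\<in>V. (t S - real (b S)) gchoose c S))"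
  proof (rule sum.reindex_bij_witness[where j = "\<lambda>a S. a S - b S" and i = "\<lambda>c S. b S + c S"], goal_cases)
    case (1 a) then show ?case by auto
  next
    case (2 a)
    then have "sum (\<lambda>S. a S - b S) V = sum a V - sum b V"
      by (subst sum_subtractf_nat) auto
    then show ?case using 2 b by (auto simp: multi_indices_def)
  next
    case (3 c) then show ?case by auto
  next
    case (4 c)
    then show ?case using b m by (auto simp: multi_indices_def sum.distrib)
  next
    case (5 a)
    have "(t S gchoose b S) * ((t S - real (b S)) gchoose (a S - b S)) = (real (a S) gchoose b S) * (t S gchoose a S)" for S
      using gbinomial_trinomial_revision[of "b S" "a S" "t S"] 5 by (simp add: mult.commute)
    then show ?case by (simp flip: prod.distrib)
  qed
  also have "\<dots> = (\<Prod>S\<in>V. t S gchoose b S) * (sum (\<lambda>S. t S - real (b S)) V gchoose (k - m))"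
    using V by (simp add: multi_Vandermonde flip: sum_distrib_left)
  also have "sum (\<lambda>S. t S - real (b S)) V = real (k - m)"
    using b t m by (simp add: sum_subtractf multi_indices_def flip: of_nat_sum)
  also have "real (k - m) gchoose (k - m) = 1" by (simp flip: binomial_gbinomial)
  finally show ?thesis by simp
qed

section \<open>Polynomials of bounded degree\<close>

text \<open>
Products of \<open>m\<close> affine functions.  They span the polynomials of degree at most \<open>m\<close>, are stable under
affine substitutions, and admit induction one factor at a time.
\<close>

inductive affine_product :: "nat \<Rightarrow> (pt \<Rightarrow> real) \<Rightarrow> bool" where
  affine_product_1: "affine_product 0 (\<lambda>_. 1)"
| affine_product_mult: "affine_product m q \<Longrightarrow> affine_product (Suc m) (\<lambda>x. (c + n \<bullet> x) * q x)"

lemma affine_product_times: "affine_product m p \<Longrightarrow> affine_product l q \<Longrightarrow> affine_product (m + l) (\<lambda>x. p x * q x)"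
proof (induction rule: affine_product.induct)
  case affine_product_1 then show ?case by simp
next
  case (affine_product_mult m p c n)
  from affine_product.affine_product_mult[OF affine_product_mult.IH[OF affine_product_mult.prems], of c n]
  show ?case by (simp add: mult.assoc)
qed

lemma affine_product_power: "affine_product m (\<lambda>x. (c + n \<bullet> x) ^ m)"
proof (induction m)
  case 0 then show ?case using affine_product_1 by simp
next
  case (Suc m) show ?case using affine_product.affine_product_mult[OF Suc, of c n] by simp
qed

lemma prod_UNIV_3: "(\<Prod>i\<in>UNIV. f (i :: 3)) = f 1 * f 2 * (f 3 :: real)"
  unfolding UNIV_3 by simp

text \<open>
The argument \<open>y + s x\<close> instead of \<open>x\<close> is what later makes the reproduction formula invariant under
translations and dilations.
\<close>

lemma affine_product_monomial:
  "affine_product (\<Sum>i\<in>UNIV. a i) (\<lambda>x. \<Prod>i\<in>UNIV. ((y + s *\<^sub>R x) $ i) ^ a (i :: 3))"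
proof -
  have "affine_product (a i) (\<lambda>x. ((y + s *\<^sub>R x) $ i) ^ a i)" for i
    using affine_product_power[of "a i" "y $ i" "s *\<^sub>R axis i 1"] by (simp add: inner_axis')
  from affine_product_times[OF affine_product_times[OF this[of 1] this[of 2]] this[of 3]]
  show ?thesis by (simp only: sum_3 prod_UNIV_3 add.assoc mult.assoc)
qed

lemma finite_exponents: "finite {a :: 3 \<Rightarrow> nat. (\<Sum>i\<in>UNIV. a i) \<le> k}"
proof -
  have "{a :: 3 \<Rightarrow> nat. (\<Sum>i\<in>UNIV. a i) \<le> k} = (\<Union>j\<le>k. multi_indices UNIV j)" by (auto simp: multi_indices_def)
  then show ?thesis by (auto simp: finite_multi_indices)
qed

lemma polys_const: "(\<lambda>_. c) \<in> polys k"
proof -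
  have "(\<Sum>a | (\<Sum>i\<in>UNIV. a i) \<le> k. (if a = (\<lambda>_. 0) then c else 0) * (\<Prod>i\<in>UNIV. (x $ i) ^ a i)) = c" for x :: pt
  proof -
    have "(\<Sum>a | (\<Sum>i\<in>UNIV. a i) \<le> k. (if a = (\<lambda>_. 0) then c else 0) * (\<Prod>i\<in>UNIV. (x $ i) ^ a i))
       = (\<Sum>a :: 3 \<Rightarrow> nat | (\<Sum>i\<in>UNIV. a i) \<le> k. (if a = (\<lambda>_. 0) then c else 0))"
      by (intro sum.cong) auto
    then show ?thesis using finite_exponents[of k] by simp
  qed
  then show ?thesis unfolding polys_def
    by (intro CollectI exI[of _ "\<lambda>a. if a = (\<lambda>_. 0) then c else 0"]) (simp only:, simp)
qed

lemma polys_add: "p \<in> polys k \<Longrightarrow> q \<in> polys k \<Longrightarrow> (\<lambda>x. p x + q x) \<in> polys k"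
  unfolding polys_def by safe (rule_tac x = "\<lambda>a. c a + ca a" in exI, simp add: sum.distrib algebra_simps)

lemma polys_cmult: "p \<in> polys k \<Longrightarrow> (\<lambda>x. r * p x) \<in> polys k"
  unfolding polys_def by safe (rule_tac x = "\<lambda>a. r * c a" in exI, simp add: sum_distrib_left algebra_simps)

lemma polys_sum: "(\<And>i. i \<in> A \<Longrightarrow> p i \<in> polys k) \<Longrightarrow> (\<lambda>x. \<Sum>i\<in>A. p i x) \<in> polys k"
proof (induction A rule: infinite_finite_induct)
  case (insert a A)
  then show ?case by (simp add: polys_add)
qed (auto intro: polys_const)

lemma polys_monomial:
  assumes "(\<Sum>i\<in>UNIV. b i) \<le> k"
  shows "(\<lambda>x :: pt. \<Prod>i\<in>UNIV. (x $ i) ^ b i) \<in> polys k"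
proof -
  have "(\<Sum>a | (\<Sum>i\<in>UNIV. a i) \<le> k. of_bool (a = b) * (\<Prod>i\<in>UNIV. (x $ i) ^ a i)) = (\<Prod>i\<in>UNIV. (x $ i) ^ b i)" for x :: pt
  proof -
    have "(\<Sum>a | (\<Sum>i\<in>UNIV. a i) \<le> k. of_bool (a = b) * (\<Prod>i\<in>UNIV. (x $ i) ^ a i))
       = (\<Sum>a | (\<Sum>i\<in>UNIV. a i) \<le> k. if a = b then (\<Prod>i\<in>UNIV. (x $ i) ^ b i) else 0)"
      by (intro sum.cong) auto
    then show ?thesis using finite_exponents[of k] assms by simp
  qed
  then show ?thesis unfolding polys_def
    by (intro CollectI exI[of _ "\<lambda>a. of_bool (a = b)"]) (simp only:, simp)
qed

lemma polys_coordinate_mult: "p \<in> polys k \<Longrightarrow> (\<lambda>x. x $ j * p x) \<in> polys (Suc k)"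
proof -
  assume "p \<in> polys k"
  then obtain c where c: "\<And>x. p x = (\<Sum>a | (\<Sum>i\<in>UNIV. a i) \<le> k. c a * (\<Prod>i\<in>UNIV. (x $ i) ^ a i))"
    by (auto simp: polys_def)
  have *: "x $ j * (\<Prod>i\<in>UNIV. (x $ i) ^ a i) = (\<Prod>i\<in>UNIV. (x $ i) ^ (a i + of_bool (i = j)))" for x :: pt and a
  proof -
    have "(\<Prod>i\<in>UNIV. (x $ i) ^ (of_bool (i = j) :: nat)) = (\<Prod>i\<in>UNIV. if i = j then x $ j else 1)"
      by (intro prod.cong) auto
    then show ?thesis by (simp add: power_add prod.distrib)
  qed
  have "(\<lambda>x. x $ j * p x) = (\<lambda>x. \<Sum>a | (\<Sum>i\<in>UNIV. a i) \<le> k. c a * (\<Prod>i\<in>UNIV. (x $ i) ^ (a i + of_bool (i = j))))"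
    by (auto simp: c sum_distrib_left * [symmetric] intro!: ext sum.cong)
  also have "\<dots> \<in> polys (Suc k)"
    by (intro polys_sum polys_cmult polys_monomial) (simp add: sum.distrib)
  finally show ?thesis .
qed

lemma polys_mono: "m \<le> k \<Longrightarrow> p \<in> polys m \<Longrightarrow> p \<in> polys k"
proof -
  assume "m \<le> k" "p \<in> polys m"
  then obtain c where c: "\<And>x. p x = (\<Sum>a | (\<Sum>i\<in>UNIV. a i) \<le> m. c a * (\<Prod>i\<in>UNIV. (x $ i) ^ a i))"
    by (auto simp: polys_def)
  have "(\<lambda>x. \<Sum>a | (\<Sum>i\<in>UNIV. a i) \<le> m. c a * (\<Prod>i\<in>UNIV. (x $ i) ^ a i)) \<in> polys k"
    using \<open>m \<le> k\<close> by (intro polys_sum polys_cmult polys_monomial) auto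
  moreover have "p = (\<lambda>x. \<Sum>a | (\<Sum>i\<in>UNIV. a i) \<le> m. c a * (\<Prod>i\<in>UNIV. (x $ i) ^ a i))" using c by auto
  ultimately show ?thesis by simp
qed

lemma affine_product_imp_polys: "affine_product m p \<Longrightarrow> p \<in> polys m"
proof (induction rule: affine_product.induct)
  case affine_product_1 then show ?case by (rule polys_const)
next
  case (affine_product_mult m q c n)
  have eq: "(c + n \<bullet> x) * q x = c * q x + (\<Sum>j\<in>UNIV. n $ j * (x $ j * q x))" for x
    by (simp add: inner_vec_def algebra_simps sum_distrib_left sum_distrib_right)
  show ?case unfolding eq
    using affine_product_mult.IH
    by (intro polys_add polys_cmult polys_sum polys_coordinate_mult) (auto intro: polys_mono[of m "Suc m"])
qed

lemma affine_product_differentiable: "affine_product m p \<Longrightarrow> p differentiable (at x)"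
proof (induction rule: affine_product.induct)
  case (affine_product_mult m q c n)
  then show ?case by (intro differentiable_mult differentiable_add differentiable_inner) auto
qed simp

lemma polys_differentiable: "p \<in> polys k \<Longrightarrow> p differentiable (at x)"
proof -
  assume "p \<in> polys k"
  then obtain c where c: "\<And>x. p x = (\<Sum>a | (\<Sum>i\<in>UNIV. a i) \<le> k. c a * (\<Prod>i\<in>UNIV. (x $ i) ^ a i))"
    by (auto simp: polys_def)
  then have "p = (\<lambda>x. \<Sum>a | (\<Sum>i\<in>UNIV. a i) \<le> k. c a * (\<Prod>i\<in>UNIV. (x $ i) ^ a i))" by auto
  moreover have "(\<lambda>x :: pt. \<Prod>i\<in>UNIV. (x $ i) ^ a i) differentiable (at x)" for a
    using affine_product_differentiable[OF affine_product_monomial[of a 0 1]] by simp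
  ultimately show ?thesis
    by (simp add: finite_exponents differentiable_sum)
qed

section \<open>Barycentric coordinates\<close>

definition verts :: "pt set \<Rightarrow> pt set" where
  "verts T = {S. S extreme_point_of T}"

lemma verts_convex_hull: "\<not> affine_dependent V \<Longrightarrow> verts (convex hull V) = V"
  by (auto simp: verts_def extreme_point_of_convex_hull_affine_independent)

lemma tetrahedron_verts:
  assumes "3 simplex T"
  shows "finite (verts T)" "\<not> affine_dependent (verts T)" "card (verts T) = 4"
    "convex hull verts T = T"
proof -
  obtain C where C: "\<not> affine_dependent C" "int (card C) = 3 + 1" "T = convex hull C"
    using assms by (auto simp: simplex_def)
  then have "verts T = C" by (simp add: verts_convex_hull)
  then show "finite (verts T)" "\<not> affine_dependent (verts T)" "card (verts T) = 4"
    "convex hull verts T = T"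
    using C aff_independent_finite by auto
qed

lemma face_verts:
  assumes "3 simplex T" "\<Phi> face_of T"
  shows "verts \<Phi> \<subseteq> verts T" "convex hull verts \<Phi> = \<Phi>" "verts \<Phi> = verts T \<inter> \<Phi>"
    "\<not> affine_dependent (verts \<Phi>)"
proof -
  note V = tetrahedron_verts[OF assms(1)]
  obtain W where W: "W \<subseteq> verts T" "\<Phi> = convex hull W"
    using face_of_convex_hull_affine_independent[OF V(2)] assms(2) V(4) by auto
  have "\<not> affine_dependent W" using V(2) W(1) affine_dependent_subset by blast
  then have eq: "verts \<Phi> = W" by (simp add: W verts_convex_hull)
  show "verts \<Phi> \<subseteq> verts T" "convex hull verts \<Phi> = \<Phi>" using eq W by auto
  show "\<not> affine_dependent (verts \<Phi>)" using eq \<open>\<not> affine_dependent W\<close> by simp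
  show "verts \<Phi> = verts T \<inter> \<Phi>"
    using extreme_point_of_face[OF assms(2)] by (auto simp: verts_def)
qed

text \<open>
The affine function with value one at \<open>S\<close> and zero at the other points of \<open>V\<close>.  If \<open>V\<close> does not span
the space, this only determines the values on the affine hull of \<open>V\<close>; a face of a tetrahedron can
thus be treated by the same definition.
\<close>

definition bary :: "pt set \<Rightarrow> pt \<Rightarrow> pt \<Rightarrow> real" where
  "bary V S = (SOME l. (\<exists>c n. \<forall>x. l x = c + n \<bullet> x) \<and> (\<forall>R\<in>V. l R = of_bool (R = S)))"

lemma bary_exists:
  assumes V: "\<not> affine_dependent V" "S \<in> V"
  shows "(\<exists>c n. \<forall>x. bary V S x = c + n \<bullet> x) \<and> (\<forall>R\<in>V. bary V S R = of_bool (R = S))"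
proof -
  have "independent ((\<lambda>x. - S + x) ` (V - {S}))"
    using V affine_dependent_iff_dependent2 by blast
  then obtain g :: "pt \<Rightarrow> real" where g: "linear g" "\<forall>x\<in>(\<lambda>x. - S + x) ` (V - {S}). g x = -1"
    using linear_independent_extend[of _ "\<lambda>_. -1 :: real"] by blast
  obtain n where n: "g = (\<lambda>x. n \<bullet> x)"
  proof
    show "g = (\<lambda>x. adjoint g 1 \<bullet> x)"
      using adjoint_works[OF g(1), of _ 1] by (auto simp: inner_commute)
  qed
  let ?l = "\<lambda>x. (1 - n \<bullet> S) + n \<bullet> x"
  have "?l R = of_bool (R = S)" if "R \<in> V" for R
  proof (cases "R = S")
    case False
    with g(2) that have "n \<bullet> (- S + R) = -1" by (auto simp: n)
    with False show ?thesis by (simp add: inner_diff_right)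
  qed simp
  then have "(\<exists>c n. \<forall>x. ?l x = c + n \<bullet> x) \<and> (\<forall>R\<in>V. ?l R = of_bool (R = S))" by blast
  then show ?thesis unfolding bary_def
    by (rule someI[where P = "\<lambda>l. (\<exists>c n. \<forall>x. l x = c + n \<bullet> x) \<and> (\<forall>R\<in>V. l R = of_bool (R = S))"])
qed

lemma bary_affine:
  assumes "\<not> affine_dependent V" "S \<in> V"
  obtains c n where "\<And>x. bary V S x = c + n \<bullet> x"
  using bary_exists[OF assms] by blast

lemma affine_fun_combination:
  fixes x :: "'b::real_inner"
  assumes "finite V" "sum u V = 1"
  shows "c + n \<bullet> (\<Sum>R\<in>V. u R *\<^sub>R f R) = (\<Sum>R\<in>V. u R * (c + n \<bullet> (f R :: 'b)))"
  using assms by (simp add: inner_sum_right distrib_left sum.distrib flip: sum_distrib_right)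

lemma bary_combination:
  assumes "\<not> affine_dependent V" "S \<in> V" "sum u V = 1"
  shows "bary V S (\<Sum>R\<in>V. u R *\<^sub>R R) = u S"
proof -
  have fin: "finite V" using assms aff_independent_finite by blast
  obtain c n where cn: "\<And>x. bary V S x = c + n \<bullet> x" using bary_affine assms by blast
  have "bary V S (\<Sum>R\<in>V. u R *\<^sub>R R) = (\<Sum>R\<in>V. u R * bary V S R)"
    unfolding cn by (rule affine_fun_combination) (use fin assms in auto)
  also have "\<dots> = (\<Sum>R\<in>V. if R = S then u R else 0)"
    using bary_exists[OF assms(1,2)] by (intro sum.cong) auto
  finally show ?thesis using fin assms by simp
qed

lemma bary_tetrahedron:
  fixes x :: pt
  assumes V: "\<not> affine_dependent V" "card V = 4"
  shows "(\<Sum>S\<in>V. bary V S x) = 1" "(\<Sum>S\<in>V. bary V S x *\<^sub>R S) = x"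
proof -
  have fin: "finite V" using assms aff_independent_finite by blast
  have "aff_dim V = 3" using aff_dim_affine_independent[OF V(1)] V(2) by simp
  then have "affine hull V = UNIV" by (simp add: aff_dim_eq_full flip: aff_dim_eq_full)
  then have "x \<in> affine hull V" by simp
  then obtain u where u: "sum u V = 1" "(\<Sum>R\<in>V. u R *\<^sub>R R) = x"
    using fin by (auto simp: affine_hull_finite)
  have "bary V S x = u S" if "S \<in> V" for S
    using bary_combination[OF V(1) that u(1)] u(2) by simp
  then show "(\<Sum>S\<in>V. bary V S x) = 1" "(\<Sum>S\<in>V. bary V S x *\<^sub>R S) = x" using u by auto
qed

lemma bary_on_face:
  assumes V: "\<not> affine_dependent V" and W: "W \<subseteq> V" and x: "x \<in> convex hull W" and S: "S \<in> V"
  shows "bary V S x = (if S \<in> W then bary W S x else 0)" "0 \<le> bary V S x" "bary V S x \<le> 1"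
proof -
  have fin: "finite V" "finite W" using V W aff_independent_finite finite_subset by blast+
  have Wi: "\<not> affine_dependent W" using V W affine_dependent_subset by blast
  obtain u where u: "\<And>R. R \<in> W \<Longrightarrow> 0 \<le> u R" "sum u W = 1" "(\<Sum>R\<in>W. u R *\<^sub>R R) = x"
    using x fin by (auto simp: convex_hull_finite)
  let ?u = "\<lambda>R. if R \<in> W then u R else 0"
  have "sum ?u V = sum ?u W" "(\<Sum>R\<in>V. ?u R *\<^sub>R R) = (\<Sum>R\<in>W. ?u R *\<^sub>R R)"
    using fin W by (intro sum.mono_neutral_right; auto)+
  then have "sum ?u V = 1" "(\<Sum>R\<in>V. ?u R *\<^sub>R R) = x" using u by simp_all
  from bary_combination[OF V S this(1)] this(2) have b: "bary V S x = ?u S" by simp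
  moreover have "u S \<le> 1" if "S \<in> W" using member_le_sum[of S W u] u fin that by auto
  ultimately show "bary V S x = (if S \<in> W then bary W S x else 0)" "0 \<le> bary V S x" "bary V S x \<le> 1"
    using bary_combination[OF Wi _ u(2)] u by auto
qed

text \<open>
The affine function takes values between \<open>0\<close> and \<open>1\<close> on the ball, so its slope is at most \<open>1 / r\<close>.
\<close>

lemma bary_Lipschitz:
  assumes V: "\<not> affine_dependent V" and S: "S \<in> V" and r: "0 < r" "cball c r \<subseteq> convex hull V"
  shows "\<bar>bary V S x - bary V S y\<bar> \<le> norm (x - y) / r"
proof -
  obtain d n where cn: "\<And>x. bary V S x = d + n \<bullet> x" using bary_affine V S by blast
  have "norm n \<le> 1 / r"
  proof (cases "n = 0")
    case False
    have b: "0 \<le> bary V S x \<and> bary V S x \<le> 1" if "x \<in> cball c r" for x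
      using bary_on_face[OF V subset_refl _ S] that r by blast
    have "bary V S (c + (r / norm n) *\<^sub>R n) - bary V S c = r * norm n"
      using False by (simp add: cn inner_add_right dot_square_norm power2_eq_square)
    moreover have "c + (r / norm n) *\<^sub>R n \<in> cball c r" "c \<in> cball c r"
      using False r by (auto simp: dist_norm)
    ultimately have "r * norm n \<le> 1" using b[of c] b[of "c + (r / norm n) *\<^sub>R n"] by linarith
    then show ?thesis using r by (simp add: field_simps)
  qed (use r in auto)
  have "\<bar>bary V S x - bary V S y\<bar> = \<bar>n \<bullet> (x - y)\<bar>" by (simp add: cn inner_diff_right)
  also have "\<dots> \<le> norm n * norm (x - y)" by (rule Cauchy_Schwarz_ineq2)
  also have "\<dots> \<le> (1 / r) * norm (x - y)" using \<open>norm n \<le> 1 / r\<close> by (rule mult_right_mono) auto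
  finally show ?thesis by simp
qed

section \<open>Lagrange interpolation on the principal lattice\<close>

definition node :: "nat \<Rightarrow> pt set \<Rightarrow> (pt \<Rightarrow> nat) \<Rightarrow> pt" where
  "node k V a = (\<Sum>S\<in>V. (real (a S) / real k) *\<^sub>R S)"

text \<open>
The basis function of the node with multi-index \<open>a\<close>.  At the lattice point with multi-index \<open>b\<close> its
value is the product of the \<open>b S choose a S\<close>, which is zero unless \<open>a = b\<close>.
\<close>

definition lagrange :: "nat \<Rightarrow> pt set \<Rightarrow> (pt \<Rightarrow> nat) \<Rightarrow> pt \<Rightarrow> real" where
  "lagrange k V a x = (\<Prod>S\<in>V. (real k * bary V S x) gchoose a S)"

lemma node_coefficients:
  assumes "0 < k" "a \<in> multi_indices V k"
  shows "(\<Sum>S\<in>V. real (a S) / real k) = 1"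
proof -
  have "(\<Sum>S\<in>V. real (a S)) = real k" using assms by (simp add: multi_indices_def flip: of_nat_sum)
  then show ?thesis using assms by (simp flip: sum_divide_distrib)
qed

lemma bary_node:
  assumes "0 < k" "\<not> affine_dependent V" "S \<in> V" "a \<in> multi_indices V k"
  shows "bary V S (node k V a) = real (a S) / real k"
  unfolding node_def using bary_combination[OF assms(2,3) node_coefficients[OF assms(1,4)]] by simp

lemma node_in_hull:
  assumes "0 < k" "finite V" "a \<in> multi_indices V k"
  shows "node k V a \<in> convex hull V"
  unfolding node_def using assms
  by (intro convex_sum) (auto simp: node_coefficients hull_inc)

lemma lattice_points_eq: "0 < k \<Longrightarrow> finite (verts T) \<Longrightarrow> lattice_points k T = node k (verts T) ` multi_indices (verts T) k"
proof (intro equalityI subsetI)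
  fix x assume k: "0 < k" and fin: "finite (verts T)" and "x \<in> lattice_points k T"
  then obtain a where a: "sum a (verts T) = k" "x = node k (verts T) a"
    by (auto simp: lattice_points_def verts_def node_def)
  let ?a = "\<lambda>S. if S \<in> verts T then a S else 0"
  have "?a \<in> multi_indices (verts T) k" "node k (verts T) ?a = x"
    using a by (auto simp: multi_indices_def node_def)
  then show "x \<in> node k (verts T) ` multi_indices (verts T) k" by blast
qed (auto simp: lattice_points_def verts_def node_def multi_indices_def)

lemma affine_product_gchoose:
  "affine_product j (\<lambda>x. (c + n \<bullet> x) gchoose j)"
proof (induction j)
  case 0 then show ?case using affine_product_1 by simp
next
  case (Suc j)
  have "(c + n \<bullet> x) gchoose Suc j
      = ((c - real j) / real (Suc j) + (n /\<^sub>R real (Suc j)) \<bullet> x) * ((c + n \<bullet> x) gchoose j)" for x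
  proof -
    have "((c + n \<bullet> x) gchoose Suc j) * (1 + real j) = ((c + n \<bullet> x) gchoose j) * (c + n \<bullet> x - real j)"
      using gbinomial_mult_1[of "c + n \<bullet> x" j] by (simp add: algebra_simps)
    then have "((c + n \<bullet> x) gchoose Suc j) = ((c + n \<bullet> x) gchoose j) * (c + n \<bullet> x - real j) / (1 + real j)"
      by (simp add: field_simps)
    moreover have "(c - real j) / real (Suc j) + (n /\<^sub>R real (Suc j)) \<bullet> x = (c + n \<bullet> x - real j) / (1 + real j)"
      by (simp add: divide_inverse algebra_simps)
    ultimately show ?thesis by simp
  qed
  then show ?case by (simp only: affine_product.affine_product_mult[OF Suc])
qed

lemma affine_product_lagrange:
  assumes "\<not> affine_dependent V"
  shows "affine_product (sum a V) (lagrange k V a)"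
proof -
  have *: "affine_product (a S) (\<lambda>x. (real k * bary V S x) gchoose a S)" if "S \<in> V" for S
  proof -
    obtain d n where cn: "\<And>x. bary V S x = d + n \<bullet> x" using bary_affine assms \<open>S \<in> V\<close> by blast
    show ?thesis using affine_product_gchoose[of "a S" "real k * d" "real k *\<^sub>R n"]
      by (simp add: cn distrib_left)
  qed
  have "finite W \<Longrightarrow> W \<subseteq> V \<Longrightarrow> affine_product (sum a W) (\<lambda>x. \<Prod>S\<in>W. (real k * bary V S x) gchoose a S)" for W
    by (induction W rule: finite_induct) (auto intro!: affine_product_1 affine_product_times *)
  from this[of V] show ?thesis using assms aff_independent_finite by (auto simp: lagrange_def[abs_def])
qed

lemma lagrange_polys: "\<not> affine_dependent V \<Longrightarrow> a \<in> multi_indices V k \<Longrightarrow> lagrange k V a \<in> polys k"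
  using affine_product_imp_polys[OF affine_product_lagrange[of V a k]] by (simp add: multi_indices_def)

text \<open>
On a face only the basis functions of the nodes of that face survive, and there they agree with the
basis functions of the face itself.  Conformity of interpolants across common faces and the boundary
condition of the clipped interpolant both come from this.
\<close>

lemma lagrange_trace:
  assumes V: "\<not> affine_dependent V" and W: "W \<subseteq> V" and x: "x \<in> convex hull W"
  shows "(\<Sum>a\<in>multi_indices V k. F a * lagrange k V a x) = (\<Sum>a\<in>multi_indices W k. F a * lagrange k W a x)"
proof -
  have fin: "finite V" "finite W" using V W aff_independent_finite finite_subset by blast+
  have sub: "multi_indices W k \<subseteq> multi_indices V k"
  proof
    fix a assume a: "a \<in> multi_indices W k"
    then have "sum a V = sum a W" using W fin by (intro sum.mono_neutral_right) (auto simp: multi_indices_def)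
    then show "a \<in> multi_indices V k" using a W by (auto simp: multi_indices_def)
  qed
  have z: "lagrange k V a x = 0" if a: "a \<in> multi_indices V k - multi_indices W k" for a
  proof -
    have "\<exists>S\<in>V - W. a S \<noteq> 0"
    proof (rule ccontr)
      assume no: "\<not> ?thesis"
      then have "sum a V = sum a W" using W fin by (intro sum.mono_neutral_right) auto
      moreover have "a S = 0" if "S \<notin> W" for S using a no that by (cases "S \<in> V") (auto simp: multi_indices_def)
      ultimately show False using a by (auto simp: multi_indices_def)
    qed
    then obtain S where S: "S \<in> V" "S \<notin> W" "a S \<noteq> 0" by auto
    then have "(real k * bary V S x) gchoose a S = 0"
      using bary_on_face(1)[OF V W x, of S] by (simp add: gbinomial_0_left)
    then show ?thesis unfolding lagrange_def using S fin by (auto intro: prod_zero)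
  qed
  have "lagrange k V a x = lagrange k W a x" if a: "a \<in> multi_indices W k" for a
  proof -
    have "lagrange k V a x = (\<Prod>S\<in>W. (real k * bary V S x) gchoose a S)"
      unfolding lagrange_def using W fin a by (intro prod.mono_neutral_right) (auto simp: multi_indices_def)
    also have "\<dots> = lagrange k W a x"
      unfolding lagrange_def using bary_on_face(1)[OF V W x] W by (intro prod.cong) auto
    finally show ?thesis .
  qed
  then have "(\<Sum>a\<in>multi_indices W k. F a * lagrange k W a x) = (\<Sum>a\<in>multi_indices W k. F a * lagrange k V a x)" by simp
  also have "\<dots> = (\<Sum>a\<in>multi_indices V k. F a * lagrange k V a x)"
    using sub z fin by (intro sum.mono_neutral_left) (auto simp: finite_multi_indices)
  finally show ?thesis by simp
qed

lemma node_trace: "finite V \<Longrightarrow> W \<subseteq> V \<Longrightarrow> a \<in> multi_indices W k \<Longrightarrow> node k V a = node k W a"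
  unfolding node_def by (intro sum.mono_neutral_right) (auto simp: multi_indices_def)

text \<open>
Interpolation is exact for products of a binomial basis function of order \<open>j\<close> with \<open>m\<close> affine
factors.  For \<open>m = 0\<close> this is \<open>gbinomial_partition_of_unity\<close>.  An affine factor is a combination of
the barycentric coordinates, and \<open>t (t gchoose n) = (n + 1) (t gchoose (n + 1)) + n (t gchoose n)\<close>
trades it for binomial factors of order at most \<open>j + 1\<close>, to which the induction hypothesis applies.
The case \<open>j = 0\<close> is the reproduction of polynomials.
\<close>

lemma affine_product_reproduction:
  assumes V: "\<not> affine_dependent V" "card V = 4" and k: "0 < k"
    and q: "affine_product m q" and b: "b \<in> multi_indices V j" "j + m \<le> k"
  shows "(\<Prod>S\<in>V. (real k * bary V S x) gchoose b S) * q x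
       = (\<Sum>a\<in>multi_indices V k. (\<Prod>S\<in>V. real (a S) gchoose b S) * q (node k V a) * lagrange k V a x)"
  using q b
proof (induction arbitrary: b j rule: affine_product.induct)
  case affine_product_1
  have fin: "finite V" using V aff_independent_finite by blast
  have "(\<Sum>S\<in>V. real k * bary V S x) = real k"
    using bary_tetrahedron(1)[OF V, of x] by (simp flip: sum_distrib_left)
  from gbinomial_partition_of_unity[OF fin affine_product_1(1) _ this] affine_product_1(2)
  show ?case by (simp add: lagrange_def)
next
  case (affine_product_mult m q c n)
  have fin: "finite V" using V aff_independent_finite by blast
  let ?l = "\<lambda>x. c + n \<bullet> x"
  let ?B = "\<lambda>b t. \<Prod>S\<in>V. t S gchoose b S"
  let ?t = "\<lambda>S. real k * bary V S x"
  let ?J = "\<lambda>b. \<Sum>a\<in>multi_indices V k. ?B b (\<lambda>S. real (a S)) * q (node k V a) * lagrange k V a x"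
  have step: "t R * ?B b t = (real (b R) + 1) * ?B (b(R := Suc (b R))) t + real (b R) * ?B b t"
    if "R \<in> V" for t :: "pt \<Rightarrow> real" and R
  proof -
    have "?B (b(R := Suc (b R))) t = (t R gchoose Suc (b R)) * (\<Prod>S\<in>V - {R}. t S gchoose b S)"
      by (subst prod.remove[OF fin that]) (auto intro: prod.cong)
    moreover have "?B b t = (t R gchoose b R) * (\<Prod>S\<in>V - {R}. t S gchoose b S)"
      by (subst prod.remove[OF fin that]) auto
    moreover have "t R * (t R gchoose b R) = (real (b R) + 1) * (t R gchoose Suc (b R)) + real (b R) * (t R gchoose b R)"
      using gbinomial_mult_1[of "t R" "b R"] by (simp add: algebra_simps)
    ultimately show ?thesis by algebra
  qed
  have up: "b(R := Suc (b R)) \<in> multi_indices V (Suc j)" if "R \<in> V" for R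
  proof -
    have "sum (b(R := Suc (b R))) V = Suc (b R) + sum b (V - {R})"
      by (subst sum.remove[OF fin that]) (auto intro: sum.cong)
    also have "\<dots> = Suc (sum b V)" using sum.remove[OF fin that, of b] by simp
    finally show ?thesis using affine_product_mult.prems(1) that by (auto simp: multi_indices_def)
  qed
  have l: "?l y = (\<Sum>R\<in>V. ?l R / real k * (real k * bary V R y))" for y
    using affine_fun_combination[OF fin bary_tetrahedron(1)[OF V, of y], of c n "\<lambda>R. R"]
      bary_tetrahedron(2)[OF V, of y] k by (simp add: mult.commute)
  have main: "?l y * ?B b (\<lambda>S. real k * bary V S y)
    = (\<Sum>R\<in>V. ?l R / real k * ((real (b R) + 1) * ?B (b(R := Suc (b R))) (\<lambda>S. real k * bary V S y)
         + real (b R) * ?B b (\<lambda>S. real k * bary V S y)))" for y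
  proof -
    have "?l y * ?B b (\<lambda>S. real k * bary V S y)
      = (\<Sum>R\<in>V. ?l R / real k * (real k * bary V R y)) * ?B b (\<lambda>S. real k * bary V S y)"
      using l[of y] by simp
    also have "\<dots> = (\<Sum>R\<in>V. ?l R / real k * (real k * bary V R y * ?B b (\<lambda>S. real k * bary V S y)))"
      unfolding sum_distrib_right by (simp only: mult.assoc)
    also have "\<dots> = (\<Sum>R\<in>V. ?l R / real k * ((real (b R) + 1) * ?B (b(R := Suc (b R))) (\<lambda>S. real k * bary V S y)
         + real (b R) * ?B b (\<lambda>S. real k * bary V S y)))"
      by (intro sum.cong refl arg_cong2[where f = "(*)"] step)
    finally show ?thesis .
  qed
  have nodeB: "?B e (\<lambda>S. real k * bary V S (node k V a)) = ?B e (\<lambda>S. real (a S))" if "a \<in> multi_indices V k" for a e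
    using bary_node[OF k V(1) _ that] k by (intro prod.cong) auto
  have "?B b ?t * (?l x * q x) = (?l x * ?B b ?t) * q x" by (simp add: algebra_simps)
  also have "\<dots> = (\<Sum>R\<in>V. ?l R / real k * ((real (b R) + 1) * (?B (b(R := Suc (b R))) ?t * q x)
         + real (b R) * (?B b ?t * q x)))"
    unfolding main sum_distrib_right by (intro sum.cong refl) (simp add: algebra_simps)
  also have "\<dots> = (\<Sum>R\<in>V. ?l R / real k * ((real (b R) + 1) * ?J (b(R := Suc (b R)))
         + real (b R) * ?J b))"
  proof (intro sum.cong refl)
    fix R assume R: "R \<in> V"
    have "?B (b(R := Suc (b R))) ?t * q x = ?J (b(R := Suc (b R)))"
      using affine_product_mult.IH[OF up[OF R]] affine_product_mult.prems by simp
    moreover have "?B b ?t * q x = ?J b"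
      using affine_product_mult.IH[OF affine_product_mult.prems(1)] affine_product_mult.prems by simp
    ultimately show "?l R / real k * ((real (b R) + 1) * (?B (b(R := Suc (b R))) ?t * q x)
         + real (b R) * (?B b ?t * q x)) = ?l R / real k * ((real (b R) + 1) * ?J (b(R := Suc (b R)))
         + real (b R) * ?J b)" by simp
  qed
  also have "\<dots> = (\<Sum>a\<in>multi_indices V k. (\<Sum>R\<in>V. ?l R / real k * ((real (b R) + 1) * ?B (b(R := Suc (b R))) (\<lambda>S. real (a S))
         + real (b R) * ?B b (\<lambda>S. real (a S)))) * q (node k V a) * lagrange k V a x)"
    unfolding sum_distrib_left sum_distrib_right sum.distrib[symmetric]
    by (subst sum.swap) (simp add: algebra_simps)
  also have "\<dots> = (\<Sum>a\<in>multi_indices V k. ?B b (\<lambda>S. real (a S)) * (?l (node k V a) * q (node k V a)) * lagrange k V a x)"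
  proof (intro sum.cong refl)
    fix a assume a: "a \<in> multi_indices V k"
    show "(\<Sum>R\<in>V. ?l R / real k * ((real (b R) + 1) * ?B (b(R := Suc (b R))) (\<lambda>S. real (a S))
         + real (b R) * ?B b (\<lambda>S. real (a S)))) * q (node k V a) * lagrange k V a x
      = ?B b (\<lambda>S. real (a S)) * (?l (node k V a) * q (node k V a)) * lagrange k V a x"
      unfolding main[of "node k V a", unfolded nodeB[OF a], symmetric] by (simp only: ac_simps)
  qed
  finally show ?case .
qed

lemma polys_reproduction:
  assumes V: "\<not> affine_dependent V" "card V = 4" and k: "0 < k" and p: "p \<in> polys k"
  shows "p (y + s *\<^sub>R x) = (\<Sum>a\<in>multi_indices V k. p (y + s *\<^sub>R node k V a) * lagrange k V a x)"
proof -
  obtain c where c: "\<And>x. p x = (\<Sum>e | (\<Sum>i\<in>UNIV. e i) \<le> k. c e * (\<Prod>i\<in>UNIV. (x $ i) ^ e i))"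
    using p by (auto simp: polys_def)
  let ?m = "\<lambda>e x. \<Prod>i\<in>UNIV. ((y + s *\<^sub>R x) $ i) ^ e i"
  have m: "?m e x = (\<Sum>a\<in>multi_indices V k. ?m e (node k V a) * lagrange k V a x)" if "(\<Sum>i\<in>UNIV. e i) \<le> k" for e
    using affine_product_reproduction[OF V k affine_product_monomial[of e y s], of "\<lambda>_. 0" 0 x] that
    by (simp add: multi_indices_def)
  have "p (y + s *\<^sub>R x) = (\<Sum>e | (\<Sum>i\<in>UNIV. e i) \<le> k. c e * ?m e x)" by (rule c)
  also have "\<dots> = (\<Sum>e | (\<Sum>i\<in>UNIV. e i) \<le> k. \<Sum>a\<in>multi_indices V k. c e * ?m e (node k V a) * lagrange k V a x)"
    by (intro sum.cong refl) (subst m, auto simp: sum_distrib_left mult.assoc)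
  also have "\<dots> = (\<Sum>a\<in>multi_indices V k. p (y + s *\<^sub>R node k V a) * lagrange k V a x)"
    unfolding c sum_distrib_right by (rule sum.swap)
  finally show ?thesis .
qed

section \<open>Gradients of polynomials\<close>

lemma gradient_eqI: "GDERIV f x :> D \<Longrightarrow> gradient f x = D"
proof -
  assume D: "GDERIV f x :> D"
  have "D' = D" if "GDERIV f x :> D'" for D'
  proof -
    have "(\<lambda>h. h \<bullet> D') = (\<lambda>h. h \<bullet> D)"
      using D that unfolding gderiv_def by (rule has_derivative_unique[rotated])
    then have "(D' - D) \<bullet> D' = (D' - D) \<bullet> D" by metis
    then have "(D' - D) \<bullet> (D' - D) = 0" by (simp add: inner_diff_right)
    then show ?thesis by simp
  qed
  then have "(THE D. GDERIV f x :> D) = D" using D by blast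
  moreover have "f differentiable (at x)" using D by (auto simp: gderiv_def differentiable_def)
  ultimately show ?thesis by (simp add: gradient_def)
qed

lemma differentiable_GDERIV:
  assumes "f differentiable (at x)"
  shows "GDERIV f x :> gradient f x"
proof -
  obtain f' where f': "(f has_derivative f') (at x)" using assms by (auto simp: differentiable_def)
  then have "linear f'" by (rule has_derivative_linear)
  then have "f' = (\<lambda>h. h \<bullet> adjoint f' 1)" using adjoint_works[of f' _ 1] by auto
  then have "GDERIV f x :> adjoint f' 1" using f' by (simp add: gderiv_def)
  then show ?thesis using gradient_eqI by metis
qed

lemma polys_GDERIV: "p \<in> polys k \<Longrightarrow> GDERIV p x :> gradient p x"
  by (intro differentiable_GDERIV polys_differentiable)

lemma GDERIV_sum:
  assumes "\<And>i. i \<in> A \<Longrightarrow> GDERIV (f i) x :> D i"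
  shows "GDERIV (\<lambda>x. \<Sum>i\<in>A. f i x) x :> (\<Sum>i\<in>A. D i)"
  using assms by (induction A rule: infinite_finite_induct) (auto simp del: gderiv_deriv intro!: GDERIV_add GDERIV_const)

lemma GDERIV_cmult: "GDERIV f x :> D \<Longrightarrow> GDERIV (\<lambda>x. c * f x) x :> c *\<^sub>R D"
  using GDERIV_mult[OF GDERIV_const[of c] , of f x D] by simp

lemma GDERIV_shift: "GDERIV f (y + z) :> D \<Longrightarrow> GDERIV (\<lambda>y. f (y + z)) y :> D"
proof -
  assume "GDERIV f (y + z) :> D"
  then have "(f has_derivative (\<lambda>h. h \<bullet> D)) (at (y + z))" by (simp add: gderiv_def)
  moreover have "((\<lambda>y. y + z) has_derivative (\<lambda>h. h)) (at y)" by (auto intro!: derivative_eq_intros)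
  ultimately have "((\<lambda>y. f (y + z)) has_derivative (\<lambda>h. h \<bullet> D)) (at y)"
    using has_derivative_compose by blast
  then show ?thesis by (simp add: gderiv_def)
qed

text \<open>
Both sides of \<open>polys_reproduction\<close> are differentiated with respect to the translation \<open>y\<close>; the basis
functions do not depend on it.
\<close>

lemma gradient_reproduction:
  assumes V: "\<not> affine_dependent V" "card V = 4" and k: "0 < k" and p: "p \<in> polys k"
  shows "gradient p (y + s *\<^sub>R x) = (\<Sum>a\<in>multi_indices V k. lagrange k V a x *\<^sub>R gradient p (y + s *\<^sub>R node k V a))"
proof -
  have g1: "GDERIV (\<lambda>y. p (y + s *\<^sub>R x)) y :> gradient p (y + s *\<^sub>R x)"
    by (intro GDERIV_shift polys_GDERIV[OF p])
  have eq: "(\<lambda>y. p (y + s *\<^sub>R x)) = (\<lambda>y. \<Sum>a\<in>multi_indices V k. lagrange k V a x * p (y + s *\<^sub>R node k V a))"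
  proof
    fix y show "p (y + s *\<^sub>R x) = (\<Sum>a\<in>multi_indices V k. lagrange k V a x * p (y + s *\<^sub>R node k V a))"
      unfolding polys_reproduction[OF V k p, of y s x] by (simp only: mult.commute)
  qed
  have g2: "GDERIV (\<lambda>y. p (y + s *\<^sub>R x)) y :>
      (\<Sum>a\<in>multi_indices V k. lagrange k V a x *\<^sub>R gradient p (y + s *\<^sub>R node k V a))"
    unfolding eq by (intro GDERIV_sum GDERIV_cmult GDERIV_shift polys_GDERIV[OF p])
  show ?thesis by (rule trans[OF gradient_eqI[OF g1, symmetric] gradient_eqI[OF g2]])
qed

lemma polys_continuous: "p \<in> polys k \<Longrightarrow> continuous_on A p"
  using polys_differentiable differentiable_imp_continuous_within
  by (meson continuous_at_imp_continuous_on)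

lemma continuous_on_gradient:
  fixes V :: "pt set"
  assumes V: "\<not> affine_dependent V" "card V = 4" and k: "0 < k" and p: "p \<in> polys k"
  shows "continuous_on A (gradient p)"
proof -
  have eq: "gradient p = (\<lambda>x. \<Sum>a\<in>multi_indices V k. lagrange k V a x *\<^sub>R gradient p (0 + 1 *\<^sub>R node k V a))"
  proof
    fix x show "gradient p x = (\<Sum>a\<in>multi_indices V k. lagrange k V a x *\<^sub>R gradient p (0 + 1 *\<^sub>R node k V a))"
      using gradient_reproduction[OF V k p, of 0 1 x] by simp
  qed
  show ?thesis
    by (subst eq) (intro continuous_on_sum continuous_on_scaleR continuous_on_const
        polys_continuous[OF lagrange_polys[OF V(1)]], assumption)
qed

section \<open>Bounds for the Lagrange basis\<close>

lemma abs_gchoose_le: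
  assumes "\<bar>t\<bar> + real j \<le> b"
  shows "\<bar>t gchoose j\<bar> \<le> b ^ j"
proof -
  have "\<bar>\<Prod>i = 0..<j. t - real i\<bar> \<le> (\<Prod>i = 0..<j. b)"
    unfolding abs_prod using assms by (intro prod_mono) auto
  moreover have "\<bar>t gchoose j\<bar> \<le> \<bar>\<Prod>i = 0..<j. t - real i\<bar>"
  proof -
    have "\<bar>\<Prod>i = 0..<j. t - real i\<bar> = fact j * \<bar>t gchoose j\<bar>"
      by (simp add: gbinomial_mult_fact[symmetric] abs_mult)
    moreover have "1 * \<bar>t gchoose j\<bar> \<le> fact j * \<bar>t gchoose j\<bar>"
      by (intro mult_right_mono) (auto simp: fact_ge_1)
    ultimately show ?thesis by simp
  qed
  ultimately show ?thesis by simp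
qed

text \<open>
After division by \<open>b\<close> all factors have modulus at most one, where \<open>norm_prod_diff\<close> applies.
\<close>

lemma abs_prod_diff_le:
  fixes f g :: "'i \<Rightarrow> real"
  assumes A: "finite A" and b: "1 \<le> b" and "\<And>i. i \<in> A \<Longrightarrow> \<bar>f i\<bar> \<le> b" "\<And>i. i \<in> A \<Longrightarrow> \<bar>g i\<bar> \<le> b"
    and d: "\<And>i. i \<in> A \<Longrightarrow> \<bar>f i - g i\<bar> \<le> d"
  shows "\<bar>prod f A - prod g A\<bar> \<le> b ^ card A * (real (card A) * d)"
proof -
  have "\<bar>(\<Prod>i\<in>A. f i / b) - (\<Prod>i\<in>A. g i / b)\<bar> \<le> (\<Sum>i\<in>A. \<bar>f i / b - g i / b\<bar>)"
    using norm_prod_diff[of A "\<lambda>i. f i / b" "\<lambda>i. g i / b"] assms by simp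
  also have "\<dots> \<le> (\<Sum>i\<in>A. d)"
  proof (rule sum_mono)
    fix i assume "i \<in> A"
    then have "\<bar>f i - g i\<bar> / b \<le> d / 1"
      using d b by (intro frac_le) force+
    then show "\<bar>f i / b - g i / b\<bar> \<le> d" using b by (simp flip: diff_divide_distrib)
  qed
  finally have *: "\<bar>(\<Prod>i\<in>A. f i / b) - (\<Prod>i\<in>A. g i / b)\<bar> \<le> real (card A) * d" by simp
  have "prod f A = b ^ card A * (\<Prod>i\<in>A. f i / b)" "prod g A = b ^ card A * (\<Prod>i\<in>A. g i / b)"
    using b by (simp_all add: prod_dividef)
  then have "\<bar>prod f A - prod g A\<bar> = b ^ card A * \<bar>(\<Prod>i\<in>A. f i / b) - (\<Prod>i\<in>A. g i / b)\<bar>"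
    using b by (simp add: abs_mult flip: right_diff_distrib)
  also have "\<dots> \<le> b ^ card A * (real (card A) * d)"
    using * b by (intro mult_left_mono) auto
  finally show ?thesis .
qed

lemma abs_gchoose_diff_le:
  assumes "\<bar>t\<bar> + real j \<le> b" "\<bar>s\<bar> + real j \<le> b" "1 \<le> b"
  shows "\<bar>(t gchoose j) - (s gchoose j)\<bar> \<le> b ^ j * (real j * \<bar>t - s\<bar>)"
proof -
  have "\<bar>(\<Prod>i = 0..<j. t - real i) - (\<Prod>i = 0..<j. s - real i)\<bar> \<le> b ^ card {0..<j} * (real (card {0..<j}) * \<bar>t - s\<bar>)"
    using assms by (intro abs_prod_diff_le) auto
  moreover have "\<bar>(t gchoose j) - (s gchoose j)\<bar> \<le> \<bar>(\<Prod>i = 0..<j. t - real i) - (\<Prod>i = 0..<j. s - real i)\<bar>"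
  proof -
    have "\<bar>(\<Prod>i = 0..<j. t - real i) - (\<Prod>i = 0..<j. s - real i)\<bar> = fact j * \<bar>(t gchoose j) - (s gchoose j)\<bar>"
      by (simp add: gbinomial_mult_fact[symmetric] abs_mult flip: right_diff_distrib)
    moreover have "1 * \<bar>(t gchoose j) - (s gchoose j)\<bar> \<le> fact j * \<bar>(t gchoose j) - (s gchoose j)\<bar>"
      by (intro mult_right_mono) (auto simp: fact_ge_1)
    ultimately show ?thesis by simp
  qed
  ultimately show ?thesis by simp
qed

lemma abs_lagrange_le:
  fixes V :: "pt set"
  assumes V: "finite V" "a \<in> multi_indices V k" and k: "0 < k" and R: "\<And>S. S \<in> V \<Longrightarrow> \<bar>bary V S x\<bar> \<le> R"
  shows "\<bar>lagrange k V a x\<bar> \<le> (real k * (R + 1)) ^ k"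
proof -
  have "\<bar>(real k * bary V S x) gchoose a S\<bar> \<le> (real k * (R + 1)) ^ a S" if "S \<in> V" for S
  proof (rule abs_gchoose_le)
    have "real k * \<bar>bary V S x\<bar> \<le> real k * R" using R[OF that] by (intro mult_left_mono) auto
    moreover have "a S \<le> k" using multi_indices_le[OF V] by simp
    ultimately show "\<bar>real k * bary V S x\<bar> + real (a S) \<le> real k * (R + 1)"
      by (simp add: abs_mult distrib_left)
  qed
  then have "\<bar>lagrange k V a x\<bar> \<le> (\<Prod>S\<in>V. (real k * (R + 1)) ^ a S)"
    unfolding lagrange_def abs_prod by (intro prod_mono) auto
  also have "\<dots> = (real k * (R + 1)) ^ k"
    using V by (simp add: multi_indices_def flip: power_sum)
  finally show ?thesis .
qed

text \<open>
The bound of \<open>abs_prod_diff_le\<close> for four factors that are bounded by \<open>(k (R + 1))\<^sup>k\<close> and, as functions of the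
barycentric coordinate, have Lipschitz constant \<open>k\<^sup>2 (k (R + 1))\<^sup>k\<close>.
\<close>

definition lagrange_Lipschitz :: "nat \<Rightarrow> real \<Rightarrow> real" where
  "lagrange_Lipschitz k R = ((real k * (R + 1)) ^ k) ^ 4 * (4 * ((real k * (R + 1)) ^ k * (real k * real k)))"

lemma lagrange_Lipschitz_pos: "0 < k \<Longrightarrow> 0 \<le> R \<Longrightarrow> 0 < lagrange_Lipschitz k R"
  by (simp add: lagrange_Lipschitz_def)

lemma abs_lagrange_diff_le:
  fixes V :: "pt set"
  assumes V: "finite V" "card V = 4" "a \<in> multi_indices V k" and k: "0 < k" and R0: "0 \<le> R"
    and R: "\<And>S. S \<in> V \<Longrightarrow> \<bar>bary V S x\<bar> \<le> R" "\<And>S. S \<in> V \<Longrightarrow> \<bar>bary V S y\<bar> \<le> R"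
    and d: "\<And>S. S \<in> V \<Longrightarrow> \<bar>bary V S x - bary V S y\<bar> \<le> d"
  shows "\<bar>lagrange k V a x - lagrange k V a y\<bar> \<le> lagrange_Lipschitz k R * d"
proof -
  let ?b = "real k * (R + 1)"
  have b: "1 \<le> ?b" using k R0 mult_mono[of 1 "real k" 1 "R + 1"] by simp
  have t: "\<bar>real k * t\<bar> + real (a S) \<le> ?b" if "\<bar>t\<bar> \<le> R" for t S
  proof -
    have "real k * \<bar>t\<bar> \<le> real k * R" using that by (intro mult_left_mono) auto
    moreover have "a S \<le> k" using multi_indices_le[OF V(1,3)] by simp
    ultimately show ?thesis by (simp add: abs_mult distrib_left)
  qed
  have pw: "?b ^ a S \<le> ?b ^ k" for S using b multi_indices_le[OF V(1,3)] by (intro power_increasing) auto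
  have "V \<noteq> {}" using V by auto
  then have d0: "0 \<le> d" using d by force
  have "\<bar>(\<Prod>S\<in>V. (real k * bary V S x) gchoose a S) - (\<Prod>S\<in>V. (real k * bary V S y) gchoose a S)\<bar>
    \<le> (?b ^ k) ^ card V * (real (card V) * (?b ^ k * (real k * (real k * d))))"
  proof (intro abs_prod_diff_le V)
    show "1 \<le> ?b ^ k" using b by simp
    fix S assume S: "S \<in> V"
    show "\<bar>(real k * bary V S x) gchoose a S\<bar> \<le> ?b ^ k" "\<bar>(real k * bary V S y) gchoose a S\<bar> \<le> ?b ^ k"
      using abs_gchoose_le[OF t] R S pw order_trans by metis+
    have "\<bar>((real k * bary V S x) gchoose a S) - ((real k * bary V S y) gchoose a S)\<bar>
      \<le> ?b ^ a S * (real (a S) * \<bar>real k * bary V S x - real k * bary V S y\<bar>)"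
      using R S b by (intro abs_gchoose_diff_le t) auto
    also have "\<dots> \<le> ?b ^ k * (real k * (real k * d))"
    proof (intro mult_mono pw)
      show "real (a S) \<le> real k" using multi_indices_le[OF V(1,3)] by simp
      have "\<bar>real k * bary V S x - real k * bary V S y\<bar> = real k * \<bar>bary V S x - bary V S y\<bar>"
        by (simp add: abs_mult flip: right_diff_distrib)
      then show "\<bar>real k * bary V S x - real k * bary V S y\<bar> \<le> real k * d"
        using d[OF S] k by simp
    qed (use b d0 in auto)
    finally show "\<bar>((real k * bary V S x) gchoose a S) - ((real k * bary V S y) gchoose a S)\<bar>
      \<le> ?b ^ k * (real k * (real k * d))" .
  qed
  then show ?thesis using V(2) by (simp add: lagrange_def lagrange_Lipschitz_def mult.assoc)
qed

lemma norm_gradient_le: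
  fixes x :: "'a::euclidean_space"
  assumes p: "GDERIV f x :> D" and r: "0 < r" and L: "\<And>y. dist y x < r \<Longrightarrow> \<bar>f y - f x\<bar> \<le> L * norm (y - x)"
  shows "norm D \<le> L"
proof (cases "D = 0")
  case True
  obtain u :: 'a where u: "u \<in> Basis" using nonempty_Basis by blast
  let ?y = "x + (r/2) *\<^sub>R u"
  have "norm (?y - x) = r/2" using u r by simp
  then have "0 \<le> L * (r/2)" using L[of ?y] r by (simp add: dist_norm) (smt (verit))
  then show ?thesis using True r by (simp add: zero_le_mult_iff)
next
  case False
  have "((\<lambda>t. f (x + t *\<^sub>R D)) has_field_derivative D \<bullet> D) (at 0)"
  proof -
    have f: "(f has_derivative (\<lambda>h. h \<bullet> D)) (at (x + 0 *\<^sub>R D))" using p by (simp add: gderiv_def)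
    have g: "((\<lambda>t. x + t *\<^sub>R D) has_derivative (\<lambda>t. t *\<^sub>R D)) (at 0)"
      by (auto intro!: derivative_eq_intros)
    have "(\<lambda>h. (h *\<^sub>R D) \<bullet> D) = (*) (D \<bullet> D)" by (auto simp: mult.commute)
    with has_derivative_compose[OF g f] show ?thesis
      unfolding has_field_derivative_def by (simp only:)
  qed
  then have lim: "((\<lambda>t. (f (x + t *\<^sub>R D) - f x) / t) \<longlongrightarrow> D \<bullet> D) (at 0)"
    by (simp add: DERIV_def)
  have "eventually (\<lambda>t. (f (x + t *\<^sub>R D) - f x) / t \<le> L * norm D) (at 0)"
    unfolding eventually_at
  proof (intro exI conjI ballI impI)
    show "0 < r / norm D" using r False by simp
    fix t :: real assume t: "t \<noteq> 0 \<and> dist t 0 < r / norm D"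
    then have "\<bar>t\<bar> * norm D < r" using False by (simp add: field_simps)
    then have "\<bar>f (x + t *\<^sub>R D) - f x\<bar> \<le> L * (\<bar>t\<bar> * norm D)"
      using L[of "x + t *\<^sub>R D"] by (simp add: dist_norm)
    then have "\<bar>(f (x + t *\<^sub>R D) - f x) / t\<bar> \<le> L * norm D"
      using t by (simp add: field_simps)
    then show "(f (x + t *\<^sub>R D) - f x) / t \<le> L * norm D" by linarith
  qed
  then have "D \<bullet> D \<le> L * norm D" using lim by (intro tendsto_upperbound) auto
  then have "norm D * norm D \<le> L * norm D" by (simp add: dot_square_norm power2_eq_square)
  then show ?thesis using False by simp
qed

lemma bary_bound:
  assumes V: "\<not> affine_dependent V" and S: "S \<in> V" and r: "0 < r" "cball c r \<subseteq> convex hull V"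
    and y: "y \<in> convex hull V"
  shows "\<bar>bary V S x\<bar> \<le> 1 + norm (x - y) / r"
  using bary_Lipschitz[OF V S r, of x y] bary_on_face[OF V subset_refl y S] by linarith

lemma gradient_lagrange_le:
  assumes V: "\<not> affine_dependent V" "card V = 4" and k: "0 < k"
    and r: "0 < r" "cball c r \<subseteq> convex hull V"
    and x: "x \<in> convex hull V" and a: "a \<in> multi_indices V k"
  shows "norm (gradient (lagrange k V a) x) \<le> lagrange_Lipschitz k 2 / r"
proof (rule norm_gradient_le[OF polys_GDERIV[OF lagrange_polys[OF V(1) a]] r(1)])
  fix y assume y: "dist y x < r"
  have fin: "finite V" using V aff_independent_finite by blast
  have "\<bar>lagrange k V a y - lagrange k V a x\<bar> \<le> lagrange_Lipschitz k 2 * (norm (y - x) / r)"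
  proof (rule abs_lagrange_diff_le[OF fin V(2) a k])
    fix S assume S: "S \<in> V"
    have "norm (y - x) / r \<le> 1" using y r by (simp add: dist_norm)
    then show "\<bar>bary V S y\<bar> \<le> 2" using bary_bound[OF V(1) S r x, of y] by linarith
    show "\<bar>bary V S x\<bar> \<le> 2" using bary_bound[OF V(1) S r x, of x] by simp
    show "\<bar>bary V S y - bary V S x\<bar> \<le> norm (y - x) / r" by (rule bary_Lipschitz[OF V(1) S r])
  qed simp
  then show "\<bar>lagrange k V a y - lagrange k V a x\<bar> \<le> lagrange_Lipschitz k 2 / r * norm (y - x)" by simp
qed

text \<open>
The Vandermonde identity with all parameters equal to \<open>k\<close> counts multi-indices with weights at least
one, so their number is bounded independently of the simplex.
\<close>

lemma card_multi_indices_le: 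
  assumes "finite V" "card V = 4" "0 < k"
  shows "real (card (multi_indices V k)) \<le> real (4 * k choose k)"
proof -
  have "1 \<le> (\<Prod>S\<in>V. real k gchoose a S)" if "a \<in> multi_indices V k" for a
  proof (rule prod_ge_1)
    fix S assume "S \<in> V"
    have "a S \<le> k" using multi_indices_le[OF assms(1) that] .
    then have "1 \<le> k choose a S" by (simp add: Suc_leI)
    then show "1 \<le> real k gchoose a S" by (simp flip: binomial_gbinomial)
  qed
  then have "(\<Sum>a\<in>multi_indices V k. 1) \<le> (\<Sum>a\<in>multi_indices V k. \<Prod>S\<in>V. real k gchoose a S)" by (intro sum_mono)
  also have "\<dots> = (\<Sum>S\<in>V. real k) gchoose k" by (rule multi_Vandermonde[OF assms(1)])
  also have "\<dots> = real (4 * k choose k)" using assms by (simp add: binomial_gbinomial)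
  finally show ?thesis by simp
qed

section \<open>The inverse estimate and the correction of nodal values\<close>

lemma integrable_on_compact_continuous:
  fixes f :: "'a::euclidean_space \<Rightarrow> real"
  assumes "compact S" "continuous_on S f"
  shows "f integrable_on S"
proof -
  have "set_integrable lborel S f"
    using borel_integrable_compact[OF assms] by (simp add: set_integrable_def)
  then show ?thesis by (rule set_borel_integral_eq_integral(1))
qed

text \<open>
The cube of translations has volume \<open>r\<^sup>3 / 27\<close>.  The other factors are the square of a bound for the
number of nodes and the square of the bound for the basis functions at points whose barycentric
coordinates have modulus at most \<open>4 K + 2\<close>.
\<close>

definition inverse_const :: "nat \<Rightarrow> real \<Rightarrow> real" where
  "inverse_const k K = 27 * (real (4 * k choose k))\<^sup>2 * ((real k * (4 * K + 3)) ^ k)\<^sup>2"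

text \<open>
The maximum of the gradient near the tetrahedron is controlled by its mean square on the tetrahedron.
For every small translation \<open>y\<close>, the gradient at \<open>\<xi>\<close> is a combination of its values at the lattice
points of a translate of the tetrahedron shrunk by the factor \<open>1/2\<close> towards the centre \<open>c\<close> of the
inscribed ball, with coefficients bounded by the shape parameter; these points stay in the
tetrahedron.  Squaring and integrating over the translations in a cube gives the claim, the volume of
the cube being proportional to \<open>r\<^sup>3\<close>.
\<close>

lemma inverse_estimate:
  assumes V: "\<not> affine_dependent V" "card V = 4" and k: "0 < k" and p: "p \<in> polys k"
    and r: "0 < r" "cball c r \<subseteq> convex hull V"
    and h: "convex hull V \<subseteq> cball c h" "h \<le> K * r" and \<xi>: "dist c \<xi> \<le> 2 * h"
  shows "(norm (gradient p \<xi>))\<^sup>2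
    \<le> inverse_const k K / r ^ 3 * integral (convex hull V) (\<lambda>x. (norm (gradient p x))\<^sup>2)"
proof -
  have fin: "finite V" using V aff_independent_finite by blast
  let ?T = "convex hull V"
  let ?F = "\<lambda>x. (norm (gradient p x))\<^sup>2"
  let ?N = "real (4 * k choose k)"
  let ?B = "(real k * (4 * K + 3)) ^ k"
  let ?Z = "\<lambda>a. (1/2) *\<^sub>R (c + node k V a)"
  let ?v = "vec (r / 6) :: pt"
  let ?Q = "cbox (- ?v) ?v"
  have cT: "compact ?T" using fin by (simp add: finite_imp_compact_convex_hull)
  have cF: "continuous_on A ?F" for A
    by (intro continuous_intros continuous_on_gradient[OF V k p])
  have c_in: "c \<in> ?T" using r by auto
  have N: "real (card (multi_indices V k)) \<le> ?N" by (rule card_multi_indices_le[OF fin V(2) k])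
  have y_small: "norm y \<le> r / 2" if "y \<in> ?Q" for y
  proof -
    have "\<bar>y $ i\<bar> \<le> r / 6" for i
    proof -
      have "- (r / 6) \<le> y $ i \<and> y $ i \<le> r / 6" using that by (simp add: mem_box_cart)
      then show ?thesis by linarith
    qed
    then have "(\<Sum>i\<in>UNIV. \<bar>y $ i\<bar>) \<le> (\<Sum>i\<in>(UNIV :: 3 set). r / 6)" by (intro sum_mono)
    then show ?thesis using norm_le_l1_cart[of y] by simp
  qed
  have near: "?Z a + y \<in> ?T" if "y \<in> ?Q" "a \<in> multi_indices V k" for y a
  proof -
    have "c + 2 *\<^sub>R y \<in> ?T" using r y_small[OF that(1)] by (intro subsetD[OF r(2)]) (simp add: dist_norm)
    moreover have "node k V a \<in> ?T" using node_in_hull[OF k fin that(2)] .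
    ultimately have "(1/2) *\<^sub>R (c + 2 *\<^sub>R y) + (1/2) *\<^sub>R node k V a \<in> ?T"
      by (intro convexD[OF convex_convex_hull]) auto
    then show ?thesis by (simp add: algebra_simps)
  qed
  have pointwise: "?F \<xi> \<le> ?N * ?B\<^sup>2 * (\<Sum>a\<in>multi_indices V k. ?F (y + ?Z a))" if y: "y \<in> ?Q" for y
  proof -
    define y' where "y' = (1/2) *\<^sub>R c + y"
    \<comment> \<open>chosen such that \<open>\<xi> = y' + x / 2\<close>, while the lattice points become \<open>?Z a + y\<close>\<close>
    define x where "x = 2 *\<^sub>R (\<xi> - y')"
    have x: "norm (x - c) \<le> 4 * h + r"
    proof -
      have "x - c = 2 *\<^sub>R ((\<xi> - c) - y)"
        by (simp add: x_def y'_def algebra_simps scaleR_2)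
      then have "norm (x - c) = 2 * norm ((\<xi> - c) - y)" by simp
      also have "\<dots> \<le> 2 * (norm (\<xi> - c) + norm y)" by (intro mult_left_mono norm_triangle_ineq4) auto
      finally show ?thesis using \<xi> y_small[OF y] by (simp add: dist_norm norm_minus_commute)
    qed
    have "\<bar>lagrange k V a x\<bar> \<le> ?B" if a: "a \<in> multi_indices V k" for a
    proof -
      have "\<bar>bary V S x\<bar> \<le> 4 * K + 2" if "S \<in> V" for S
      proof -
        have "norm (x - c) / r \<le> (4 * (K * r) + r) / r"
          using x h r by (intro divide_right_mono) auto
        moreover have "(4 * (K * r) + r) / r = 4 * K + 1" using r by (simp add: add_divide_distrib)
        ultimately show ?thesis using bary_bound[OF V(1) that r c_in, of x] by linarith
      qed
      then show ?thesis using abs_lagrange_le[OF fin a k, of x "4 * K + 2"] by (simp add: algebra_simps)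
    qed
    note B = this
    have "gradient p \<xi> = gradient p (y' + (1/2) *\<^sub>R x)" by (simp add: x_def)
    also have "\<dots> = (\<Sum>a\<in>multi_indices V k. lagrange k V a x *\<^sub>R gradient p (y' + (1/2) *\<^sub>R node k V a))"
      by (rule gradient_reproduction[OF V k p])
    also have "\<dots> = (\<Sum>a\<in>multi_indices V k. lagrange k V a x *\<^sub>R gradient p (y + ?Z a))"
      by (simp add: y'_def scaleR_add_right ac_simps)
    finally have "norm (gradient p \<xi>) \<le> (\<Sum>a\<in>multi_indices V k. ?B * norm (gradient p (y + ?Z a)))"
      using B by (auto intro!: sum_norm_le mult_right_mono)
    then have "?F \<xi> \<le> (\<Sum>a\<in>multi_indices V k. ?B * norm (gradient p (y + ?Z a)))\<^sup>2"
      by (intro power_mono) auto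
    also have "\<dots> \<le> (\<Sum>a\<in>multi_indices V k. (?B * norm (gradient p (y + ?Z a)))\<^sup>2) * card (multi_indices V k)"
      by (rule sum_squared_le_sum_of_squares)
    also have "\<dots> \<le> (\<Sum>a\<in>multi_indices V k. (?B * norm (gradient p (y + ?Z a)))\<^sup>2) * ?N"
      using N by (intro mult_left_mono sum_nonneg) auto
    also have "\<dots> = ?N * ?B\<^sup>2 * (\<Sum>a\<in>multi_indices V k. ?F (y + ?Z a))"
      by (simp add: power_mult_distrib sum_distrib_left sum_distrib_right mult_ac)
    finally show ?thesis .
  qed
  have shift: "(\<lambda>y. ?F (y + z)) integrable_on ?Q" for z
    by (intro integrable_continuous continuous_on_compose2[OF cF[of UNIV]] continuous_intros) auto
  have part: "integral ?Q (\<lambda>y. ?F (y + ?Z a)) \<le> integral ?T ?F" if a: "a \<in> multi_indices V k" for a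
  proof -
    have "integral ?Q (\<lambda>y. ?F (y + ?Z a)) = integral (cbox (- ?v + ?Z a) (?v + ?Z a)) ?F"
      using integral_shift_cbox[of "- ?v + ?Z a" "?Z a" "?v + ?Z a" ?F] by simp
    also have "\<dots> \<le> integral ?T ?F"
    proof (rule integral_subset_le)
      have "cbox (- ?v + ?Z a) (?v + ?Z a) = (\<lambda>x. x + ?Z a) ` ?Q"
        using cbox_translation[of "?Z a" "- ?v" ?v] by (simp add: add.commute image_def)
      then show "cbox (- ?v + ?Z a) (?v + ?Z a) \<subseteq> ?T" using near[OF _ a] by (auto simp: add.commute)
      show "?F integrable_on cbox (- ?v + ?Z a) (?v + ?Z a)" by (intro integrable_continuous cF)
      show "?F integrable_on ?T" by (rule integrable_on_compact_continuous[OF cT cF])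
    qed auto
    finally show ?thesis .
  qed
  have "measure lborel ?Q = (r / 3) ^ 3"
  proof -
    have "?Q \<noteq> {}" using r by (auto simp: interval_ne_empty_cart)
    then have "measure lborel ?Q = (\<Prod>i\<in>UNIV. ?v $ i - (- ?v) $ i)" by (rule content_cbox_cart)
    then show ?thesis by (simp add: field_simps power3_eq_cube)
  qed
  then have "(r / 3) ^ 3 * ?F \<xi> = integral ?Q (\<lambda>_. ?F \<xi>)" by simp
  also have "\<dots> \<le> integral ?Q (\<lambda>y. ?N * ?B\<^sup>2 * (\<Sum>a\<in>multi_indices V k. ?F (y + ?Z a)))"
    using pointwise shift fin
    by (intro integral_le integrable_const integrable_on_mult_right integrable_sum) (auto simp: finite_multi_indices)
  also have "\<dots> = ?N * ?B\<^sup>2 * (\<Sum>a\<in>multi_indices V k. integral ?Q (\<lambda>y. ?F (y + ?Z a)))"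
    using shift fin by (simp add: integral_sum finite_multi_indices)
  also have "\<dots> \<le> ?N * ?B\<^sup>2 * (\<Sum>a\<in>multi_indices V k. integral ?T ?F)"
    using part by (intro mult_left_mono sum_mono) auto
  also have "\<dots> = ?N * ?B\<^sup>2 * (real (card (multi_indices V k)) * integral ?T ?F)" by simp
  also have "\<dots> \<le> ?N * ?B\<^sup>2 * (?N * integral ?T ?F)"
    using N integrable_on_compact_continuous[OF cT cF]
    by (intro mult_left_mono mult_right_mono integral_nonneg) auto
  finally have "r ^ 3 * ?F \<xi> \<le> inverse_const k K * integral ?T ?F"
    by (simp add: inverse_const_def power_divide power2_eq_square mult_ac)
  then show ?thesis using r by (simp add: field_simps)
qed

text \<open>
The factor \<open>8 K\<^sup>3\<close> comes from the volume of a cube that contains the tetrahedron, the next two from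
the number of nodes and the gradients of the basis functions.
\<close>

definition correction_const :: "nat \<Rightarrow> real \<Rightarrow> real" where
  "correction_const k K = 8 * K ^ 3 * (real (4 * k choose k))\<^sup>2 * (lagrange_Lipschitz k 2)\<^sup>2 * inverse_const k K"

text \<open>
A polynomial that vanishes at distance at most \<open>\<eta> r\<close> from \<open>N\<close> is small at \<open>N\<close>: mean value inequality
and inverse estimate.
\<close>

lemma polys_nodal_value_le:
  assumes V: "\<not> affine_dependent V" "card V = 4" and k: "0 < k" and p: "p \<in> polys k"
    and r: "0 < r" "cball c r \<subseteq> convex hull V"
    and h: "convex hull V \<subseteq> cball c h" "h \<le> K * r"
    and N: "N \<in> convex hull V" and P: "dist N P \<le> \<eta> * r" "\<eta> \<le> 1" "p P = 0"
  shows "\<bar>p N\<bar> \<le> \<eta> * r * sqrt (inverse_const k K / r ^ 3 * integral (convex hull V) (\<lambda>x. (norm (gradient p x))\<^sup>2))"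
    (is "_ \<le> _ * ?b")
proof -
  have rh: "r \<le> h"
  proof -
    obtain u :: pt where "norm u = 1" using vector_choose_size[of 1] by auto
    then have "c + r *\<^sub>R u \<in> cball c r" using r by (simp add: dist_norm)
    then have "c + r *\<^sub>R u \<in> cball c h" using r h by blast
    then show ?thesis using \<open>norm u = 1\<close> r by (simp add: dist_norm)
  qed
  have "\<eta> * r \<le> r" using P r mult_right_mono[of \<eta> 1 r] by simp
  then have ends: "N \<in> cball c (2 * h)" "P \<in> cball c (2 * h)"
  proof -
    have 1: "dist c N \<le> h" using N h by auto
    show "N \<in> cball c (2 * h)" using 1 rh r by simp
    show "P \<in> cball c (2 * h)" using 1 P \<open>\<eta> * r \<le> r\<close> rh dist_triangle[of c P N] by simp
  qed
  have "norm (p N - p P) \<le> ?b * norm (N - P)"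
  proof (rule differentiable_bound[OF convex_cball _ _ ends])
    fix x assume x: "x \<in> cball c (2 * h)"
    show "(p has_derivative (\<lambda>d. d \<bullet> gradient p x)) (at x within cball c (2 * h))"
      using polys_GDERIV[OF p, of x] unfolding gderiv_def by (rule has_derivative_at_withinI)
    have "norm (gradient p x) \<le> ?b"
      using inverse_estimate[OF V k p r h, of x] x by (intro real_le_rsqrt) auto
    moreover have "onorm (\<lambda>d. d \<bullet> gradient p x) \<le> norm (gradient p x)"
      by (intro onorm_bound) (auto simp: Cauchy_Schwarz_ineq2 mult.commute)
    ultimately show "onorm (\<lambda>d. d \<bullet> gradient p x) \<le> ?b" by simp
  qed
  also have "\<dots> \<le> ?b * (\<eta> * r)"
  proof (rule mult_left_mono)
    show "norm (N - P) \<le> \<eta> * r" using P by (simp add: dist_norm)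
    have "norm (gradient p c) \<le> ?b"
      using inverse_estimate[OF V k p r h, of c] rh r by (intro real_le_rsqrt) auto
    then show "0 \<le> ?b" using norm_ge_zero order_trans by blast
  qed
  finally show ?thesis using P by (simp add: mult.commute)
qed

lemma integral_le_const:
  fixes f :: "pt \<Rightarrow> real"
  assumes T: "compact T" "T \<subseteq> cball c h" "0 \<le> h" and f: "continuous_on T f"
    and M: "\<And>x. x \<in> T \<Longrightarrow> f x \<le> M" "0 \<le> M"
  shows "integral T f \<le> 8 * h ^ 3 * M"
proof -
  let ?Q = "cbox (c - vec h) (c + vec h)"
  have "cball c h \<subseteq> ?Q"
  proof
    fix x assume "x \<in> cball c h"
    then have "\<bar>(x - c) $ i\<bar> \<le> h" for i
      using component_le_norm_cart[of "x - c" i] by (simp add: dist_norm norm_minus_commute)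
    then show "x \<in> ?Q" by (auto simp: mem_box_cart abs_le_iff algebra_simps)
  qed
  then have sub: "T \<subseteq> ?Q" using T by blast
  have "integral T f \<le> integral T (\<lambda>_. M)"
    using M f T by (intro integral_le integrable_on_compact_continuous) auto
  also have "\<dots> \<le> integral ?Q (\<lambda>_. M)"
    using T M sub by (intro integral_subset_le integrable_on_compact_continuous) auto
  also have "\<dots> = measure lborel ?Q * M" by simp
  also have "measure lborel ?Q = 8 * h ^ 3"
  proof -
    have "?Q \<noteq> {}" using \<open>0 \<le> h\<close> by (auto simp: interval_ne_empty_cart)
    then have "measure lborel ?Q = (\<Prod>i\<in>UNIV. (c + vec h) $ i - (c - vec h) $ i)" by (rule content_cbox_cart)
    then show ?thesis by (simp add: field_simps power3_eq_cube)
  qed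
  finally show ?thesis .
qed

text \<open>
Moving the zeros of \<open>p\<close> from the points \<open>P\<close> to the nearby nodes changes \<open>p\<close> by the sum below.  Each
coefficient is of order \<open>\<eta> / sqrt r\<close> times the norm of the gradient of \<open>p\<close>, each gradient of a basis function of
order \<open>1 / r\<close>, and the volume is of order \<open>r\<^sup>3\<close>; the powers of \<open>r\<close> cancel.
\<close>

lemma correction_estimate:
  assumes V: "\<not> affine_dependent V" "card V = 4" and k: "0 < k" and p: "p \<in> polys k"
    and r: "0 < r" "cball c r \<subseteq> convex hull V"
    and h: "convex hull V \<subseteq> cball c h" "h \<le> K * r"
    and A: "A \<subseteq> multi_indices V k" and \<eta>: "\<eta> \<le> 1"
    and P: "\<And>a. a \<in> A \<Longrightarrow> \<exists>P. dist (node k V a) P \<le> \<eta> * r \<and> p P = 0"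
  shows "integral (convex hull V) (\<lambda>x. (norm (gradient (\<lambda>x. \<Sum>a\<in>A. p (node k V a) * lagrange k V a x) x))\<^sup>2)
    \<le> correction_const k K * \<eta>\<^sup>2 * integral (convex hull V) (\<lambda>x. (norm (gradient p x))\<^sup>2)"
proof -
  have fin: "finite V" using V aff_independent_finite by blast
  then have finA: "finite A" using A finite_multi_indices finite_subset by blast
  let ?T = "convex hull V"
  let ?I = "integral ?T (\<lambda>x. (norm (gradient p x))\<^sup>2)"
  let ?q = "\<lambda>x. \<Sum>a\<in>A. p (node k V a) * lagrange k V a x"
  let ?N = "real (4 * k choose k)"
  let ?b = "inverse_const k K / r ^ 3 * ?I"
  have cT: "compact ?T" using fin by (simp add: finite_imp_compact_convex_hull)
  have q: "?q \<in> polys k" using A by (intro polys_sum polys_cmult lagrange_polys V) auto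
  have c_in: "c \<in> ?T" using r by auto
  then have h0: "0 \<le> h" using h by auto
  have K0: "0 \<le> K" using h0 h r by (smt (verit) mult_neg_pos)
  have I0: "0 \<le> ?I"
    by (intro integral_nonneg integrable_on_compact_continuous[OF cT] continuous_intros
        continuous_on_gradient[OF V k p]) auto
  have b0: "0 \<le> ?b" using I0 r by (simp add: inverse_const_def)
  have L0: "0 < lagrange_Lipschitz k 2" using k by (rule lagrange_Lipschitz_pos) simp
  show ?thesis
  proof (cases "A = {}")
    case True
    have "gradient (\<lambda>_. 0) = (\<lambda>_. 0 :: pt)" using gradient_eqI[OF GDERIV_const] by blast
    then show ?thesis using True I0 K0 by (simp add: correction_const_def inverse_const_def)
  next
    case False
    then obtain a P where "dist (node k V a) P \<le> \<eta> * r" using P by blast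
    then have \<eta>0: "0 \<le> \<eta>" using r zero_le_dist[of "node k V a" P] by (smt (verit) mult_neg_pos)
    let ?M = "?N * (\<eta> * r * sqrt ?b * (lagrange_Lipschitz k 2 / r))"
    have "(norm (gradient ?q x))\<^sup>2 \<le> ?M\<^sup>2" if x: "x \<in> ?T" for x
    proof (rule power_mono)
      have "gradient ?q x = (\<Sum>a\<in>A. p (node k V a) *\<^sub>R gradient (lagrange k V a) x)"
        using A by (intro gradient_eqI GDERIV_sum GDERIV_cmult polys_GDERIV[of _ k] lagrange_polys V) auto
      also have "norm \<dots> \<le> (\<Sum>a\<in>A. \<eta> * r * sqrt ?b * (lagrange_Lipschitz k 2 / r))"
      proof (intro sum_norm_le)
        fix a assume a: "a \<in> A"
        then obtain P where P: "dist (node k V a) P \<le> \<eta> * r" "p P = 0" using P by blast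
        have aV: "a \<in> multi_indices V k" using a A by auto
        have "\<bar>p (node k V a)\<bar> \<le> \<eta> * r * sqrt ?b"
          by (rule polys_nodal_value_le[OF V k p r h node_in_hull[OF k fin aV] P(1) \<eta> P(2)])
        moreover have "norm (gradient (lagrange k V a) x) \<le> lagrange_Lipschitz k 2 / r"
          by (rule gradient_lagrange_le[OF V k r x aV])
        ultimately show "norm (p (node k V a) *\<^sub>R gradient (lagrange k V a) x) \<le> \<eta> * r * sqrt ?b * (lagrange_Lipschitz k 2 / r)"
          unfolding norm_scaleR real_norm_def
          using \<eta>0 r b0 by (intro mult_mono[of _ "\<eta> * r * sqrt ?b"]) auto
      qed
      also have "\<dots> = real (card A) * (\<eta> * r * sqrt ?b * (lagrange_Lipschitz k 2 / r))" by simp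
      also have "\<dots> \<le> ?M"
      proof (rule mult_right_mono)
        show "real (card A) \<le> ?N"
          using card_mono[OF finite_multi_indices[OF fin] A] card_multi_indices_le[OF fin V(2) k] by linarith
        show "0 \<le> \<eta> * r * sqrt ?b * (lagrange_Lipschitz k 2 / r)" using \<eta>0 r b0 L0 by auto
      qed
      finally show "norm (gradient ?q x) \<le> ?M" .
    qed simp
    then have "integral ?T (\<lambda>x. (norm (gradient ?q x))\<^sup>2) \<le> 8 * h ^ 3 * ?M\<^sup>2"
      by (intro integral_le_const[OF cT h(1) h0]) (auto intro!: continuous_intros continuous_on_gradient[OF V k q])
    also have "\<dots> \<le> 8 * (K * r) ^ 3 * ?M\<^sup>2"
      using h h0 by (intro mult_right_mono mult_left_mono power_mono) auto
    also have "?M\<^sup>2 = ?N\<^sup>2 * \<eta>\<^sup>2 * ?b * (lagrange_Lipschitz k 2)\<^sup>2"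
      using r b0 by (simp add: power_mult_distrib power_divide)
    also have "8 * (K * r) ^ 3 * (?N\<^sup>2 * \<eta>\<^sup>2 * ?b * (lagrange_Lipschitz k 2)\<^sup>2) = correction_const k K * \<eta>\<^sup>2 * ?I"
      using r by (simp add: correction_const_def power_mult_distrib field_simps)
    finally show ?thesis .
  qed
qed

section \<open>Uniform flatness of the boundary\<close>

text \<open>
On \<open>U\<close> the set \<open>\<Omega>\<close> is \<open>{f > 0}\<close> and its boundary \<open>{f = 0}\<close>, and \<open>f\<close> is linear up to a perturbation with
Lipschitz constant \<open>\<eta>\<close>.  The unit vector \<open>g\<close> approximates the inner normal.
\<close>

definition local_chart :: "pt set \<Rightarrow> real \<Rightarrow> pt set \<Rightarrow> (pt \<Rightarrow> real) \<Rightarrow> pt \<Rightarrow> bool" where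
  "local_chart \<Omega> \<eta> U f g \<longleftrightarrow> norm g = 1 \<and>
    (\<forall>x\<in>U. \<forall>y\<in>U. \<bar>f x - f y - g \<bullet> (x - y)\<bar> \<le> \<eta> * norm (x - y)) \<and>
    (\<forall>x\<in>U. (x \<in> frontier \<Omega> \<longleftrightarrow> f x = 0) \<and> (x \<in> \<Omega> \<longleftrightarrow> 0 < f x))"

lemma linear_isometry_inverse:
  fixes A :: "(real^2) \<times> real \<Rightarrow> pt"
  assumes "linear A" "\<And>z. norm (A z) = norm z"
  obtains B where "linear B" "\<And>x. A (B x) = x" "\<And>z. B (A z) = z" "\<And>x. norm (B x) = norm x"
proof -
  have inj: "inj A"
    using assms linear_injective_0[OF assms(1)] by (metis norm_eq_zero)
  obtain B where B: "linear B" "B \<circ> A = id"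
    using linear_injective_left_inverse[OF assms(1) inj] by blast
  have "dim (range A) = dim (UNIV :: ((real^2) \<times> real) set)"
    using dim_image_eq[OF assms(1), of UNIV] inj by simp
  then have "dim (range A) = DIM(pt)" by simp
  moreover have "subspace (range A)" using assms(1) linear_subspace_image subspace_UNIV by blast
  ultimately have "range A = UNIV" using dim_eq_full[of "range A"] span_eq_iff by blast
  then have AB: "A (B x) = x" for x
    using B(2) by (metis comp_eq_dest_lhs id_apply surjD)
  show ?thesis
    using that[OF B(1) AB] B(2) assms(2) AB by (metis comp_apply id_apply)
qed

text \<open>
In the graph coordinates \<open>(y, t)\<close> centred at \<open>q\<close> the function is \<open>t - \<phi> y\<close>, divided by the length of
its gradient at \<open>q\<close>.  The perturbation is that of \<open>\<phi>\<close>, and its Lipschitz constant is the oscillation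
of the gradient of \<open>\<phi>\<close>, which is small near \<open>q\<close> by continuity.
\<close>

lemma C1_boundary_chart:
  assumes C1: "C1_boundary \<Omega>" and op: "open \<Omega>" and q: "q \<in> frontier \<Omega>" and \<eta>: "0 < \<eta>"
  shows "\<exists>U f g. open U \<and> q \<in> U \<and> local_chart \<Omega> \<eta> U f g"
proof -
  obtain A :: "(real^2) \<times> real \<Rightarrow> pt" and \<phi> D r where
    A: "linear A" "\<And>z. norm (A z) = norm z" and r: "0 < r"
    and \<phi>: "\<And>y. GDERIV \<phi> y :> D y" and D: "continuous_on UNIV D"
    and \<Omega>: "\<Omega> \<inter> ball q r = {x \<in> ball q r. \<exists>y t. x = q + A (y, t) \<and> \<phi> y < t}"
    using C1 q unfolding C1_boundary_def by blast
  obtain B where B: "linear B" "\<And>x. A (B x) = x" "\<And>z. B (A z) = z" "\<And>x. norm (B x) = norm x"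
    using linear_isometry_inverse[OF A] by metis
  define f0 where "f0 x = snd (B (x - q)) - \<phi> (fst (B (x - q)))" for x
  have in\<Omega>: "x \<in> \<Omega> \<longleftrightarrow> 0 < f0 x" if "x \<in> ball q r" for x
  proof -
    have "x \<in> \<Omega> \<longleftrightarrow> (\<exists>y t. x = q + A (y, t) \<and> \<phi> y < t)" using \<Omega> that by blast
    also have "\<dots> \<longleftrightarrow> (\<exists>y t. B (x - q) = (y, t) \<and> \<phi> y < t)"
      using B(2,3) by (metis add_diff_cancel_left' add_diff_cancel_right' diff_add_cancel add.commute)
    also have "\<dots> \<longleftrightarrow> 0 < f0 x" by (cases "B (x - q)") (auto simp: f0_def)
    finally show ?thesis .
  qed
  have contB: "continuous_on UNIV (\<lambda>x. B (x - q))"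
    by (intro linear_continuous_on_compose[OF _ B(1)] continuous_intros)
  have cont\<phi>: "continuous_on UNIV \<phi>"
  proof -
    have "\<phi> differentiable (at y)" for y using \<phi>[of y] by (auto simp: gderiv_def differentiable_def)
    then show ?thesis by (meson continuous_at_imp_continuous_on differentiable_imp_continuous_within)
  qed
  have contf: "continuous_on UNIV f0"
    unfolding f0_def by (intro continuous_intros contB continuous_on_compose2[OF cont\<phi>]) auto
  have infr: "x \<in> frontier \<Omega> \<longleftrightarrow> f0 x = 0" if x: "x \<in> ball q r" for x
  proof
    assume fr: "x \<in> frontier \<Omega>"
    then have "x \<notin> \<Omega>" using op by (auto simp: frontier_def interior_open)
    then have "f0 x \<le> 0" using in\<Omega>[OF x] by auto
    moreover have "\<not> f0 x < 0"
    proof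
      assume neg: "f0 x < 0"
      have "open (ball q r \<inter> {x. f0 x < 0})"
        by (intro open_Int open_ball open_Collect_less contf continuous_on_const)
      moreover have "(ball q r \<inter> {x. f0 x < 0}) \<inter> \<Omega> = {}" using in\<Omega> by force
      ultimately have "x \<notin> closure \<Omega>" using open_Int_closure_eq_empty x neg by blast
      then show False using fr by (auto simp: frontier_def)
    qed
    ultimately show "f0 x = 0" by simp
  next
    assume f0: "f0 x = 0"
    then have "x \<notin> \<Omega>" using in\<Omega>[OF x] by auto
    moreover have "x \<in> closure \<Omega>"
      unfolding closure_approachable
    proof (intro allI impI)
      fix e :: real assume "0 < e"
      define s where "s = min (e / 2) ((r - dist q x) / 2)"
      have s: "0 < s" "s < e" "s < r - dist q x" using \<open>0 < e\<close> x by (auto simp: s_def min_def)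
      let ?y = "x + A (0, s)"
      have d: "dist ?y x = s" using s A(2)[of "(0, s)"] by (simp add: dist_norm norm_Pair)
      then have "?y \<in> ball q r" using s dist_triangle[of q ?y x] by (simp add: dist_commute)
      moreover have "f0 ?y = s"
      proof -
        have "B (?y - q) = B (x - q) + B (A (0, s))"
          using linear_add[OF B(1), of "x - q" "A (0, s)"] by (simp add: algebra_simps)
        then show ?thesis using f0 B(3) by (simp add: f0_def)
      qed
      ultimately have "?y \<in> \<Omega>" using in\<Omega> s by simp
      then show "\<exists>y\<in>\<Omega>. dist y x < e" using d s(2) by (intro bexI[of _ ?y]) simp_all
    qed
    ultimately show "x \<in> frontier \<Omega>" using op by (auto simp: frontier_def interior_open)
  qed
  obtain g0 where g0: "\<And>x. snd (B x) - D 0 \<bullet> fst (B x) = g0 \<bullet> x"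
  proof -
    have "linear (\<lambda>x. snd (B x) - D 0 \<bullet> fst (B x))"
      by (intro linear_compose_sub linear_compose[OF B(1), unfolded o_def] linear_snd
          linear_compose[OF linear_compose[OF B(1) linear_fst], unfolded o_def, where g = "\<lambda>z. D 0 \<bullet> z"]
          bounded_linear.linear bounded_linear_inner_right)
    from adjoint_works[OF this, of _ 1] show ?thesis
      by (intro that[of "adjoint (\<lambda>x. snd (B x) - D 0 \<bullet> fst (B x)) 1"]) (simp add: inner_commute)
  qed
  have g1: "1 \<le> norm g0"
  proof -
    have "1 = g0 \<bullet> A (0, 1)" using g0[of "A (0, 1)"] B(3) by simp
    also have "\<dots> \<le> norm g0 * norm (A (0, 1))" by (rule norm_cauchy_schwarz)
    finally show ?thesis using A(2) by (simp add: norm_Pair)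
  qed
  obtain \<rho> where \<rho>: "0 < \<rho>" "\<And>z. norm z < \<rho> \<Longrightarrow> norm (D z - D 0) < \<eta>"
    using D \<eta> unfolding continuous_on_iff dist_norm
    by (metis UNIV_I diff_zero)
  let ?U = "ball q (min r \<rho>)"
  have est: "\<bar>f0 x - f0 y - g0 \<bullet> (x - y)\<bar> \<le> \<eta> * norm (x - y)" if "x \<in> ?U" "y \<in> ?U" for x y
  proof -
    have fs: "norm (fst (B w)) \<le> norm w" for w using norm_fst_le[of "fst (B w)" "snd (B w)"] B(4) by simp
    let ?u = "fst (B (x - q))" and ?v = "fst (B (y - q))"
    have "norm (x - q) < \<rho>" "norm (y - q) < \<rho>" using that by (auto simp: dist_norm norm_minus_commute)
    then have uv: "?u \<in> ball 0 \<rho>" "?v \<in> ball 0 \<rho>" using fs[of "x - q"] fs[of "y - q"] by auto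
    have "norm ((\<phi> ?u - D 0 \<bullet> ?u) - (\<phi> ?v - D 0 \<bullet> ?v)) \<le> \<eta> * norm (?u - ?v)"
    proof (rule differentiable_bound[OF convex_ball _ _ uv])
      fix z :: "real^2" assume z: "z \<in> ball 0 \<rho>"
      have "(\<phi> has_derivative (\<lambda>d. d \<bullet> D z)) (at z within ball 0 \<rho>)"
        using \<phi>[of z] unfolding gderiv_def by (rule has_derivative_at_withinI)
      then show "((\<lambda>z. \<phi> z - D 0 \<bullet> z) has_derivative (\<lambda>d. d \<bullet> D z - D 0 \<bullet> d)) (at z within ball 0 \<rho>)"
        by (auto intro!: derivative_eq_intros)
      show "onorm (\<lambda>d. d \<bullet> D z - D 0 \<bullet> d) \<le> \<eta>"
      proof (rule onorm_bound)
        fix d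
        have "d \<bullet> D z - D 0 \<bullet> d = d \<bullet> (D z - D 0)" by (simp add: inner_diff_right inner_commute)
        then have "norm (d \<bullet> D z - D 0 \<bullet> d) \<le> norm d * norm (D z - D 0)"
          using Cauchy_Schwarz_ineq2 by simp
        also have "\<dots> \<le> norm d * \<eta>" using \<rho>(2)[of z] z by (intro mult_left_mono) auto
        finally show "norm (d \<bullet> D z - D 0 \<bullet> d) \<le> \<eta> * norm d" by (simp add: mult.commute)
      qed (use \<eta> in simp)
    qed
    moreover have "?u - ?v = fst (B (x - y))"
      using linear_diff[OF B(1), of "x - q" "y - q"] by (simp add: fst_diff)
    moreover have "f0 x - f0 y - g0 \<bullet> (x - y) = - ((\<phi> ?u - D 0 \<bullet> ?u) - (\<phi> ?v - D 0 \<bullet> ?v))"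
    proof -
      have "B (x - q) = B (x - y) + B (y - q)"
        using linear_add[OF B(1), of "x - y" "y - q"] by simp
      then show ?thesis unfolding f0_def g0[symmetric] by (simp add: inner_add_right)
    qed
    ultimately have "\<bar>f0 x - f0 y - g0 \<bullet> (x - y)\<bar> \<le> \<eta> * norm (fst (B (x - y)))" by simp
    also have "\<dots> \<le> \<eta> * norm (x - y)" using fs \<eta> by (intro mult_left_mono) auto
    finally show ?thesis .
  qed
  have "local_chart \<Omega> \<eta> ?U (\<lambda>x. f0 x / norm g0) (g0 /\<^sub>R norm g0)"
    unfolding local_chart_def
  proof (intro conjI ballI)
    have "g0 \<noteq> 0" using g1 by auto
    then show "norm (g0 /\<^sub>R norm g0) = 1" by simp
    fix x assume x: "x \<in> ?U"
    show "(x \<in> frontier \<Omega>) = (f0 x / norm g0 = 0)" using infr[of x] x g1 by auto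
    show "(x \<in> \<Omega>) = (0 < f0 x / norm g0)" using in\<Omega>[of x] x g1 by (auto simp: zero_less_divide_iff)
    fix y assume y: "y \<in> ?U"
    have "f0 x / norm g0 - f0 y / norm g0 - (g0 /\<^sub>R norm g0) \<bullet> (x - y) = (f0 x - f0 y - g0 \<bullet> (x - y)) / norm g0"
      by (simp add: divide_inverse algebra_simps)
    then have "\<bar>f0 x / norm g0 - f0 y / norm g0 - (g0 /\<^sub>R norm g0) \<bullet> (x - y)\<bar> = \<bar>f0 x - f0 y - g0 \<bullet> (x - y)\<bar> / norm g0"
      by (simp only: abs_divide abs_norm_cancel)
    also have "\<dots> \<le> \<eta> * norm (x - y) / 1"
      using est[OF x y] g1 \<eta> by (intro frac_le) auto
    finally show "\<bar>f0 x / norm g0 - f0 y / norm g0 - (g0 /\<^sub>R norm g0) \<bullet> (x - y)\<bar> \<le> \<eta> * norm (x - y)" by simp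
  qed
  then show ?thesis using r \<rho> by (intro exI conjI) auto
qed

text \<open>
A Lebesgue number of the cover of the compact boundary by the domains of charts.
\<close>

lemma uniform_local_chart:
  assumes "C1_boundary \<Omega>" "open \<Omega>" "bounded \<Omega>" "0 < \<eta>"
  obtains \<delta> where "0 < \<delta>" "\<And>p. p \<in> frontier \<Omega> \<Longrightarrow> \<exists>f g. local_chart \<Omega> \<eta> (ball p \<delta>) f g"
proof -
  let ?\<G> = "{U. open U \<and> (\<exists>f g. local_chart \<Omega> \<eta> U f g)}"
  have "compact (frontier \<Omega>)" using assms(3) by (rule compact_frontier_bounded)
  moreover have "frontier \<Omega> \<subseteq> \<Union>?\<G>" using C1_boundary_chart[OF assms(1,2) _ assms(4)] by blast
  ultimately obtain \<delta> where \<delta>: "0 < \<delta>" "\<And>p. p \<in> frontier \<Omega> \<Longrightarrow> \<exists>U\<in>?\<G>. ball p \<delta> \<subseteq> U"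
    using Heine_Borel_lemma[of "frontier \<Omega>" ?\<G>] by blast
  show ?thesis
  proof (rule that[OF \<delta>(1)])
    fix p assume "p \<in> frontier \<Omega>"
    then obtain U f g where "ball p \<delta> \<subseteq> U" "local_chart \<Omega> \<eta> U f g" using \<delta>(2) by blast
    then show "\<exists>f g. local_chart \<Omega> \<eta> (ball p \<delta>) f g"
      unfolding local_chart_def by (meson subsetD)
  qed
qed

lemma local_chart_continuous:
  assumes "local_chart \<Omega> \<eta> U f g"
  shows "continuous_on U f"
proof (rule continuous_on_subset[OF _ subset_refl])
  have g: "norm g = 1" and est: "\<And>x y. x \<in> U \<Longrightarrow> y \<in> U \<Longrightarrow> \<bar>f x - f y - g \<bullet> (x - y)\<bar> \<le> \<eta> * norm (x - y)"
    using assms by (auto simp: local_chart_def)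
  have "dist (f x) (f y) \<le> (\<bar>\<eta>\<bar> + 1) * dist x y" if "x \<in> U" "y \<in> U" for x y
  proof -
    have "\<bar>g \<bullet> (x - y)\<bar> \<le> norm (x - y)" using Cauchy_Schwarz_ineq2[of g "x - y"] g by simp
    moreover have "\<eta> * norm (x - y) \<le> \<bar>\<eta>\<bar> * norm (x - y)" by (intro mult_right_mono) auto
    ultimately show ?thesis using est[OF that] by (simp add: dist_norm algebra_simps)
  qed
  then have "(\<bar>\<eta>\<bar> + 1)-lipschitz_on U f" by (intro lipschitz_onI) auto
  then show "continuous_on U f" by (rule lipschitz_on_continuous_on)
qed

text \<open>
Along the direction \<open>u\<close> the function \<open>f\<close> grows at rate at least \<open>\<kappa> - \<eta> \<ge> \<kappa> / 2\<close>, so it changes sign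
within distance \<open>2 b / \<kappa>\<close> of a point where its modulus is at most \<open>b\<close>.
\<close>

lemma local_chart_transversal_intersection:
  assumes chart: "local_chart \<Omega> \<eta> U f g" and u: "u \<noteq> 0" "\<kappa> * norm u \<le> \<bar>g \<bullet> u\<bar>"
    and \<kappa>: "0 < \<kappa>" "2 * \<eta> \<le> \<kappa>" and b: "\<bar>f M\<bar> \<le> b" and U: "cball M (2 * b / \<kappa>) \<subseteq> U"
  shows "\<exists>s. M + s *\<^sub>R u \<in> frontier \<Omega> \<and> dist M (M + s *\<^sub>R u) \<le> 2 * b / \<kappa>"
proof -
  define w where "w = (sgn (g \<bullet> u) / norm u) *\<^sub>R u"
  have "g \<bullet> u \<noteq> 0" using u \<kappa> by (metis abs_zero mult_pos_pos norm_eq_zero not_less zero_less_norm_iff)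
  then have w: "norm w = 1" using u by (simp add: w_def abs_sgn_eq)
  have gw: "\<kappa> \<le> g \<bullet> w"
  proof -
    have "g \<bullet> w = \<bar>g \<bullet> u\<bar> / norm u" by (simp add: w_def abs_sgn mult.commute)
    then show ?thesis using u by (simp add: pos_le_divide_eq)
  qed
  define s where "s = 2 * b / \<kappa>"
  have s0: "0 \<le> s" using b \<kappa> by (auto simp: s_def intro!: divide_nonneg_pos)
  have s_b: "\<kappa> * s = 2 * b" using \<kappa> by (simp add: s_def)
  have inU: "M + t *\<^sub>R w \<in> U" if "\<bar>t\<bar> \<le> s" for t
    using that w by (intro subsetD[OF U, folded s_def]) (simp add: dist_norm)
  have est: "\<bar>f (M + t *\<^sub>R w) - f M - t * (g \<bullet> w)\<bar> \<le> \<eta> * \<bar>t\<bar>" if "\<bar>t\<bar> \<le> s" for t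
    using chart inU[OF that] inU[of 0] s0 w unfolding local_chart_def by fastforce
  have sb: "(\<kappa> - \<eta>) * s \<ge> b"
  proof -
    have "(\<kappa> / 2) * s \<le> (\<kappa> - \<eta>) * s" using s0 \<kappa> by (intro mult_right_mono) auto
    then show ?thesis using s_b by linarith
  qed
  have gws: "\<kappa> * s \<le> s * (g \<bullet> w)" using gw s0 by (metis mult.commute mult_left_mono)
  have "f (M + s *\<^sub>R w) \<ge> 0"
    using est[of s] gws sb s0 b by (simp add: abs_le_iff left_diff_distrib)
  moreover have "f (M + (- s) *\<^sub>R w) \<le> 0"
    using est[of "- s"] gws sb s0 b by (simp add: abs_le_iff left_diff_distrib)
  moreover have "continuous_on {- s..s} (\<lambda>t. f (M + t *\<^sub>R w))"
    by (intro continuous_on_compose2[OF local_chart_continuous[OF chart]] continuous_intros)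
      (use inU in \<open>auto simp: abs_le_iff\<close>)
  ultimately obtain t where t: "- s \<le> t" "t \<le> s" "f (M + t *\<^sub>R w) = 0"
    using IVT'[of "\<lambda>t. f (M + t *\<^sub>R w)" "- s" 0 s] s0 by auto
  then have "M + t *\<^sub>R w \<in> frontier \<Omega>"
    using chart inU[of t] unfolding local_chart_def by (auto simp: abs_le_iff)
  moreover have "M + (t * (sgn (g \<bullet> u) / norm u)) *\<^sub>R u = M + t *\<^sub>R w" by (simp add: w_def)
  moreover have "dist M (M + t *\<^sub>R w) \<le> s" using t w by (simp add: dist_norm abs_le_iff)
  ultimately show ?thesis unfolding s_def by metis
qed

lemma nearest_intersection_exists:
  assumes "closed l" "X \<in> l \<inter> frontier \<Omega>"
  obtains P where "nearest_intersection (frontier \<Omega>) l M P" "dist M P \<le> dist M X"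
proof -
  have "closed (l \<inter> frontier \<Omega>)" using assms by (intro closed_Int) auto
  then obtain P where P: "P \<in> l \<inter> frontier \<Omega>" "\<And>Y. Y \<in> l \<inter> frontier \<Omega> \<Longrightarrow> dist M P \<le> dist M Y"
    using distance_attains_inf[of "l \<inter> frontier \<Omega>" M] assms by blast
  show ?thesis
    by (rule that[of P]) (use P assms in \<open>auto simp: nearest_intersection_def is_arg_min_linorder\<close>)
qed

section \<open>Tetrahedra with a face inscribed in the boundary\<close>

text \<open>
A tetrahedron with apex \<open>Z\<close> inside \<open>\<Omega>\<close> and the vertices \<open>W\<close> of the opposite face on its boundary, of
diameter at most \<open>h\<close> and with inscribed ball of radius \<open>r\<close>, inside the domain of a chart that is
flat compared with the shape of the tetrahedron.
\<close>

locale flat_tetrahedron =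
  fixes \<Omega> :: "pt set" and \<eta> :: real and U :: "pt set" and f :: "pt \<Rightarrow> real" and g :: pt
    and W :: "pt set" and Z c :: pt and r h :: real
  assumes chart: "local_chart \<Omega> \<eta> U f g" and convU: "convex U" and \<eta>: "0 \<le> \<eta>" "4 * (\<eta> * h) \<le> r"
    and V: "\<not> affine_dependent (insert Z W)" and Z: "Z \<notin> W"
    and W: "W \<subseteq> frontier \<Omega>" "W \<noteq> {}" and Z\<Omega>: "Z \<in> \<Omega>" and VU: "insert Z W \<subseteq> U"
    and r: "0 < r" "cball c r \<subseteq> convex hull (insert Z W)"
    and h: "\<And>S R. S \<in> insert Z W \<Longrightarrow> R \<in> insert Z W \<Longrightarrow> norm (S - R) \<le> h"
begin

lemma g_unit: "norm g = 1"
  using chart by (simp add: local_chart_def)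

lemma estimate: "x \<in> U \<Longrightarrow> y \<in> U \<Longrightarrow> \<bar>f x - f y - g \<bullet> (x - y)\<bar> \<le> \<eta> * norm (x - y)"
  using chart by (auto simp: local_chart_def)

lemma f_W: "S \<in> W \<Longrightarrow> f S = 0"
  using chart W VU by (auto simp: local_chart_def)

lemma f_Z: "0 < f Z"
  using chart Z\<Omega> VU by (auto simp: local_chart_def)

lemma hull_W_U: "convex hull W \<subseteq> U"
  using VU convU by (intro hull_minimal) auto

lemma h_nonneg: "0 \<le> h"
  using h[of Z Z] by simp

lemma tangential_vertices: "S \<in> W \<Longrightarrow> R \<in> W \<Longrightarrow> \<bar>g \<bullet> (S - R)\<bar> \<le> \<eta> * h"
proof -
  assume SR: "S \<in> W" "R \<in> W"
  have "\<bar>g \<bullet> (S - R)\<bar> \<le> \<eta> * norm (S - R)" using estimate[of S R] SR VU f_W by auto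
  also have "\<dots> \<le> \<eta> * h" using h SR \<eta> by (intro mult_left_mono) auto
  finally show ?thesis .
qed

lemma convex_slab: "convex {x. \<bar>w \<bullet> (x - S)\<bar> \<le> (b :: real)}"
proof -
  have "{x. \<bar>w \<bullet> (x - S)\<bar> \<le> b} = {x. w \<bullet> x \<le> b + w \<bullet> S} \<inter> {x. w \<bullet> x \<ge> w \<bullet> S - b}"
    by (auto simp: inner_diff_right abs_le_iff)
  then show ?thesis by (simp add: convex_Int convex_halfspace_le convex_halfspace_ge)
qed

lemma tangential_face:
  assumes "M \<in> convex hull W" "S \<in> W"
  shows "\<bar>g \<bullet> (M - S)\<bar> \<le> \<eta> * h"
proof -
  have "convex hull W \<subseteq> {x. \<bar>g \<bullet> (x - S)\<bar> \<le> \<eta> * h}"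
    using tangential_vertices assms by (intro hull_minimal convex_slab) auto
  then show ?thesis using assms by auto
qed

text \<open>
A slab that contains the vertices contains the inscribed ball, hence is at least as wide.  The
height of the apex and the closeness of normals below both come from this.
\<close>

lemma slab_width:
  assumes "\<And>S. S \<in> insert Z W \<Longrightarrow> \<bar>w \<bullet> (S - R)\<bar> \<le> b"
  shows "r * norm w \<le> b"
proof (cases "w = 0")
  case True
  then show ?thesis using assms[of Z] by simp
next
  case False
  let ?u = "(r / norm w) *\<^sub>R w"
  have sub: "convex hull (insert Z W) \<subseteq> {x. \<bar>w \<bullet> (x - R)\<bar> \<le> b}"
    using assms by (intro hull_minimal convex_slab) auto
  have u: "norm ?u = r" using False r by simp
  have "c + ?u \<in> cball c r" "c - ?u \<in> cball c r" using u by (auto simp: dist_norm)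
  then have "\<bar>w \<bullet> (c + ?u - R)\<bar> \<le> b" "\<bar>w \<bullet> (c - ?u - R)\<bar> \<le> b" using sub r by blast+
  moreover have "w \<bullet> (c + ?u - R) - w \<bullet> (c - ?u - R) = 2 * (w \<bullet> ?u)"
    by (simp add: inner_diff_right inner_add_right)
  moreover have "w \<bullet> ?u = r * norm w" using False by (simp add: dot_square_norm power2_eq_square)
  ultimately show ?thesis by linarith
qed

text \<open>
The vertices of the face are almost at the same height with respect to \<open>g\<close>, so the height of the
apex is responsible for the width of the tetrahedron; its sign is that of \<open>f\<close> at the apex.
\<close>

lemma apex_height:
  assumes M: "M \<in> convex hull W"
  shows "r \<le> g \<bullet> (Z - M)"
proof -
  obtain S where S: "S \<in> W" using W by blast
  have "r * norm g \<le> max (\<eta> * h) \<bar>g \<bullet> (Z - M)\<bar>"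
  proof (rule slab_width[of _ M])
    fix R assume R: "R \<in> insert Z W"
    show "\<bar>g \<bullet> (R - M)\<bar> \<le> max (\<eta> * h) \<bar>g \<bullet> (Z - M)\<bar>"
    proof (cases "R = Z")
      case False
      then have "\<bar>g \<bullet> (M - R)\<bar> \<le> \<eta> * h" using R M tangential_face by auto
      then show ?thesis by (simp add: inner_diff_right)
    qed simp
  qed
  then have a: "r \<le> max (\<eta> * h) \<bar>g \<bullet> (Z - M)\<bar>" using g_unit by simp
  have "\<bar>f Z - f S - g \<bullet> (Z - S)\<bar> \<le> \<eta> * norm (Z - S)" using S VU by (intro estimate) auto
  also have "\<dots> \<le> \<eta> * h" using S \<eta> h by (intro mult_left_mono) auto
  finally have b: "- (\<eta> * h) < g \<bullet> (Z - S)" using f_Z f_W[OF S] by linarith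
  have "\<bar>g \<bullet> (M - S)\<bar> \<le> \<eta> * h" by (rule tangential_face[OF M S])
  moreover have "g \<bullet> (Z - M) = g \<bullet> (Z - S) - g \<bullet> (M - S)" by (simp add: inner_diff_right)
  ultimately have "- (2 * (\<eta> * h)) < g \<bullet> (Z - M)" using b by linarith
  then show ?thesis using a \<eta> r by (simp add: max_def split: if_splits)
qed

lemma face_chord:
  assumes M: "M \<in> convex hull W"
  shows "\<bar>f M\<bar> \<le> 2 * (\<eta> * h)" "norm (Z - M) \<le> h"
proof -
  obtain S where S: "S \<in> W" using W by blast
  have hull: "convex hull W \<subseteq> {x. norm (R - x) \<le> h}" if "R \<in> insert Z W" for R
  proof (rule hull_minimal)
    have "{x. norm (R - x) \<le> h} = cball R h" by (auto simp: dist_norm)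
    then show "convex {x. norm (R - x) \<le> h}" by simp
  qed (use h that in auto)
  show "norm (Z - M) \<le> h" using hull[of Z] M by auto
  have "\<bar>f M - f S - g \<bullet> (M - S)\<bar> \<le> \<eta> * norm (M - S)"
    using M S hull_W_U VU by (intro estimate) auto
  also have "\<dots> \<le> \<eta> * h" using S hull[of S] M \<eta> by (intro mult_left_mono) (auto simp: norm_minus_commute)
  finally show "\<bar>f M\<bar> \<le> 2 * (\<eta> * h)" using f_W[OF S] tangential_face[OF M S] by linarith
qed

text \<open>
The gradient of the barycentric coordinate of the apex: an inner normal of the face, which after
normalisation becomes the negative of \<open>face_normal\<close>.
\<close>

definition normal :: pt where
  "normal = (SOME n. \<exists>d. \<forall>x. bary (insert Z W) Z x = d + n \<bullet> x)"

lemma normal_props: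
  "\<And>x y. bary (insert Z W) Z x - bary (insert Z W) Z y = normal \<bullet> (x - y)"
  "\<And>S R. S \<in> W \<Longrightarrow> R \<in> W \<Longrightarrow> normal \<bullet> (S - R) = 0"
  "\<And>S. S \<in> W \<Longrightarrow> normal \<bullet> (Z - S) = 1"
  "normal \<noteq> 0"
proof -
  have "\<exists>n d. \<forall>x. bary (insert Z W) Z x = d + n \<bullet> x" using bary_affine[OF V, of Z] by (metis insertI1)
  then obtain d where d: "\<And>x. bary (insert Z W) Z x = d + normal \<bullet> x"
    unfolding normal_def using someI_ex[of "\<lambda>n. \<exists>d. \<forall>x. bary (insert Z W) Z x = d + n \<bullet> x"] by blast
  show 1: "\<And>x y. bary (insert Z W) Z x - bary (insert Z W) Z y = normal \<bullet> (x - y)"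
    by (simp add: d inner_diff_right)
  have b: "bary (insert Z W) Z S = 0" if "S \<in> W" for S using bary_exists[OF V, of Z] that Z by auto
  have b1: "bary (insert Z W) Z Z = 1" using bary_exists[OF V, of Z] by auto
  show "\<And>S R. S \<in> W \<Longrightarrow> R \<in> W \<Longrightarrow> normal \<bullet> (S - R) = 0" using b by (simp flip: 1)
  show 3: "\<And>S. S \<in> W \<Longrightarrow> normal \<bullet> (Z - S) = 1" using b b1 by (simp flip: 1)
  show "normal \<noteq> 0" using 3 W by fastforce
qed

lemma normal_face:
  assumes "x \<in> convex hull W" "y \<in> convex hull W"
  shows "normal \<bullet> (x - y) = 0" "normal \<bullet> (Z - x) = 1"
proof -
  have *: "bary (insert Z W) Z x = 0" if "x \<in> convex hull W" for x
    using bary_on_face(1)[OF V _ that, of Z] Z by auto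
  have b1: "bary (insert Z W) Z Z = 1" using bary_exists[OF V, of Z] by auto
  show "normal \<bullet> (x - y) = 0" "normal \<bullet> (Z - x) = 1"
    using *[OF assms(1)] *[OF assms(2)] b1 by (simp_all flip: normal_props(1))
qed

text \<open>
A vector almost orthogonal to the face is almost a multiple of the normal, because subtracting the
multiple that matches its product with the edge from \<open>S\<close> to the apex leaves a vector whose products with all edges
at \<open>S\<close> are small.
\<close>

lemma vector_decomposition:
  assumes S: "S \<in> W" and b: "\<And>R. R \<in> W \<Longrightarrow> \<bar>v \<bullet> (R - S)\<bar> \<le> b" "0 \<le> b"
  shows "r * norm (v - (v \<bullet> (Z - S)) *\<^sub>R normal) \<le> b"
proof (rule slab_width[of _ S])
  fix R assume "R \<in> insert Z W"
  then show "\<bar>(v - (v \<bullet> (Z - S)) *\<^sub>R normal) \<bullet> (R - S)\<bar> \<le> b"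
    using S b normal_props(2,3) by (cases "R = Z") (auto simp: inner_diff_left)
qed

lemma outward_normal_unique:
  "(THE \<nu>. norm \<nu> = 1 \<and> (\<forall>x\<in>convex hull W. \<forall>y\<in>convex hull W. \<nu> \<bullet> (x - y) = 0) \<and>
      (\<forall>x\<in>convex hull W. \<nu> \<bullet> (Z - x) < 0)) = - (normal /\<^sub>R norm normal)"
  (is "The ?P = ?\<nu>")
proof (rule the_equality)
  have n0: "0 < norm normal" using normal_props(4) by simp
  show "?P ?\<nu>" using normal_face n0 by (auto simp: normal_props(4))
  fix \<nu> assume \<nu>: "?P \<nu>"
  obtain S where S: "S \<in> W" using W by blast
  have inW: "R \<in> convex hull W" if "R \<in> W" for R using that by (rule hull_inc)
  have "r * norm (\<nu> - (\<nu> \<bullet> (Z - S)) *\<^sub>R normal) \<le> 0"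
    using \<nu> inW S by (intro vector_decomposition) auto
  then have eq: "\<nu> = (\<nu> \<bullet> (Z - S)) *\<^sub>R normal" using r by (simp add: mult_le_0_iff)
  have neg: "\<nu> \<bullet> (Z - S) < 0" using \<nu> inW[OF S] by blast
  have "1 = norm ((\<nu> \<bullet> (Z - S)) *\<^sub>R normal)" using \<nu> eq by metis
  then have "1 = - (\<nu> \<bullet> (Z - S)) * norm normal" using neg by simp
  then have "\<nu> \<bullet> (Z - S) = - (1 / norm normal)" using n0 by (simp add: field_simps)
  with eq show "\<nu> = ?\<nu>" by (simp add: divide_inverse)
qed

text \<open>
By \<open>vector_decomposition\<close> the unit vector \<open>g\<close> is close to a nonnegative multiple of the normal, hence
to the unit normal itself.
\<close>

lemma normal_close:
  "r * norm (g - normal /\<^sub>R norm normal) \<le> 2 * (\<eta> * h)"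
proof -
  obtain S where S: "S \<in> W" using W by blast
  have n0: "0 < norm normal" using normal_props(4) by simp
  let ?a = "g \<bullet> (Z - S)"
  let ?n = "normal /\<^sub>R norm normal"
  have w: "r * norm (g - ?a *\<^sub>R normal) \<le> \<eta> * h"
    using S tangential_vertices \<eta> h_nonneg by (intro vector_decomposition) auto
  have a0: "0 \<le> ?a" using apex_height[of S] hull_inc[OF S, of convex] r by linarith
  have "g - ?n = (g - ?a *\<^sub>R normal) + (?a * norm normal - 1) *\<^sub>R ?n"
    using n0 by (simp add: algebra_simps)
  then have "norm (g - ?n) \<le> norm (g - ?a *\<^sub>R normal) + norm ((?a * norm normal - 1) *\<^sub>R ?n)"
    by (metis norm_triangle_ineq)
  also have "norm ((?a * norm normal - 1) *\<^sub>R ?n) = \<bar>?a * norm normal - 1\<bar>" using n0 by (simp add: abs_mult)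
  also have "?a * norm normal = norm (?a *\<^sub>R normal)" using a0 by simp
  also have "\<bar>norm (?a *\<^sub>R normal) - 1\<bar> \<le> norm (g - ?a *\<^sub>R normal)"
    using norm_triangle_ineq3[of "?a *\<^sub>R normal" g] g_unit by (simp add: norm_minus_commute)
  finally have "r * norm (g - ?n) \<le> r * (2 * norm (g - ?a *\<^sub>R normal))" using r by simp
  then show ?thesis using w by linarith
qed

end

section \<open>Conforming tetrahedral meshes\<close>

locale mesh =
  fixes \<Omega> :: "pt set" and \<T> :: mesh
  assumes open_\<Omega>: "open \<Omega>" and fitted: "fitted_mesh \<Omega> \<T>"
begin

lemma finite_mesh: "finite \<T>"
  and tetrahedra: "T \<in> \<T> \<Longrightarrow> 3 simplex T"
  using fitted by (auto simp: fitted_mesh_def triangulation_def)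

lemma face_Int: "T \<in> \<T> \<Longrightarrow> T' \<in> \<T> \<Longrightarrow> (T \<inter> T') face_of T"
  using fitted by (auto simp: fitted_mesh_def triangulation_def)

lemma compact_element: "T \<in> \<T> \<Longrightarrow> compact T"
  and convex_element: "T \<in> \<T> \<Longrightarrow> convex T"
  using tetrahedra compact_simplex convex_simplex by blast+

lemma closed_union: "closed (\<Union>\<T>)"
  using finite_mesh compact_element by (intro closed_Union) (auto intro: compact_imp_closed)

lemma interior_element_nonempty: "T \<in> \<T> \<Longrightarrow> interior T \<noteq> {}"
proof -
  assume T: "T \<in> \<T>"
  have "aff_dim T = 3" using aff_dim_simplex[OF tetrahedra[OF T]] .
  then have "interior T = rel_interior T" "T \<noteq> {}"
    using convex_element[OF T] by (auto simp: interior_rel_interior_gen)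
  then show ?thesis using convex_element[OF T] rel_interior_eq_empty by metis
qed

lemma mesh_boundary_eq: "mesh_boundary \<T> = \<Union>\<T> - interior (\<Union>\<T>)"
proof -
  have "\<Union>\<T> \<subseteq> closure (interior (\<Union>\<T>))"
  proof (rule Union_least)
    fix T assume T: "T \<in> \<T>"
    have "T \<subseteq> closure (interior T)"
      using convex_closure_interior[OF convex_element[OF T] interior_element_nonempty[OF T]] closure_subset by blast
    also have "\<dots> \<subseteq> closure (interior (\<Union>\<T>))" using T by (intro closure_mono interior_mono) auto
    finally show "T \<subseteq> closure (interior (\<Union>\<T>))" .
  qed
  moreover have "closure (interior (\<Union>\<T>)) \<subseteq> \<Union>\<T>"
    using closed_union by (metis closure_closed closure_mono interior_subset)
  ultimately have "closure (interior (\<Union>\<T>)) = \<Union>\<T>" by blast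
  then show ?thesis by (simp add: mesh_boundary_def mesh_domain_def frontier_def)
qed

lemma closed_mesh_boundary: "closed (mesh_boundary \<T>)"
  by (simp add: mesh_boundary_def)

text \<open>
Whether a point is interior to the union of the elements depends only on the face whose relative
interior contains it.  An element that contains one relative interior point of \<open>\<Phi>\<close> contains \<open>\<Phi>\<close>, and
a homothety with centre \<open>y \<in> \<Phi>\<close> that maps \<open>x\<close> to \<open>N\<close> maps each of these elements into itself, hence a
neighbourhood of \<open>x\<close> inside the union to a neighbourhood of \<open>N\<close> inside it.
\<close>

lemma carrier_subset_mesh_boundary:
  assumes T: "T \<in> \<T>" and \<Phi>: "\<Phi> face_of T" and N: "N \<in> rel_interior \<Phi>" "N \<in> mesh_boundary \<T>"
  shows "\<Phi> \<subseteq> mesh_boundary \<T>"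
proof -
  have conv: "convex \<Phi>" using \<Phi> by (rule face_of_imp_convex)
  have \<Phi>T: "\<Phi> \<subseteq> T" using \<Phi> by (rule face_of_imp_subset)
  have "rel_interior \<Phi> \<subseteq> mesh_boundary \<T>"
  proof
    fix x assume x: "x \<in> rel_interior \<Phi>"
    have x\<Phi>: "x \<in> \<Phi>" using x rel_interior_subset by blast
    \<comment> \<open>\<open>T \<inter> T'\<close> is a face of \<open>T\<close> that meets the relative interior of \<open>\<Phi>\<close>\<close>
    have sup: "\<Phi> \<subseteq> T'" if "T' \<in> \<T>" "x \<in> T'" for T'
    proof -
      have "\<Phi> \<subseteq> T \<inter> T'"
        using subset_of_face_of[OF face_Int[OF T that(1)] \<Phi>T] x that \<Phi>T x\<Phi> by (auto simp: disjnt_def)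
      then show ?thesis by blast
    qed
    have "x \<notin> interior (\<Union>\<T>)"
    proof
      assume "x \<in> interior (\<Union>\<T>)"
      moreover have "open (- \<Union>{T' \<in> \<T>. x \<notin> T'})"
        using finite_mesh compact_element by (intro open_Compl closed_Union) (auto intro: compact_imp_closed)
      ultimately obtain \<rho> where \<rho>: "0 < \<rho>" "ball x \<rho> \<subseteq> interior (\<Union>\<T>) \<inter> - \<Union>{T' \<in> \<T>. x \<notin> T'}"
        using open_contains_ball[of "interior (\<Union>\<T>) \<inter> - \<Union>{T' \<in> \<T>. x \<notin> T'}"]
          open_Int[OF open_interior, of "- \<Union>{T' \<in> \<T>. x \<notin> T'}"] by blast
      obtain e where e: "1 < e" "(1 - e) *\<^sub>R x + e *\<^sub>R N \<in> \<Phi>"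
        using N(1) x\<Phi> convex_rel_interior_iff[OF conv] by (metis empty_iff)
      \<comment> \<open>the centre of the homothety, on the ray from \<open>x\<close> through \<open>N\<close>\<close>
      define y where "y = (1 - e) *\<^sub>R x + e *\<^sub>R N"
      let ?s = "1 - 1 / e"
      have s: "0 < ?s" using e by simp
      have "ball N (?s * \<rho>) \<subseteq> \<Union>\<T>"
      proof
        fix w assume w: "w \<in> ball N (?s * \<rho>)"
        define v where "v = (w - N) /\<^sub>R ?s"
        have "norm (w - N) < ?s * \<rho>" using w by (simp add: dist_norm norm_minus_commute)
        moreover have "norm v = norm (w - N) / ?s" using s by (simp add: v_def divide_inverse mult.commute)
        ultimately have "norm v < \<rho>" using s by (simp add: pos_divide_less_eq mult.commute)
        then have "x + v \<in> ball x \<rho>" by (simp add: dist_norm)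
        then have "x + v \<in> \<Union>\<T>" "x + v \<notin> \<Union>{T' \<in> \<T>. x \<notin> T'}" using \<rho> interior_subset by blast+
        then obtain T' where T': "T' \<in> \<T>" "x + v \<in> T'" "x \<in> T'" by blast
        have "y \<in> T'" using sup[OF T'(1,3)] e by (auto simp: y_def)
        then have "?s *\<^sub>R (x + v) + (1 / e) *\<^sub>R y \<in> T'"
          using T' e s by (intro convexD[OF convex_element[OF T'(1)]]) auto
        moreover have "?s *\<^sub>R (x + v) + (1 / e) *\<^sub>R y = w"
        proof -
          have "?s *\<^sub>R v = (?s * inverse ?s) *\<^sub>R (w - N)" by (simp only: v_def scaleR_scaleR)
          then have "?s *\<^sub>R v = w - N" using s by (simp only: right_inverse[of ?s] less_irrefl scaleR_one not_False_eq_True)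
          moreover have "(1 / e) *\<^sub>R y = N - ?s *\<^sub>R x" using e
            by (simp add: y_def algebra_simps diff_divide_distrib)
          ultimately show ?thesis by (simp add: scaleR_add_right)
        qed
        ultimately show "w \<in> \<Union>\<T>" using T' by auto
      qed
      moreover have "N \<in> ball N (?s * \<rho>)" using s \<rho> by simp
      ultimately have "N \<in> interior (\<Union>\<T>)" using interior_maximal open_ball by blast
      then show False using N mesh_boundary_eq by auto
    qed
    then show "x \<in> mesh_boundary \<T>" using mesh_boundary_eq x\<Phi> \<Phi>T T by auto
  qed
  then have "closure (rel_interior \<Phi>) \<subseteq> mesh_boundary \<T>"
    using closed_mesh_boundary by (rule closure_minimal)
  then show ?thesis using convex_closure_rel_interior[OF conv] closure_subset by blast
qed

lemma vertex_frontier: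
  assumes "T \<in> \<T>" "S \<in> verts T" "S \<in> mesh_boundary \<T>"
  shows "S \<in> boundary_vertices \<T>" "S \<in> frontier \<Omega>"
proof -
  show "S \<in> boundary_vertices \<T>"
    using assms by (auto simp: boundary_vertices_def mesh_vertices_def verts_def)
  then show "S \<in> frontier \<Omega>" using fitted by (auto simp: fitted_mesh_def)
qed

lemma facet_verts:
  assumes "T \<in> \<T>" "F facet_of T"
  shows "verts F \<subseteq> verts T" "card (verts F) = 3" "convex hull verts F = F"
proof -
  have F: "F face_of T" "aff_dim F = aff_dim T - 1" using assms by (auto simp: facet_of_def)
  note fv = face_verts[OF tetrahedra[OF assms(1)] F(1)]
  show "verts F \<subseteq> verts T" "convex hull verts F = F" using fv by auto
  have "aff_dim F = aff_dim (verts F)" using fv(2) by (metis aff_dim_convex_hull)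
  also have "\<dots> = int (card (verts F)) - 1" using fv(4) affine_independent_iff_card by blast
  finally show "card (verts F) = 3" using F(2) aff_dim_simplex[OF tetrahedra[OF assms(1)]] by simp
qed

text \<open>
The definite descriptions of the boundary face and the inner vertex are well defined: the vertices
of a facet on the boundary lie on \<open>\<Gamma>\<close>, so they are all vertices except the only one off \<open>\<Gamma>\<close>.
\<close>

lemma face_element:
  assumes T: "T \<in> face_elements \<T>"
  shows "T \<in> \<T>" "boundary_face \<T> T facet_of T" "boundary_face \<T> T \<subseteq> mesh_boundary \<T>"
    "verts T = insert (inner_vertex \<Omega> T) (verts (boundary_face \<T> T))"
    "inner_vertex \<Omega> T \<notin> verts (boundary_face \<T> T)"
    "inner_vertex \<Omega> T \<in> \<Omega>" "verts (boundary_face \<T> T) \<subseteq> frontier \<Omega>"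
    "\<And>F. F facet_of T \<Longrightarrow> F \<subseteq> mesh_boundary \<T> \<Longrightarrow> F = boundary_face \<T> T"
    "\<And>G. G facet_of T \<Longrightarrow> inner_vertex \<Omega> T \<notin> G \<Longrightarrow> G = boundary_face \<T> T"
proof -
  show TT: "T \<in> \<T>" using T by (auto simp: face_elements_def)
  note V = tetrahedron_verts[OF tetrahedra[OF TT]]
  have ex1: "\<exists>!S. S extreme_point_of T \<and> S \<notin> frontier \<Omega>"
    using fitted T by (auto simp: fitted_mesh_def)
  let ?Z = "inner_vertex \<Omega> T"
  have Z: "?Z \<in> verts T" "?Z \<notin> frontier \<Omega>"
    using theI'[OF ex1] by (auto simp: inner_vertex_def verts_def)
  have facet: "verts F = verts T - {?Z}" if "F facet_of T" "?Z \<notin> verts F" for F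
  proof (rule card_subset_eq)
    show "finite (verts T - {?Z})" using V by simp
    show "verts F \<subseteq> verts T - {?Z}" using facet_verts[OF TT that(1)] that by auto
    show "card (verts F) = card (verts T - {?Z})" using facet_verts[OF TT that(1)] V Z by simp
  qed
  have bd: "verts F \<subseteq> frontier \<Omega>" if "F facet_of T" "F \<subseteq> mesh_boundary \<T>" for F
    using vertex_frontier(2)[OF TT] facet_verts[OF TT that(1)] hull_subset[of "verts F" convex] that(2) by blast
  have uniq: "F = convex hull (verts T - {?Z})" if "F facet_of T" "F \<subseteq> mesh_boundary \<T>" for F
  proof -
    have "?Z \<notin> verts F" using bd[OF that] Z by blast
    from facet[OF that(1) this] show ?thesis using facet_verts(3)[OF TT that(1)] by metis
  qed
  obtain F where F: "F facet_of T" "F \<subseteq> mesh_boundary \<T>" using T by (auto simp: face_elements_def)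
  have "boundary_face \<T> T = F"
    unfolding boundary_face_def using F uniq by (intro the_equality conjI) (assumption, assumption, metis)
  then show bf: "boundary_face \<T> T facet_of T" "boundary_face \<T> T \<subseteq> mesh_boundary \<T>" using F by auto
  have eq: "verts (boundary_face \<T> T) = verts T - {?Z}"
    using facet[OF bf(1)] bd[OF bf] Z by auto
  show "verts T = insert ?Z (verts (boundary_face \<T> T))" "?Z \<notin> verts (boundary_face \<T> T)"
    using eq Z by auto
  show "verts (boundary_face \<T> T) \<subseteq> frontier \<Omega>" by (rule bd[OF bf])
  have "?Z \<in> mesh_vertices \<T>" using Z TT by (auto simp: mesh_vertices_def verts_def)
  then have "?Z \<in> closure \<Omega>" using fitted by (auto simp: fitted_mesh_def)
  then show "?Z \<in> \<Omega>" using Z open_\<Omega> by (auto simp: frontier_def interior_open)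
  show "F = boundary_face \<T> T" if "F facet_of T" "F \<subseteq> mesh_boundary \<T>" for F
    using uniq[OF that] uniq[OF bf] by simp
  show "G = boundary_face \<T> T" if "G facet_of T" "?Z \<notin> G" for G
  proof -
    have "?Z \<notin> verts G" using that(2) facet_verts(3)[OF TT that(1)] hull_subset[of "verts G" convex] by blast
    then have "verts G = verts (boundary_face \<T> T)" using facet[OF that(1)] eq by simp
    then show ?thesis using facet_verts(3)[OF TT that(1)] facet_verts(3)[OF TT bf(1)] by metis
  qed
qed

lemma edge_endpoints:
  assumes "T \<in> \<T>" "e edge_of T"
  obtains a b where "a \<noteq> b" "e = closed_segment a b" "verts e = {a, b}" "a \<in> verts T" "b \<in> verts T"
proof -
  have e: "e face_of T" "aff_dim e = 1" using assms by (auto simp: edge_of_def)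
  note fv = face_verts[OF tetrahedra[OF assms(1)] e(1)]
  have "aff_dim e = aff_dim (verts e)" using fv(2) by (metis aff_dim_convex_hull)
  also have "\<dots> = int (card (verts e)) - 1" using fv(4) affine_independent_iff_card by blast
  finally have "card (verts e) = 2" using e(2) by simp
  then obtain a b where "verts e = {a, b}" "a \<noteq> b" by (auto simp: card_2_iff)
  then show ?thesis using that[of a b] fv by (simp add: segment_convex_hull)
qed

lemma boundary_edge_endpoints:
  assumes "e \<in> boundary_edges \<T>"
  obtains a b where "a \<noteq> b" "e = closed_segment a b" "a \<in> frontier \<Omega>" "b \<in> frontier \<Omega>"
proof -
  obtain T where T: "T \<in> \<T>" "e edge_of T" and sub: "e \<subseteq> mesh_boundary \<T>"
    using assms by (auto simp: boundary_edges_def)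
  obtain a b where ab: "a \<noteq> b" "e = closed_segment a b" "a \<in> verts T" "b \<in> verts T"
    using edge_endpoints[OF T] by metis
  then show ?thesis using that[of a b] vertex_frontier(2)[OF T(1)] sub by auto
qed

end

section \<open>Boundary points near the nodes of the mesh\<close>

lemma orthogonal_segment:
  fixes u :: "'a::real_inner"
  assumes u: "u \<bullet> (b - a) = 0" and pq: "p \<in> closed_segment a b" "q \<in> closed_segment a b"
  shows "u \<bullet> (p - q) = 0"
proof -
  obtain s t where pqe: "p = (1 - s) *\<^sub>R a + s *\<^sub>R b" "q = (1 - t) *\<^sub>R a + t *\<^sub>R b"
    using pq by (auto simp: in_segment)
  have "p - q = (s - t) *\<^sub>R (b - a)" unfolding pqe by (simp add: algebra_simps)
  then show ?thesis using u by simp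
qed

text \<open>
Both vectors are close to \<open>- g\<close>, hence their sum is close to \<open>- 2 g\<close>: if the cosine of
the angle between \<open>u\<close> and the sum has modulus at least \<open>c\<close>, then that of the angle between \<open>u\<close> and \<open>g\<close> has
modulus at least \<open>c / 2\<close>.
\<close>

lemma bisector_transversal:
  fixes g u :: "'a::real_inner"
  assumes g: "norm g = 1" and \<nu>: "norm (\<nu> + g) \<le> \<epsilon>" "norm (\<nu>' + g) \<le> \<epsilon>" and c: "4 * \<epsilon> \<le> c" "c \<le> 1"
    and u: "c * (norm u * norm (\<nu> + \<nu>')) \<le> \<bar>u \<bullet> (\<nu> + \<nu>')\<bar>"
  shows "c / 2 * norm u \<le> \<bar>g \<bullet> u\<bar>"
proof -
  let ?b = "\<nu> + \<nu>'"
  have \<epsilon>: "0 \<le> \<epsilon>" using \<nu>(1) norm_ge_zero order_trans by blast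
  have "?b + 2 *\<^sub>R g = (\<nu> + g) + (\<nu>' + g)" by (simp add: scaleR_2)
  then have "norm (?b + 2 *\<^sub>R g) \<le> norm (\<nu> + g) + norm (\<nu>' + g)" by (metis norm_triangle_ineq)
  then have d: "norm (?b + 2 *\<^sub>R g) \<le> 2 * \<epsilon>" using \<nu> by linarith
  have "norm (2 *\<^sub>R g) \<le> norm (?b + 2 *\<^sub>R g) + norm ?b"
    using norm_triangle_ineq4[of "?b + 2 *\<^sub>R g" ?b] by simp
  then have nb: "2 - 2 * \<epsilon> \<le> norm ?b" using d g by simp
  have "u \<bullet> ?b = u \<bullet> (?b + 2 *\<^sub>R g) - 2 * (g \<bullet> u)" by (simp add: inner_add_right inner_commute)
  moreover have "\<bar>u \<bullet> (?b + 2 *\<^sub>R g)\<bar> \<le> norm u * (2 * \<epsilon>)"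
    using Cauchy_Schwarz_ineq2[of u "?b + 2 *\<^sub>R g"] mult_left_mono[OF d norm_ge_zero[of u]] by linarith
  ultimately have "\<bar>u \<bullet> ?b\<bar> \<le> 2 * \<bar>g \<bullet> u\<bar> + norm u * (2 * \<epsilon>)" by linarith
  moreover have "c * (norm u * (2 - 2 * \<epsilon>)) \<le> c * (norm u * norm ?b)"
    using nb c \<epsilon> by (intro mult_left_mono) auto
  ultimately have "c * (norm u * (2 - 2 * \<epsilon>)) \<le> 2 * \<bar>g \<bullet> u\<bar> + norm u * (2 * \<epsilon>)" using u by linarith
  then have "norm u * (c * (2 - 2 * \<epsilon>) - 2 * \<epsilon>) \<le> 2 * \<bar>g \<bullet> u\<bar>" by (simp add: algebra_simps)
  moreover have "c \<le> c * (2 - 2 * \<epsilon>) - 2 * \<epsilon>"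
    using mult_right_mono[OF c(2) \<epsilon>] c(1) by (simp add: right_diff_distrib)
  then have "norm u * c \<le> norm u * (c * (2 - 2 * \<epsilon>) - 2 * \<epsilon>)" by (intro mult_left_mono) auto
  ultimately show ?thesis by (simp add: mult.commute)
qed

text \<open>
The vector \<open>u\<close> is the altitude of the apex over the line through \<open>a\<close> and \<open>b\<close>.  It has the height of the
apex up to the contribution of a multiple of \<open>b - a\<close>, which is no longer than \<open>h\<close> and almost
tangential.
\<close>

lemma (in flat_tetrahedron) altitude_transversal:
  assumes ab: "a \<in> convex hull W" "b \<in> convex hull W" "a \<in> frontier \<Omega>" "b \<in> frontier \<Omega>"
    and u: "u = (Z - a) - t *\<^sub>R (b - a)" "u \<bullet> (b - a) = 0"
  shows "norm u \<le> h" "r / 2 \<le> g \<bullet> u"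
proof -
  have "orthogonal u (t *\<^sub>R (b - a))" using u by (simp add: orthogonal_def)
  from norm_add_Pythagorean[OF this]
  have pyth: "(norm (Z - a))\<^sup>2 = (norm u)\<^sup>2 + (norm (t *\<^sub>R (b - a)))\<^sup>2" using u(1) by simp
  have Za: "norm (Z - a) \<le> h" by (rule face_chord(2)[OF ab(1)])
  show "norm u \<le> h" using pyth Za by (smt (verit) power2_le_imp_le norm_ge_zero zero_le_power2)
  have nt: "norm (t *\<^sub>R (b - a)) \<le> h"
    using pyth Za by (smt (verit) power2_le_imp_le norm_ge_zero zero_le_power2)
  have U: "b \<in> U" "a \<in> U" using hull_W_U ab by blast+
  then have "f a = 0" "f b = 0" using chart ab unfolding local_chart_def by blast+
  then have gba: "\<bar>g \<bullet> (b - a)\<bar> \<le> \<eta> * norm (b - a)" using estimate[OF U] by simp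
  have "\<bar>g \<bullet> (t *\<^sub>R (b - a))\<bar> = \<bar>t\<bar> * \<bar>g \<bullet> (b - a)\<bar>" by (simp add: abs_mult)
  also have "\<dots> \<le> \<bar>t\<bar> * (\<eta> * norm (b - a))" using gba by (intro mult_left_mono) auto
  also have "\<dots> = \<eta> * norm (t *\<^sub>R (b - a))" by simp
  also have "\<dots> \<le> \<eta> * h" using nt \<eta>(1) by (rule mult_left_mono)
  finally show "r / 2 \<le> g \<bullet> u"
    using apex_height[OF ab(1)] \<eta>(2) r(1) unfolding u(1) inner_diff_right[of g "Z - a"] by linarith
qed

context mesh
begin

lemma diameter_bound: "T \<in> \<T> \<Longrightarrow> x \<in> T \<Longrightarrow> y \<in> T \<Longrightarrow> dist x y \<le> diameter T"
  using compact_element compact_imp_bounded diameter_bounded_bound by blast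

lemma flat_face_element:
  assumes T: "T \<in> face_elements \<T>" and chart: "local_chart \<Omega> \<eta> (ball p \<delta>) f g" and sub: "T \<subseteq> ball p \<delta>"
    and r: "0 < r" "cball c r \<subseteq> T" and \<eta>: "0 \<le> \<eta>" "4 * (\<eta> * diameter T) \<le> r"
  shows "flat_tetrahedron \<Omega> \<eta> (ball p \<delta>) f g (verts (boundary_face \<T> T)) (inner_vertex \<Omega> T) c r (diameter T)"
proof -
  note F = face_element[OF T]
  note V = tetrahedron_verts[OF tetrahedra[OF F(1)]]
  have "card (verts (boundary_face \<T> T)) = 3" by (rule facet_verts[OF F(1,2)])
  then have ne: "verts (boundary_face \<T> T) \<noteq> {}" by auto
  have VT: "verts T \<subseteq> T" using V(4) hull_subset[of "verts T" convex] by simp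
  show ?thesis
  proof
    show "convex hull insert (inner_vertex \<Omega> T) (verts (boundary_face \<T> T)) \<supseteq> cball c r"
      using V(4) r by (simp flip: F(4))
    show "\<not> affine_dependent (insert (inner_vertex \<Omega> T) (verts (boundary_face \<T> T)))"
      using V(2) by (simp flip: F(4))
    show "insert (inner_vertex \<Omega> T) (verts (boundary_face \<T> T)) \<subseteq> ball p \<delta>"
      using VT sub by (simp flip: F(4))
    show "norm (S - R) \<le> diameter T"
      if "S \<in> insert (inner_vertex \<Omega> T) (verts (boundary_face \<T> T))"
        "R \<in> insert (inner_vertex \<Omega> T) (verts (boundary_face \<T> T))" for S R
    proof -
      have "S \<in> T" "R \<in> T" using that VT unfolding F(4)[symmetric] by auto
      then show ?thesis using diameter_bound[OF F(1)] by (simp add: dist_norm)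
    qed
  qed (use chart \<eta> F(5-7) ne r(1) in auto)
qed

end

text \<open>
A mesh of shape parameter \<open>K\<close> that is so fine that every element lies in a chart of flatness \<open>\<eta>\<close>
around each of its boundary vertices.
\<close>

locale resolved_mesh = mesh +
  fixes \<theta> :: real and \<Delta> :: "pt set \<Rightarrow> pt set" and \<eta> \<delta> K :: real
  assumes adm: "admissible_planes \<Omega> \<T> \<theta> \<Delta>" and cos: "0 < cos \<theta>"
    and charts: "\<And>p. p \<in> frontier \<Omega> \<Longrightarrow> \<exists>f g. local_chart \<Omega> \<eta> (ball p \<delta>) f g"
    and shape: "\<And>T. T \<in> \<T> \<Longrightarrow> \<exists>c r. 0 < r \<and> cball c r \<subseteq> T \<and> diameter T \<le> K * r"
    and K: "1 \<le> K" and \<eta>: "0 \<le> \<eta>" "8 * (\<eta> * K) \<le> cos \<theta>"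
    and \<delta>: "\<And>T. T \<in> \<T> \<Longrightarrow> 2 * diameter T < \<delta>"
begin

lemma \<eta>K: "0 \<le> \<eta> * K" "4 * (\<eta> * K) \<le> 1"
proof -
  show "0 \<le> \<eta> * K" using \<eta> K by simp
  then show "4 * (\<eta> * K) \<le> 1" using \<eta>(2) cos_le_one[of \<theta>] by linarith
qed

lemma flat_scaled:
  assumes T: "T \<in> face_elements \<T>" and p: "p \<in> T" and chart: "local_chart \<Omega> \<eta> (ball p \<delta>) f g"
    and r: "0 < r" "cball c r \<subseteq> T" "diameter T \<le> K * r"
  shows "flat_tetrahedron \<Omega> \<eta> (ball p \<delta>) f g (verts (boundary_face \<T> T)) (inner_vertex \<Omega> T) c r (diameter T)"
proof -
  have TT: "T \<in> \<T>" by (rule face_element(1)[OF T])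
  have h0: "0 \<le> diameter T" by (rule diameter_ge_0[OF compact_imp_bounded[OF compact_element[OF TT]]])
  have sub: "T \<subseteq> ball p \<delta>" using diameter_bound[OF TT p] \<delta>[OF TT] h0 by fastforce
  have "4 * (\<eta> * diameter T) \<le> 4 * (\<eta> * (K * r))" using r \<eta> by (intro mult_left_mono) auto
  also have "\<dots> = (4 * (\<eta> * K)) * r" by simp
  also have "\<dots> \<le> 1 * r" using \<eta>K r by (intro mult_right_mono) auto
  finally show ?thesis using flat_face_element[OF T chart sub r(1,2) \<eta>(1)] by simp
qed

text \<open>
The line through the apex \<open>Z\<close> and \<open>M\<close> is transversal, since the height of \<open>Z\<close> is comparable with
its distance from \<open>M\<close>.
\<close>

lemma face_intersection:
  assumes T: "T \<in> face_elements \<T>"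
    and r: "0 < r" "cball c r \<subseteq> T" "diameter T \<le> K * r"
    and M: "M \<in> boundary_face \<T> T"
  shows "\<exists>P. nearest_intersection (frontier \<Omega>) (affine hull {inner_vertex \<Omega> T, M}) M P \<and>
      dist M P \<le> 4 * \<eta> * K * diameter T"
proof -
  note F = face_element[OF T]
  let ?W = "verts (boundary_face \<T> T)" and ?Z = "inner_vertex \<Omega> T" and ?h = "diameter T"
  note fv = facet_verts[OF F(1,2)]
  obtain p where p: "p \<in> ?W" using fv(2) by (metis card.empty ex_in_conv zero_neq_numeral)
  have WT: "?W \<subseteq> T" using fv(3) F(2) hull_subset[of ?W convex] by (auto dest: facet_of_imp_subset)
  obtain f g where chart: "local_chart \<Omega> \<eta> (ball p \<delta>) f g" using charts p F(7) by blast
  have h0: "0 \<le> ?h" by (rule diameter_ge_0[OF compact_imp_bounded[OF compact_element[OF F(1)]]])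
  have ft: "flat_tetrahedron \<Omega> \<eta> (ball p \<delta>) f g ?W ?Z c r ?h"
    using p WT by (intro flat_scaled[OF T _ chart r]) auto
  note rK = r and eta = \<eta>
  interpret flat_tetrahedron \<Omega> \<eta> "ball p \<delta>" f g ?W ?Z c r ?h by (rule ft)
  have MW: "M \<in> convex hull ?W" using M fv(3) by simp
  have MT: "M \<in> T" using M F(2) facet_of_imp_subset by blast
  let ?\<kappa> = "1 / K" and ?b = "2 * (\<eta> * ?h)"
  have b: "2 * ?b / ?\<kappa> = 4 * \<eta> * K * ?h" by simp
  have small: "4 * \<eta> * K * ?h \<le> ?h" using \<eta>K(2) h0 mult_right_mono[of "4 * (\<eta> * K)" 1 ?h] by (simp add: mult.assoc)
  have gZ: "r \<le> g \<bullet> (?Z - M)" by (rule apex_height[OF MW])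
  have "\<exists>s. M + s *\<^sub>R (?Z - M) \<in> frontier \<Omega> \<and> dist M (M + s *\<^sub>R (?Z - M)) \<le> 2 * ?b / ?\<kappa>"
  proof (rule local_chart_transversal_intersection[OF chart])
    show "?Z - M \<noteq> 0" using gZ rK(1) by auto
    have "norm (?Z - M) \<le> K * r" using face_chord(2)[OF MW] rK(3) by linarith
    then have "?\<kappa> * norm (?Z - M) \<le> r" using K by (simp add: field_simps)
    then show "?\<kappa> * norm (?Z - M) \<le> \<bar>g \<bullet> (?Z - M)\<bar>" using gZ by linarith
    show "0 < ?\<kappa>" using K by simp
    have "2 * \<eta> * K \<le> 1" using \<eta>K by (simp add: mult.assoc)
    then show "2 * \<eta> \<le> ?\<kappa>" using K by (simp add: field_simps)
    show "\<bar>f M\<bar> \<le> ?b" by (rule face_chord(1)[OF MW])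
    show "cball M (2 * ?b / ?\<kappa>) \<subseteq> ball p \<delta>"
    proof
      fix x assume "x \<in> cball M (2 * ?b / ?\<kappa>)"
      then have "dist M x \<le> ?h" unfolding b using small by simp
      moreover have "dist p M \<le> ?h" using p WT MT by (intro diameter_bound[OF F(1)]) auto
      ultimately show "x \<in> ball p \<delta>" using \<delta>[OF F(1)] dist_triangle[of p x M] by simp
    qed
  qed
  then obtain s where s: "M + s *\<^sub>R (?Z - M) \<in> frontier \<Omega>" "dist M (M + s *\<^sub>R (?Z - M)) \<le> 4 * \<eta> * K * ?h"
    unfolding b by blast
  have "M + s *\<^sub>R (?Z - M) \<in> affine hull {?Z, M}"
  proof -
    have "M + s *\<^sub>R (?Z - M) = s *\<^sub>R ?Z + (1 - s) *\<^sub>R M" by (simp add: algebra_simps)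
    then show ?thesis unfolding affine_hull_2 mem_Collect_eq by (intro exI[of _ s] exI[of _ "1 - s"]) simp
  qed
  then obtain P where "nearest_intersection (frontier \<Omega>) (affine hull {?Z, M}) M P"
      "dist M P \<le> dist M (M + s *\<^sub>R (?Z - M))"
    using nearest_intersection_exists[of "affine hull {?Z, M}" "M + s *\<^sub>R (?Z - M)" \<Omega> M] s by auto
  then show ?thesis using s by force
qed

lemma flat_at_face_point:
  assumes T: "T \<in> face_elements \<T>" and p: "p \<in> boundary_face \<T> T"
    and chart: "local_chart \<Omega> \<eta> (ball p \<delta>) f g"
  shows "\<exists>c r. diameter T \<le> K * r \<and>
    flat_tetrahedron \<Omega> \<eta> (ball p \<delta>) f g (verts (boundary_face \<T> T)) (inner_vertex \<Omega> T) c r (diameter T)"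
proof -
  note F = face_element[OF T]
  obtain c r where r: "0 < r" "cball c r \<subseteq> T" "diameter T \<le> K * r" using shape[OF F(1)] by blast
  have "p \<in> T" using p F(2) facet_of_imp_subset by blast
  then show ?thesis using flat_scaled[OF T _ chart r] r(3) by blast
qed

lemma face_normal_close:
  assumes T: "T \<in> face_elements \<T>" and p: "p \<in> boundary_face \<T> T"
    and chart: "local_chart \<Omega> \<eta> (ball p \<delta>) f g"
  shows "norm (face_normal \<Omega> \<T> T + g) \<le> 2 * (\<eta> * K)"
proof -
  let ?W = "verts (boundary_face \<T> T)"
  obtain c r where rK: "diameter T \<le> K * r" and
    ft: "flat_tetrahedron \<Omega> \<eta> (ball p \<delta>) f g ?W (inner_vertex \<Omega> T) c r (diameter T)"
    using flat_at_face_point[OF T p chart] by blast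
  let ?n = "flat_tetrahedron.normal ?W (inner_vertex \<Omega> T)"
  have "convex hull ?W = boundary_face \<T> T"
    using facet_verts[OF face_element(1,2)[OF T]] by simp
  then have "face_normal \<Omega> \<T> T = - (?n /\<^sub>R norm ?n)"
    using flat_tetrahedron.outward_normal_unique[OF ft] unfolding face_normal_def by simp
  then have "r * norm (face_normal \<Omega> \<T> T + g) \<le> 2 * (\<eta> * diameter T)"
    using flat_tetrahedron.normal_close[OF ft] by simp
  also have "\<dots> \<le> 2 * (\<eta> * (K * r))" using rK \<eta> by (intro mult_left_mono) auto
  finally have "r * norm (face_normal \<Omega> \<T> T + g) \<le> r * (2 * (\<eta> * K))" by (simp add: mult_ac)
  then show ?thesis using flat_tetrahedron.r(1)[OF ft] by simp
qed

text \<open>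
The plane attached to an edge contains a direction orthogonal to the edge and transversal to \<open>\<Gamma>\<close>.
If the plane is close to the bisector of two boundary faces, this is because both outward normals are
within \<open>2 \<eta> K\<close> of \<open>- g\<close>.  If it contains a common facet \<open>G\<close> of two elements with boundary faces, then \<open>G\<close> contains
the apex of one of them, as it would otherwise be the boundary face of both and equal to the edge;
the direction is then the altitude of that apex over the edge.
\<close>

lemma edge_transversal:
  assumes e: "e \<in> boundary_edges \<T>" "a \<noteq> b" "e = closed_segment a b"
    and ab: "a \<in> frontier \<Omega>" "b \<in> frontier \<Omega>" and chart: "local_chart \<Omega> \<eta> (ball a \<delta>) f g"
  shows "\<exists>u. u \<noteq> 0 \<and> a + u \<in> \<Delta> e \<and> u \<bullet> (b - a) = 0 \<and> cos \<theta> / (2 * K) * norm u \<le> \<bar>g \<bullet> u\<bar>"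
proof -
  have \<Delta>: "affine (\<Delta> e)" "aff_dim (\<Delta> e) = 2" "e \<subseteq> \<Delta> e"
    using adm e(1) by (auto simp: admissible_planes_def)
  have "\<exists>T\<in>face_elements \<T>. \<exists>T'\<in>face_elements \<T>. T \<noteq> T' \<and>
          boundary_face \<T> T \<inter> boundary_face \<T> T' = e \<and>
          (close_to_bisector \<Omega> \<T> \<theta> e (\<Delta> e) T T' \<or>
           (\<exists>G. G facet_of T \<and> G facet_of T' \<and> \<Delta> e = affine hull G))"
    using adm e(1) unfolding admissible_planes_def by blast
  then obtain T T' where T: "T \<in> face_elements \<T>" "T' \<in> face_elements \<T>"
    and eT: "boundary_face \<T> T \<inter> boundary_face \<T> T' = e"
    and cases: "close_to_bisector \<Omega> \<T> \<theta> e (\<Delta> e) T T' \<or>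
           (\<exists>G. G facet_of T \<and> G facet_of T' \<and> \<Delta> e = affine hull G)"
    by blast
  have aW: "a \<in> e" "b \<in> e" using e by auto
  have sub: "e \<subseteq> boundary_face \<T> T" "e \<subseteq> boundary_face \<T> T'" using eT by auto
  have perp: "u \<bullet> (p - q) = 0" if up: "u \<bullet> (b - a) = 0" and pq: "p \<in> e" "q \<in> e" for u p q
    using pq e(3) by (intro orthogonal_segment[OF up]) auto
  have component: "\<exists>t u. u = (z - a) - t *\<^sub>R (b - a) \<and> u \<bullet> (b - a) = 0 \<and> a + u \<in> \<Delta> e"
    if z: "z \<in> \<Delta> e" for z
  proof -
    \<comment> \<open>\<open>(z - a) - t (b - a)\<close> is the component of \<open>z - a\<close> orthogonal to the edge\<close>
    define t where "t = ((z - a) \<bullet> (b - a)) / ((b - a) \<bullet> (b - a))"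
    have nz: "(b - a) \<bullet> (b - a) \<noteq> 0" using e(2) by simp
    have "((z - a) - t *\<^sub>R (b - a)) \<bullet> (b - a) = (z - a) \<bullet> (b - a) - t * ((b - a) \<bullet> (b - a))"
      by (simp only: inner_diff_left[of "z - a" "t *\<^sub>R (b - a)"] inner_scaleR_left)
    then have "((z - a) - t *\<^sub>R (b - a)) \<bullet> (b - a) = 0" using nz by (simp add: t_def)
    moreover have "z + (- t) *\<^sub>R (b - a) \<in> \<Delta> e"
      using mem_affine_3_minus[OF \<Delta>(1) z, of b a "- t"] aW \<Delta>(3) by blast
    then have "a + ((z - a) - t *\<^sub>R (b - a)) \<in> \<Delta> e" by (simp add: algebra_simps)
    ultimately show ?thesis by blast
  qed
  from cases show ?thesis
  proof
    assume bis: "close_to_bisector \<Omega> \<T> \<theta> e (\<Delta> e) T T'"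
    have "\<not> \<Delta> e \<subseteq> affine hull {a, b}"
    proof
      assume "\<Delta> e \<subseteq> affine hull {a, b}"
      then have "aff_dim (\<Delta> e) \<le> aff_dim {a, b}" using aff_dim_subset by (metis aff_dim_affine_hull)
      then show False using \<Delta>(2) aff_dim_2[of a b] e(2) by simp
    qed
    then obtain z where z: "z \<in> \<Delta> e" "z \<notin> affine hull {a, b}" by blast
    obtain t u where u: "u = (z - a) - t *\<^sub>R (b - a)" and u_perp: "u \<bullet> (b - a) = 0" and au: "a + u \<in> \<Delta> e"
      using component[OF z(1)] by blast
    have u0: "u \<noteq> 0"
    proof
      assume "u = 0"
      then have "z = (1 - t) *\<^sub>R a + t *\<^sub>R b" using u by (simp add: algebra_simps)
      then have "z \<in> affine hull {a, b}" unfolding affine_hull_2 mem_Collect_eq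
        by (intro exI[of _ "1 - t"] exI[of _ t]) simp
      then show False using z by simp
    qed
    let ?b = "face_normal \<Omega> \<T> T + face_normal \<Omega> \<T> T'"
    have "\<forall>p\<in>e. \<forall>q\<in>e. (a + u - a) \<bullet> (p - q) = 0" using perp[OF u_perp] by simp
    then have "cos \<theta> * (norm (a + u - a) * norm ?b) \<le> \<bar>(a + u - a) \<bullet> ?b\<bar>"
      using bis au aW \<Delta>(3) unfolding close_to_bisector_def Let_def by blast
    then have "cos \<theta> / 2 * norm u \<le> \<bar>g \<bullet> u\<bar>"
      using face_normal_close[OF T(1) _ chart] face_normal_close[OF T(2) _ chart] sub aW \<eta> \<eta>K chart
      by (intro bisector_transversal[of g _ "2 * (\<eta> * K)"]) (auto simp: local_chart_def)
    moreover have "cos \<theta> / (2 * K) * norm u \<le> cos \<theta> / 2 * norm u"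
      using cos K by (intro mult_right_mono divide_left_mono) auto
    ultimately have "cos \<theta> / (2 * K) * norm u \<le> \<bar>g \<bullet> u\<bar>" by linarith
    then show ?thesis using u0 au u_perp by blast
  next
    assume "\<exists>G. G facet_of T \<and> G facet_of T' \<and> \<Delta> e = affine hull G"
    then obtain G where G: "G facet_of T" "G facet_of T'" "\<Delta> e = affine hull G" by blast
    have "\<exists>T0\<in>{T, T'}. inner_vertex \<Omega> T0 \<in> G"
    proof (rule ccontr)
      assume "\<not> ?thesis"
      then have "G = boundary_face \<T> T" "G = boundary_face \<T> T'"
        using face_element(9)[OF T(1) G(1)] face_element(9)[OF T(2) G(2)] by auto
      then have "G = e" using eT by auto
      moreover have "aff_dim e = 1" unfolding e(3) using e(2) by (simp add: segment_convex_hull aff_dim_convex_hull aff_dim_2)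
      moreover have "aff_dim G = 2" using \<Delta>(2) G(3) by simp
      ultimately show False by simp
    qed
    then obtain T0 where T0: "T0 \<in> face_elements \<T>" "e \<subseteq> boundary_face \<T> T0" "inner_vertex \<Omega> T0 \<in> G"
      using T sub by blast
    let ?Z = "inner_vertex \<Omega> T0" and ?W = "verts (boundary_face \<T> T0)"
    have aT0: "a \<in> boundary_face \<T> T0" using T0(2) aW by auto
    obtain c r where rK: "diameter T0 \<le> K * r" and
      ft: "flat_tetrahedron \<Omega> \<eta> (ball a \<delta>) f g ?W ?Z c r (diameter T0)"
      using flat_at_face_point[OF T0(1) aT0 chart] by blast
    have hull: "convex hull ?W = boundary_face \<T> T0"
      using facet_verts[OF face_element(1,2)[OF T0(1)]] by simp
    have abW: "a \<in> convex hull ?W" "b \<in> convex hull ?W" using hull T0(2) aW by auto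
    have "?Z \<in> \<Delta> e" using T0(3) G(3) hull_inc by metis
    then obtain t u where u: "u = (?Z - a) - t *\<^sub>R (b - a)" and u_perp: "u \<bullet> (b - a) = 0" and au: "a + u \<in> \<Delta> e"
      using component by blast
    have nu: "norm u \<le> diameter T0" and gu: "r / 2 \<le> g \<bullet> u"
      using flat_tetrahedron.altitude_transversal[OF ft abW ab u u_perp] by auto
    have r: "0 < r" by (rule flat_tetrahedron.r(1)[OF ft])
    have "cos \<theta> / (2 * K) * norm u \<le> 1 / (2 * K) * (K * r)"
      using nu rK K r cos by (intro mult_mono divide_right_mono) auto
    also have "\<dots> = r / 2" using K by simp
    finally have "cos \<theta> / (2 * K) * norm u \<le> \<bar>g \<bullet> u\<bar>" using gu by linarith
    moreover have "u \<noteq> 0" using gu r by auto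
    ultimately show ?thesis using u_perp au by blast
  qed
qed

text \<open>
The function of a chart at an endpoint of \<open>e\<close> vanishes at both endpoints, so it is at most \<open>2 \<eta>\<close> times the length of the
edge at \<open>M\<close>.  The transversal direction of \<open>edge_transversal\<close> does the rest.
\<close>

lemma edge_intersection:
  assumes e: "e \<in> boundary_edges \<T>" and M: "M \<in> e"
  shows "\<exists>Q. nearest_intersection (frontier \<Omega>) (orthogonal_line (\<Delta> e) e M) M Q \<and>
      dist M Q \<le> 8 * \<eta> * K / cos \<theta> * diameter e"
proof -
  obtain a b where ab: "a \<noteq> b" "e = closed_segment a b" "a \<in> frontier \<Omega>" "b \<in> frontier \<Omega>"
    using boundary_edge_endpoints[OF e] by metis
  obtain T where T: "T \<in> \<T>" "e \<subseteq> T" using e by (auto simp: boundary_edges_def edge_of_def dest: face_of_imp_subset)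
  obtain f g where chart: "local_chart \<Omega> \<eta> (ball a \<delta>) f g" using charts ab(3) by blast
  obtain u where u: "u \<noteq> 0" "a + u \<in> \<Delta> e" "u \<bullet> (b - a) = 0" "cos \<theta> / (2 * K) * norm u \<le> \<bar>g \<bullet> u\<bar>"
    using edge_transversal[OF e ab chart] by blast
  have \<Delta>: "affine (\<Delta> e)" "e \<subseteq> \<Delta> e" using adm e by (auto simp: admissible_planes_def)
  have aT: "a \<in> T" "b \<in> T" "M \<in> T" using T ab M by auto
  define L where "L = norm (b - a)"
  have eh: "L \<le> diameter T"
    using diameter_bound[OF T(1) aT(2,1)] by (simp add: L_def dist_norm)
  have Le: "L \<le> diameter e"
    using diameter_bounded_bound[of e b a] ab(2) by (simp add: L_def dist_norm bounded_closed_segment)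
  have h0: "0 \<le> L" by (simp add: L_def)
  obtain t where t: "0 \<le> t" "t \<le> 1" "M = (1 - t) *\<^sub>R a + t *\<^sub>R b" using M ab(2) by (auto simp: in_segment)
  have Ma: "M - a = t *\<^sub>R (b - a)" by (simp add: t(3) algebra_simps)
  have "norm (M - a) = t * L" unfolding Ma using t(1) by (simp add: L_def)
  then have nMa: "norm (M - a) \<le> L" using t h0 by (simp add: mult_left_le_one_le)
  have inU: "x \<in> ball a \<delta>" if "x \<in> T" for x
    using diameter_bound[OF T(1) aT(1) that] \<delta>[OF T(1)] diameter_ge_0[OF compact_imp_bounded[OF compact_element[OF T(1)]]] by simp
  have f0: "f a = 0" "f b = 0" using chart inU aT ab unfolding local_chart_def by blast+
  have est: "\<bar>f x - f y - g \<bullet> (x - y)\<bar> \<le> \<eta> * norm (x - y)" if "x \<in> T" "y \<in> T" for x y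
    using chart inU that unfolding local_chart_def by blast
  have fM: "\<bar>f M\<bar> \<le> 2 * (\<eta> * L)"
  proof -
    have "\<bar>g \<bullet> (b - a)\<bar> \<le> \<eta> * L" using est[OF aT(2,1)] f0 L_def by simp
    then have "\<bar>g \<bullet> (M - a)\<bar> \<le> 1 * (\<eta> * L)" unfolding Ma inner_scaleR_right abs_mult
      using t by (intro mult_mono) auto
    moreover have "\<bar>f M - f a - g \<bullet> (M - a)\<bar> \<le> \<eta> * L"
      using est[OF aT(3,1)] mult_left_mono[OF nMa \<eta>(1)] by linarith
    ultimately show ?thesis using f0 by linarith
  qed
  let ?\<kappa> = "cos \<theta> / (2 * K)" and ?b = "2 * (\<eta> * L)"
  have b: "2 * ?b / ?\<kappa> = 8 * \<eta> * K / cos \<theta> * L" by simp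
  have small: "8 * \<eta> * K / cos \<theta> * L \<le> L"
  proof -
    have "8 * \<eta> * K / cos \<theta> \<le> 1" using \<eta> cos by (simp add: pos_divide_le_eq)
    then show ?thesis using mult_right_mono[of _ 1 "L"] h0 by fastforce
  qed
  have "\<exists>s. M + s *\<^sub>R u \<in> frontier \<Omega> \<and> dist M (M + s *\<^sub>R u) \<le> 2 * ?b / ?\<kappa>"
  proof (rule local_chart_transversal_intersection[OF chart u(1,4) _ _ fM])
    show "0 < ?\<kappa>" using cos K by simp
    have "4 * (\<eta> * K) \<le> cos \<theta>" using \<eta> K by (smt (verit) mult_nonneg_nonneg)
    then show "2 * \<eta> \<le> ?\<kappa>" using K by (simp add: field_simps)
    show "cball M (2 * ?b / ?\<kappa>) \<subseteq> ball a \<delta>"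
    proof
      fix x assume "x \<in> cball M (2 * ?b / ?\<kappa>)"
      then have "dist M x \<le> L" unfolding b using small by simp
      moreover have "dist a M \<le> L" using nMa by (simp add: dist_norm norm_minus_commute)
      ultimately show "x \<in> ball a \<delta>" using \<delta>[OF T(1)] eh dist_triangle[of a x M] by simp
    qed
  qed
  then obtain s where s: "M + s *\<^sub>R u \<in> frontier \<Omega>" "dist M (M + s *\<^sub>R u) \<le> 8 * \<eta> * K / cos \<theta> * L"
    unfolding b by blast
  have perp: "u \<bullet> (p - q) = 0" if pq: "p \<in> e" "q \<in> e" for p q
    using pq ab(2) by (intro orthogonal_segment[OF u(3)]) auto
  have "M + s *\<^sub>R u \<in> \<Delta> e"
    using mem_affine_3_minus[OF \<Delta>(1), of M "a + u" a s] u(2) \<Delta>(2) M ab(2) by auto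
  then have on: "M + s *\<^sub>R u \<in> orthogonal_line (\<Delta> e) e M"
    using perp by (auto simp: orthogonal_line_def)
  have "(x - M) \<bullet> (p - q) = (p - q) \<bullet> x - (p - q) \<bullet> M" for x p q
    by (simp add: inner_diff_left inner_diff_right inner_commute)
  then have *: "(x - M) \<bullet> (p - q) = 0 \<longleftrightarrow> (p - q) \<bullet> x = (p - q) \<bullet> M" for x p q
    by simp
  have "orthogonal_line (\<Delta> e) e M = \<Delta> e \<inter> (\<Inter>p\<in>e. \<Inter>q\<in>e. {x. (p - q) \<bullet> x = (p - q) \<bullet> M})"
    unfolding orthogonal_line_def by (auto simp: *)
  moreover have "closed \<dots>"
    using \<Delta>(1) by (intro closed_Int affine_closed closed_INT ballI closed_hyperplane)
  ultimately have "closed (orthogonal_line (\<Delta> e) e M)" by simp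
  then obtain Q where "nearest_intersection (frontier \<Omega>) (orthogonal_line (\<Delta> e) e M) M Q"
      "dist M Q \<le> dist M (M + s *\<^sub>R u)"
    using nearest_intersection_exists[of "orthogonal_line (\<Delta> e) e M" "M + s *\<^sub>R u" \<Omega> M] s on by auto
  moreover have "8 * \<eta> * K / cos \<theta> * L \<le> 8 * \<eta> * K / cos \<theta> * diameter e"
    using Le \<eta> K cos by (intro mult_left_mono) auto
  ultimately show ?thesis using s by (meson order_trans)
qed

end

section \<open>The clipped interpolant\<close>

lemma multi_indices_mono: "finite V \<Longrightarrow> W \<subseteq> V \<Longrightarrow> multi_indices W k \<subseteq> multi_indices V k"
proof
  fix a assume V: "finite V" "W \<subseteq> V" and a: "a \<in> multi_indices W k"
  then have "sum a V = sum a W" by (intro sum.mono_neutral_right) (auto simp: multi_indices_def)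
  then show "a \<in> multi_indices V k" using a V by (auto simp: multi_indices_def)
qed

text \<open>
The vertices with positive barycentric coordinates span the face whose relative interior contains the
point.
\<close>

lemma carrier_exists:
  fixes V :: "'a::euclidean_space set"
  assumes V: "\<not> affine_dependent V" and x: "x \<in> convex hull V"
  obtains W where "W \<subseteq> V" "x \<in> rel_interior (convex hull W)"
proof -
  have fin: "finite V" using V aff_independent_finite by blast
  obtain u where u: "\<And>S. S \<in> V \<Longrightarrow> 0 \<le> u S" "sum u V = 1" "(\<Sum>S\<in>V. u S *\<^sub>R S) = x"
    using x fin by (auto simp: convex_hull_finite)
  let ?W = "{S \<in> V. 0 < u S}"
  have z: "\<forall>S\<in>V - ?W. u S = 0" 
  proof
    fix S assume "S \<in> V - ?W"
    then have "0 \<le> u S" "\<not> 0 < u S" using u(1) by auto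
    then show "u S = 0" by linarith
  qed
  have "sum u V = sum u ?W" by (rule sum.mono_neutral_right[OF fin _ z]) blast
  moreover have "(\<Sum>S\<in>V. u S *\<^sub>R S) = (\<Sum>S\<in>?W. u S *\<^sub>R S)"
  proof (rule sum.mono_neutral_right[OF fin])
    show "\<forall>S\<in>V - ?W. u S *\<^sub>R S = 0" using z by (metis scaleR_zero_left)
  qed blast
  moreover have ind: "\<not> affine_dependent ?W" using V affine_dependent_subset[of ?W V] by blast
  ultimately have "x \<in> rel_interior (convex hull ?W)"
    using u(2,3) unfolding rel_interior_convex_hull_explicit[OF ind] mem_Collect_eq
    by (intro exI[of _ u] conjI) auto
  then show ?thesis using that[of ?W] by blast
qed

lemma node_carrier:
  assumes V: "\<not> affine_dependent V" and k: "0 < k" and a: "a \<in> multi_indices V k"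
  obtains W where "W \<subseteq> V" "W \<noteq> {}" "a \<in> multi_indices W k" "node k V a \<in> rel_interior (convex hull W)"
proof -
  have fin: "finite V" using V aff_independent_finite by blast
  let ?W = "{S \<in> V. 0 < a S}"
  have "sum a V = sum a ?W" using fin by (intro sum.mono_neutral_right) auto
  then have aW: "a \<in> multi_indices ?W k" using a by (auto simp: multi_indices_def)
  have ind: "\<not> affine_dependent ?W" using V affine_dependent_subset[of ?W V] by blast
  have eq: "node k V a = (\<Sum>S\<in>?W. (real (a S) / real k) *\<^sub>R S)"
    using node_trace[OF fin _ aW] by (simp add: node_def)
  have "node k V a \<in> rel_interior (convex hull ?W)"
    using node_coefficients[OF k aW] k eq unfolding rel_interior_convex_hull_explicit[OF ind] mem_Collect_eq
    by (intro exI[of _ "\<lambda>S. real (a S) / real k"] conjI) auto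
  moreover have "?W \<noteq> {}"
  proof
    assume "?W = {}"
    then have "sum a ?W = 0" by (simp only: sum.empty)
    then show False using aW k by (simp add: multi_indices_def)
  qed
  ultimately show ?thesis using that[of ?W] aW by blast
qed

definition clipped :: "nat \<Rightarrow> mesh \<Rightarrow> (pt set \<Rightarrow> pt \<Rightarrow> real) \<Rightarrow> pt set \<Rightarrow> pt \<Rightarrow> real" where
  "clipped k \<T> w T x = (\<Sum>a\<in>multi_indices (verts T) k.
      (if node k (verts T) a \<in> mesh_boundary \<T> then 0 else w T (node k (verts T) a)) * lagrange k (verts T) a x)"

text \<open>
For pieces that agree at common points the choice of the element does not matter.  Outside the mesh
the value is zero, which is how \<open>V_space\<close> represents its functions.
\<close>

definition glue :: "mesh \<Rightarrow> (pt set \<Rightarrow> pt \<Rightarrow> real) \<Rightarrow> pt \<Rightarrow> real" where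
  "glue \<T> z x = (if x \<in> \<Union>\<T> then z (SOME T. T \<in> \<T> \<and> x \<in> T) x else 0)"

lemma glue_eq:
  assumes "\<And>T T'. T \<in> \<T> \<Longrightarrow> T' \<in> \<T> \<Longrightarrow> x \<in> T \<Longrightarrow> x \<in> T' \<Longrightarrow> z T x = z T' x" and T: "T \<in> \<T>" "x \<in> T"
  shows "glue \<T> z x = z T x"
proof -
  have "(SOME T. T \<in> \<T> \<and> x \<in> T) \<in> \<T> \<and> x \<in> (SOME T. T \<in> \<T> \<and> x \<in> T)"
    by (rule someI[where P = "\<lambda>T. T \<in> \<T> \<and> x \<in> T"]) (use T in blast)
  then have "z (SOME T. T \<in> \<T> \<and> x \<in> T) x = z T x" using T by (intro assms(1)) auto
  moreover have "x \<in> \<Union>\<T>" using T by blast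
  ultimately show ?thesis by (simp add: glue_def)
qed

context mesh
begin

lemma clipped_polys: "T \<in> \<T> \<Longrightarrow> clipped k \<T> w T \<in> polys k"
  using tetrahedron_verts[OF tetrahedra] unfolding clipped_def[abs_def]
  by (intro polys_sum polys_cmult lagrange_polys) auto

text \<open>
By the trace formula both sides depend only on the nodes of the common face, and there \<open>w\<close> is
single-valued or clipped.
\<close>

lemma clipped_agree:
  assumes k: "0 < k"
    and single: "\<And>N. N \<in> (\<Union>T\<in>\<T>. lattice_points k T) \<Longrightarrow> N \<notin> mesh_boundary \<T> \<Longrightarrow>
      (\<forall>T\<in>\<T>. \<forall>T'\<in>\<T>. N \<in> T \<and> N \<in> T' \<longrightarrow> w T N = w T' N)"
    and T: "T \<in> \<T>" "T' \<in> \<T>" and x: "x \<in> T" "x \<in> T'"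
  shows "clipped k \<T> w T x = clipped k \<T> w T' x"
proof -
  let ?W = "verts (T \<inter> T')"
  have f1: "(T \<inter> T') face_of T" "(T \<inter> T') face_of T'"
    using face_Int[OF T] face_Int[OF T(2,1)] by (auto simp: Int_commute)
  note fv = face_verts[OF tetrahedra[OF T(1)] f1(1)] and fv' = face_verts[OF tetrahedra[OF T(2)] f1(2)]
  note V = tetrahedron_verts[OF tetrahedra[OF T(1)]] and V' = tetrahedron_verts[OF tetrahedra[OF T(2)]]
  have xW: "x \<in> convex hull ?W" using fv(2) x by simp
  let ?F = "\<lambda>T a. if node k (verts T) a \<in> mesh_boundary \<T> then 0 else w T (node k (verts T) a)"
  have "clipped k \<T> w T x = (\<Sum>a\<in>multi_indices ?W k. ?F T a * lagrange k ?W a x)"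
    unfolding clipped_def by (rule lagrange_trace[OF V(2) fv(1) xW])
  also have "\<dots> = (\<Sum>a\<in>multi_indices ?W k. ?F T' a * lagrange k ?W a x)"
  proof (intro sum.cong refl)
    fix a assume a: "a \<in> multi_indices ?W k"
    let ?N = "node k ?W a"
    have N: "node k (verts T) a = ?N" "node k (verts T') a = ?N"
      using node_trace[OF V(1) fv(1) a] node_trace[OF V'(1) fv'(1) a] by auto
    have "a \<in> multi_indices (verts T) k" using multi_indices_mono[OF V(1) fv(1), of k] a by blast
    then have "node k (verts T) a \<in> lattice_points k T" unfolding lattice_points_eq[OF k V(1)] by blast
    then have "?N \<in> lattice_points k T" by (simp only: N(1))
    moreover have "?N \<in> T \<inter> T'"
      using node_in_hull[OF k finite_subset[OF fv(1) V(1)] a] fv(2) by simp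
    ultimately have "w T ?N = w T' ?N" if "?N \<notin> mesh_boundary \<T>"
      using single[OF _ that] T by blast
    then show "?F T a * lagrange k ?W a x = ?F T' a * lagrange k ?W a x" unfolding N by auto
  qed
  also have "\<dots> = clipped k \<T> w T' x"
    unfolding clipped_def by (rule lagrange_trace[OF V'(2) fv'(1) xW, symmetric])
  finally show ?thesis .
qed

text \<open>
The face of \<open>T\<close> that carries \<open>x\<close> lies on the boundary together with all its nodes, so that the trace
formula has only zero coefficients.
\<close>

lemma clipped_zero:
  assumes k: "0 < k" and T: "T \<in> \<T>" and x: "x \<in> T" "x \<in> mesh_boundary \<T>"
  shows "clipped k \<T> w T x = 0"
proof -
  note V = tetrahedron_verts[OF tetrahedra[OF T]]
  obtain W where W: "W \<subseteq> verts T" "x \<in> rel_interior (convex hull W)"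
    using carrier_exists[OF V(2)] x V(4) by metis
  have "convex hull W face_of convex hull verts T"
    using face_of_convex_hull_affine_independent[OF V(2)] W(1) by blast
  then have "convex hull W face_of T" by (simp only: V(4))
  then have sub: "convex hull W \<subseteq> mesh_boundary \<T>"
    using carrier_subset_mesh_boundary[OF T _ W(2) x(2)] by blast
  have "x \<in> convex hull W" using W(2) rel_interior_subset by blast
  then have "clipped k \<T> w T x = (\<Sum>a\<in>multi_indices W k. (if node k (verts T) a \<in> mesh_boundary \<T> then 0
      else w T (node k (verts T) a)) * lagrange k W a x)"
    unfolding clipped_def by (rule lagrange_trace[OF V(2) W(1)])
  also have "\<dots> = 0"
  proof (intro sum.neutral ballI)
    fix a assume a: "a \<in> multi_indices W k"
    have "node k (verts T) a = node k W a" by (rule node_trace[OF V(1) W(1) a])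
    also have "\<dots> \<in> mesh_boundary \<T>"
      using node_in_hull[OF k finite_subset[OF W(1) V(1)] a] sub by blast
    finally show "(if node k (verts T) a \<in> mesh_boundary \<T> then 0
      else w T (node k (verts T) a)) * lagrange k W a x = 0" by simp
  qed
  finally show ?thesis .
qed

lemma glue_V_space:
  assumes polys: "\<And>T. T \<in> \<T> \<Longrightarrow> z T \<in> polys k"
    and agree: "\<And>T T' x. T \<in> \<T> \<Longrightarrow> T' \<in> \<T> \<Longrightarrow> x \<in> T \<Longrightarrow> x \<in> T' \<Longrightarrow> z T x = z T' x"
    and zero: "\<And>T x. T \<in> \<T> \<Longrightarrow> x \<in> T \<Longrightarrow> x \<in> mesh_boundary \<T> \<Longrightarrow> z T x = 0"
  shows "glue \<T> z \<in> V_space k \<T>"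
proof -
  have eq: "glue \<T> z x = z T x" if "T \<in> \<T>" "x \<in> T" for T x
    by (rule glue_eq[OF agree that])
  have "continuous_on (\<Union>\<T>) (glue \<T> z)"
  proof (rule continuous_on_closed_Union[of \<T> "\<lambda>T. T", simplified])
    fix T assume T: "T \<in> \<T>"
    show "closed T" using compact_element[OF T] compact_imp_closed by blast
    have "continuous_on T (z T)" by (rule polys_continuous[OF polys[OF T]])
    then show "continuous_on T (glue \<T> z)" using eq[OF T] by (metis continuous_on_cong)
  qed (use finite_mesh in auto)
  moreover have "glue \<T> z x = 0" if "x \<in> mesh_boundary \<T>" for x
  proof -
    have "x \<in> \<Union>\<T>" using that mesh_boundary_eq by auto
    then show ?thesis using zero eq that by auto
  qed
  ultimately show ?thesis
    using eq polys by (auto simp: V_space_def glue_def)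
qed

end

text \<open>
The number of vertices of the face that carries the node decides which of the defining conditions of
the space applies: one vertex, and the value at the node itself is prescribed; two or three, and the
prescribed zero is the nearest intersection for an edge or a face.  With four vertices the node would
be interior to the mesh domain.
\<close>

lemma (in resolved_mesh) boundary_node_zero_nearby:
  assumes k: "0 < k" and w: "w \<in> W_space k \<Omega> \<T> \<Delta> (\<lambda>_. 0)"
    and T: "T \<in> \<T>" and r: "0 < r" "cball c r \<subseteq> T" "diameter T \<le> K * r"
    and a: "a \<in> multi_indices (verts T) k" and N: "node k (verts T) a \<in> mesh_boundary \<T>"
  shows "\<exists>P. dist (node k (verts T) a) P \<le> 8 * \<eta> * K\<^sup>2 / cos \<theta> * r \<and> w T P = 0"
proof -
  note V = tetrahedron_verts[OF tetrahedra[OF T]]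
  let ?N = "node k (verts T) a"
  have vertex_condition: "\<forall>S\<in>boundary_vertices \<T>. \<forall>T\<in>\<T>. S \<in> T \<longrightarrow> w T S = 0"
    and face_condition: "\<forall>T\<in>face_elements \<T>. \<forall>M\<in>lattice_points k (boundary_face \<T> T).
          (\<forall>e. e edge_of boundary_face \<T> T \<longrightarrow> M \<notin> e) \<longrightarrow>
          (\<forall>P. nearest_intersection (frontier \<Omega>) (affine hull {inner_vertex \<Omega> T, M}) M P \<longrightarrow> w T P = 0)"
    and edge_condition: "\<forall>T\<in>face_elements \<T> \<union> edge_elements \<T>. \<forall>e. e edge_of T \<and> e \<subseteq> mesh_boundary \<T> \<longrightarrow>
          (\<forall>M\<in>lattice_points k e. \<not> M extreme_point_of e \<longrightarrow>
            (\<forall>Q. nearest_intersection (frontier \<Omega>) (orthogonal_line (\<Delta> e) e M) M Q \<longrightarrow> w T Q = 0))"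
    using w unfolding W_space_def mem_Collect_eq by - (elim conjE, assumption)+
  obtain W where W: "W \<subseteq> verts T" "W \<noteq> {}" "a \<in> multi_indices W k" "?N \<in> rel_interior (convex hull W)"
    using node_carrier[OF V(2) k a] by metis
  let ?\<Phi> = "convex hull W"
  have ind: "\<not> affine_dependent W" using V(2) W(1) affine_dependent_subset by blast
  have fin: "finite W" using W(1) V(1) finite_subset by blast
  have "?\<Phi> face_of convex hull verts T"
    using face_of_convex_hull_affine_independent[OF V(2)] W(1) by blast
  then have face: "?\<Phi> face_of T" by (simp only: V(4))
  have sub: "?\<Phi> \<subseteq> mesh_boundary \<T>" by (rule carrier_subset_mesh_boundary[OF T face W(4) N])
  have dim: "aff_dim ?\<Phi> = int (card W) - 1"
    using ind affine_independent_iff_card by (metis aff_dim_convex_hull)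
  have vW: "verts ?\<Phi> = W" by (rule verts_convex_hull[OF ind])
  have lat: "?N \<in> lattice_points k ?\<Phi>"
    using lattice_points_eq[OF k, of ?\<Phi>] vW fin W(3) node_trace[OF V(1) W(1,3)] by auto
  have N\<Phi>: "?N \<in> ?\<Phi>" using W(4) rel_interior_subset by blast
  have cK: "cos \<theta> \<le> 1" by simp
  have K0: "0 \<le> 8 * \<eta> * K / cos \<theta>" using K \<eta> cos by simp
  have big: "8 * \<eta> * K / cos \<theta> * (K * r) = 8 * \<eta> * K\<^sup>2 / cos \<theta> * r"
    by (simp add: power2_eq_square)
  have hT: "8 * \<eta> * K / cos \<theta> * diameter T \<le> 8 * \<eta> * K\<^sup>2 / cos \<theta> * r"
    unfolding big[symmetric] using r(3) K0 by (rule mult_left_mono)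
  have "card W \<noteq> 0" using W(2) fin by simp
  moreover have "card W \<le> 4" using card_mono[OF V(1) W(1)] V(3) by simp
  ultimately consider "card W = 1" | "card W = 2" | "card W = 3" | "card W = 4" by linarith
  then show ?thesis
  proof cases
    case 1
    then obtain S where S: "W = {S}" by (auto simp: card_1_singleton_iff)
    then have NS: "?N = S" using N\<Phi> by simp
    have "S \<in> boundary_vertices \<T>" using vertex_frontier(1)[OF T, of S] W(1) S N NS by auto
    moreover have "S \<in> T" using W(1) S hull_subset[of "verts T" convex] V(4) by blast
    ultimately have "w T S = 0" using vertex_condition T by blast
    then show ?thesis using NS \<eta> K cos r by (intro exI[of _ S]) simp
  next
    case 2
    then have edge: "?\<Phi> edge_of T" using face dim by (simp add: edge_of_def)
    then have be: "?\<Phi> \<in> boundary_edges \<T>" using sub T by (auto simp: boundary_edges_def)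
    have el: "T \<in> face_elements \<T> \<union> edge_elements \<T>"
    proof (rule ccontr)
      assume no: "\<not> ?thesis"
      then have nf: "\<not> (\<exists>F. F facet_of T \<and> F \<subseteq> mesh_boundary \<T>)" using T by (auto simp: face_elements_def)
      have "\<forall>T\<in>\<T>. (\<forall>e. e edge_of T \<longrightarrow> \<not> e \<subseteq> mesh_boundary \<T>) \<or>
             (\<exists>!e. e edge_of T \<and> e \<subseteq> mesh_boundary \<T>) \<or>
             (\<exists>F. F facet_of T \<and> F \<subseteq> mesh_boundary \<T> \<and>
                  (\<forall>e. e edge_of T \<and> e \<subseteq> mesh_boundary \<T> \<longrightarrow> e \<subseteq> F))"
        using fitted unfolding fitted_mesh_def by (elim conjE)
      from bspec[OF this T] have "\<exists>!e. e edge_of T \<and> e \<subseteq> mesh_boundary \<T>"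
        using nf edge sub by (elim disjE) (blast, assumption, blast)
      then show False using no T by (auto simp: edge_elements_def)
    qed
    obtain Q where Q: "nearest_intersection (frontier \<Omega>) (orthogonal_line (\<Delta> ?\<Phi>) ?\<Phi> ?N) ?N Q"
        "dist ?N Q \<le> 8 * \<eta> * K / cos \<theta> * diameter ?\<Phi>"
      using edge_intersection[OF be N\<Phi>] by blast
    have "?\<Phi> \<noteq> {?N}" using dim 2 aff_dim_sing[of ?N] by auto
    then have next_: "\<not> ?N extreme_point_of ?\<Phi>"
      using extreme_point_not_in_REL_INTERIOR W(4) by blast
    have "w T Q = 0"
      using edge_condition el edge sub lat next_ Q(1) by blast
    moreover have "dist ?N Q \<le> 8 * \<eta> * K\<^sup>2 / cos \<theta> * r"
    proof -
      have "diameter ?\<Phi> \<le> diameter T"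
        using face_of_imp_subset[OF face] compact_imp_bounded[OF compact_element[OF T]] by (rule diameter_subset)
      then have "8 * \<eta> * K / cos \<theta> * diameter ?\<Phi> \<le> 8 * \<eta> * K / cos \<theta> * diameter T"
        using K0 by (rule mult_left_mono)
      then show ?thesis using Q(2) hT by linarith
    qed
    ultimately show ?thesis by blast
  next
    case 3
    have facet: "?\<Phi> facet_of T"
      using face dim 3 aff_dim_simplex[OF tetrahedra[OF T]] W(2) by (simp add: facet_of_def)
    then have el: "T \<in> face_elements \<T>" using sub T by (auto simp: face_elements_def)
    have bf: "?\<Phi> = boundary_face \<T> T" by (rule face_element(8)[OF el facet sub])
    obtain P where P: "nearest_intersection (frontier \<Omega>) (affine hull {inner_vertex \<Omega> T, ?N}) ?N P"
        "dist ?N P \<le> 4 * \<eta> * K * diameter T"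
      using face_intersection[OF el r, of ?N] N\<Phi> bf by blast
    have noedge: "\<forall>e. e edge_of boundary_face \<T> T \<longrightarrow> ?N \<notin> e"
    proof (intro allI impI notI)
      fix e assume e: "e edge_of boundary_face \<T> T" "?N \<in> e"
      then have "e face_of ?\<Phi>" "aff_dim e = 1" by (auto simp: edge_of_def bf)
      moreover from this have "e \<noteq> ?\<Phi>" using dim 3 by auto
      ultimately show False using face_of_disjoint_rel_interior e(2) W(4) by blast
    qed
    have "w T P = 0"
      using face_condition el lat noedge P(1) unfolding bf by blast
    moreover have "dist ?N P \<le> 8 * \<eta> * K\<^sup>2 / cos \<theta> * r"
    proof -
      have h0: "0 \<le> diameter T" by (rule diameter_ge_0[OF compact_imp_bounded[OF compact_element[OF T]]])
      have "4 * \<eta> * K \<le> 8 * \<eta> * K / 1" using \<eta> K by simp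
      also have "\<dots> \<le> 8 * \<eta> * K / cos \<theta>" using \<eta> K cos cK by (intro divide_left_mono) auto
      finally have "4 * \<eta> * K * diameter T \<le> 8 * \<eta> * K / cos \<theta> * diameter T"
        using h0 by (rule mult_right_mono)
      then show ?thesis using P(2) hT by linarith
    qed
    ultimately show ?thesis by blast
  next
    case 4
    then have "W = verts T" using card_subset_eq[OF V(1) W(1)] V(3) by simp
    then have "?\<Phi> = T" using V(4) by simp
    then have "T \<subseteq> mesh_boundary \<T>" using sub by simp
    moreover have "interior T \<subseteq> interior (\<Union>\<T>)" using T by (intro interior_mono) auto
    ultimately have "interior T = {}" using mesh_boundary_eq interior_subset by blast
    then show ?thesis using interior_element_nonempty[OF T] by simp
  qed
qed

section \<open>Element-wise integration and the quotient\<close>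

lemma gradient_cong_open:
  assumes "open S" "x \<in> S" "\<And>y. y \<in> S \<Longrightarrow> f y = g y" and g: "GDERIV g x :> D"
  shows "gradient f x = D"
proof (rule gradient_eqI)
  have "(g has_derivative (\<lambda>h. h \<bullet> D)) (at x)" using g by (simp add: gderiv_def)
  then have "(f has_derivative (\<lambda>h. h \<bullet> D)) (at x)"
    using assms(1,2) by (rule has_derivative_transform_within_open) (simp add: assms(3))
  then show "GDERIV f x :> D" by (simp add: gderiv_def)
qed

text \<open>
The polynomial is constant on the tetrahedron, hence at all nodes, and the basis functions add up to
one on the whole space.
\<close>

lemma polys_eq_const:
  assumes V: "\<not> affine_dependent V" "card V = 4" and k: "0 < k" and p: "p \<in> polys k"
    and z: "\<And>x. x \<in> convex hull V \<Longrightarrow> gradient p x = 0"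
  obtains m where "\<And>x. p x = m"
proof -
  have fin: "finite V" using V aff_independent_finite by blast
  have "\<exists>m. \<forall>x\<in>convex hull V. p x = m"
  proof (rule has_derivative_zero_constant)
    show "convex (convex hull V)" by (rule convex_convex_hull)
    fix x assume x: "x \<in> convex hull V"
    have "(p has_derivative (\<lambda>h. h \<bullet> gradient p x)) (at x)"
      using polys_GDERIV[OF p, of x] unfolding gderiv_def .
    then have "(p has_derivative (\<lambda>h. 0)) (at x)" unfolding z[OF x] inner_zero_right .
    then show "(p has_derivative (\<lambda>h. 0)) (at x within convex hull V)" by (rule has_derivative_at_withinI)
  qed
  then obtain m where m: "\<And>x. x \<in> convex hull V \<Longrightarrow> p x = m" by blast
  have "p x = m" for x
  proof -
    have "p x = (\<Sum>a\<in>multi_indices V k. p (node k V a) * lagrange k V a x)"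
      using polys_reproduction[OF V k p, of 0 1 x] by simp
    also have "\<dots> = (\<Sum>a\<in>multi_indices V k. m * lagrange k V a x)"
      using m node_in_hull[OF k fin] by (intro sum.cong) auto
    also have "\<dots> = m" using polys_reproduction[OF V k polys_const[of m k], where x = x] by simp
    finally show ?thesis .
  qed
  then show ?thesis using that by blast
qed

context mesh
begin

abbreviation "energy T p \<equiv> integral T (\<lambda>x. (norm (gradient p x))\<^sup>2)"

lemma continuous_gradient: "T \<in> \<T> \<Longrightarrow> 0 < k \<Longrightarrow> p \<in> polys k \<Longrightarrow> continuous_on A (gradient p)"
  using continuous_on_gradient tetrahedron_verts[OF tetrahedra] by blast

lemma interiors_disjoint:
  assumes "T \<in> \<T>" "T' \<in> \<T>" "T \<noteq> T'"
  shows "interior (T \<inter> T') = {}"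
proof -
  have d: "aff_dim T = 3" "aff_dim T' = 3" using aff_dim_simplex tetrahedra assms by auto
  have "aff_dim (T \<inter> T') < 3"
  proof (cases "T \<inter> T' = T")
    case False
    then show ?thesis using face_of_aff_dim_lt[OF convex_element face_Int] assms d by metis
  next
    case True
    then have "T \<inter> T' \<noteq> T'" using assms by auto
    moreover have "(T \<inter> T') face_of T'" using face_Int[OF assms(2,1)] by (simp add: Int_commute)
    ultimately show ?thesis using face_of_aff_dim_lt[OF convex_element[OF assms(2)]] d by metis
  qed
  then show ?thesis using low_dim_interior[of "T \<inter> T'"] by simp
qed

text \<open>
The frontiers of the elements are negligible, so it suffices to know the integrand on the interiors.
\<close>

lemma piecewise_has_integral:
  fixes \<Psi> :: "pt \<Rightarrow> real"
  assumes cont: "\<And>T. T \<in> \<T> \<Longrightarrow> continuous_on T (\<phi> T)"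
    and eq: "\<And>T x. T \<in> \<T> \<Longrightarrow> x \<in> interior T \<Longrightarrow> \<Psi> x = \<phi> T x"
  shows "(\<Psi> has_integral (\<Sum>T\<in>\<T>. integral T (\<phi> T))) (mesh_domain \<T>)"
proof -
  have U: "(\<Psi> has_integral (\<Sum>T\<in>\<T>. integral T (\<phi> T))) (\<Union>\<T>)"
  proof (rule has_integral_Union[OF finite_mesh])
    fix T assume T: "T \<in> \<T>"
    have "(\<phi> T has_integral integral T (\<phi> T)) T"
      using integrable_on_compact_continuous[OF compact_element[OF T] cont[OF T]] by (rule integrable_integral)
    moreover have "negligible (frontier T)" by (rule negligible_convex_frontier[OF convex_element[OF T]])
    moreover have "\<Psi> x = \<phi> T x" if "x \<in> T - frontier T" for x
      using eq[OF T, of x] that closure_subset[of T] by (auto simp: frontier_def)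
    ultimately show "(\<Psi> has_integral integral T (\<phi> T)) T" using has_integral_spike by blast
  next
    show "pairwise (\<lambda>S S'. negligible (S \<inter> S')) \<T>"
      using interiors_disjoint convex_element by (auto simp: pairwise_def negligible_convex_interior convex_Int)
  qed
  have skel: "negligible (\<Union>T\<in>\<T>. frontier T)"
    using finite_mesh convex_element by (intro negligible_Union finite_imageI) (auto intro: negligible_convex_frontier)
  have out: "\<Union>\<T> - mesh_domain \<T> \<subseteq> (\<Union>T\<in>\<T>. frontier T)"
  proof
    fix x assume x: "x \<in> \<Union>\<T> - mesh_domain \<T>"
    then obtain T where T: "T \<in> \<T>" "x \<in> T" by blast
    have "interior T \<subseteq> interior (\<Union>\<T>)" using T by (intro interior_mono) auto
    then have "x \<notin> interior T" using x by (auto simp: mesh_domain_def)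
    then show "x \<in> (\<Union>T\<in>\<T>. frontier T)" using T closure_subset by (auto simp: frontier_def)
  qed
  have "mesh_domain \<T> \<subseteq> \<Union>\<T>" unfolding mesh_domain_def by (rule interior_subset)
  then have "{x \<in> mesh_domain \<T> - \<Union>\<T>. \<Psi> x \<noteq> 0} = {}" by blast
  then have n1: "negligible {x \<in> mesh_domain \<T> - \<Union>\<T>. \<Psi> x \<noteq> 0}" by (simp only: negligible_empty)
  have n2: "negligible {x \<in> \<Union>\<T> - mesh_domain \<T>. \<Psi> x \<noteq> 0}"
    by (rule negligible_subset[OF skel]) (use out in blast)
  show ?thesis using has_integral_spike_set_eq[OF n1 n2] U by blast
qed

lemma piecewise_lebesgue_integral:
  fixes \<Psi> :: "pt \<Rightarrow> real"
  assumes cont: "\<And>T. T \<in> \<T> \<Longrightarrow> continuous_on T (\<phi> T)"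
    and eq: "\<And>T x. T \<in> \<T> \<Longrightarrow> x \<in> interior T \<Longrightarrow> \<Psi> x = \<phi> T x"
  shows "(LINT x:mesh_domain \<T>|lebesgue. \<Psi> x) = (\<Sum>T\<in>\<T>. integral T (\<phi> T))"
proof -
  have h: "(\<Psi> has_integral (\<Sum>T\<in>\<T>. integral T (\<phi> T))) (mesh_domain \<T>)"
    by (rule piecewise_has_integral[OF cont eq])
  have "((\<lambda>x. norm (\<Psi> x)) has_integral (\<Sum>T\<in>\<T>. integral T (\<lambda>x. norm (\<phi> T x)))) (mesh_domain \<T>)"
    using cont eq by (intro piecewise_has_integral continuous_on_norm) auto
  then have "\<Psi> absolutely_integrable_on mesh_domain \<T>"
    using h by (intro absolutely_integrable_onI) (auto simp: integrable_on_def)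
  then show ?thesis using set_lebesgue_integral_eq_integral(2) integral_unique[OF h] by metis
qed

lemma broken_gradient_interior:
  assumes "T \<in> \<T>" "x \<in> interior T"
  shows "broken_gradient \<T> w x = gradient (w T) x"
proof -
  have "x \<notin> interior T'" if "T' \<in> \<T>" "T' \<noteq> T" for T'
    using interiors_disjoint[OF assms(1) that(1)] that(2) assms(2) by auto
  then have "broken_gradient \<T> w x = (\<Sum>T'\<in>\<T>. if T' = T then gradient (w T) x else 0)"
    unfolding broken_gradient_def using assms(2) by (intro sum.cong) (auto simp: indicator_def)
  then show ?thesis using finite_mesh assms(1) by simp
qed

text \<open>
On the closure of a component of the mesh domain a continuous function with finitely many values is
constant, and the frontier of the component meets the boundary of the mesh domain.
\<close>

lemma piecewise_constant_zero:
  assumes cont: "continuous_on (\<Union>\<T>) v" and zero: "\<And>x. x \<in> mesh_boundary \<T> \<Longrightarrow> v x = 0"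
    and const: "\<And>T. T \<in> \<T> \<Longrightarrow> \<exists>m. \<forall>x\<in>T. v x = (m :: real)"
    and x: "x \<in> \<Union>\<T>"
  shows "v x = 0"
proof (cases "x \<in> mesh_boundary \<T>")
  case False
  let ?D = "interior (\<Union>\<T>)"
  let ?C = "connected_component_set ?D x"
  have xD: "x \<in> ?D" using False x mesh_boundary_eq by blast
  then have xC: "x \<in> ?C" by simp
  have "compact (\<Union>\<T>)" using finite_mesh compact_element by (intro compact_Union) auto
  then have bU: "bounded (\<Union>\<T>)" by (rule compact_imp_bounded)
  have CD: "?C \<subseteq> ?D" by (rule connected_component_subset)
  have clU: "closure ?C \<subseteq> \<Union>\<T>"
    by (rule closure_minimal[OF subset_trans[OF CD interior_subset] closed_union])
  have "bounded ?C" by (rule bounded_subset[OF bU subset_trans[OF CD interior_subset]])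
  then have "?C \<noteq> UNIV" using not_bounded_UNIV by force
  then have "frontier ?C \<noteq> {}" using xC frontier_not_empty[of ?C] by blast
  then obtain y where y: "y \<in> frontier ?C" by blast
  have ymb: "y \<in> mesh_boundary \<T>"
    using y frontier_of_connected_component_subset[of ?D x] by (auto simp: mesh_boundary_def mesh_domain_def)
  have "v constant_on closure ?C"
  proof (rule continuous_finite_range_constant)
    show "connected (closure ?C)" by (intro connected_imp_connected_closure connected_connected_component)
    show "continuous_on (closure ?C) v" using cont clU by (rule continuous_on_subset)
    have "v ` (\<Union>\<T>) \<subseteq> (\<Union>T\<in>\<T>. {SOME m. \<forall>x\<in>T. v x = m})"
    proof
      fix t assume "t \<in> v ` (\<Union>\<T>)"
      then obtain T z where T: "T \<in> \<T>" "z \<in> T" "t = v z" by blast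
      have "\<forall>x\<in>T. v x = (SOME m. \<forall>x\<in>T. v x = m)" using const[OF T(1)] by (rule someI_ex)
      then show "t \<in> (\<Union>T\<in>\<T>. {SOME m. \<forall>x\<in>T. v x = m})" using T by blast
    qed
    moreover have "finite (\<Union>T\<in>\<T>. {SOME m. \<forall>x\<in>T. v x = m})" using finite_mesh by simp
    ultimately have "finite (v ` (\<Union>\<T>))" by (rule finite_subset)
    then show "finite (v ` closure ?C)" by (rule finite_subset[OF image_mono[OF clU]])
  qed
  then have "\<exists>m. \<forall>z\<in>closure ?C. v z = m" unfolding constant_on_def .
  then obtain m where m: "\<forall>z\<in>closure ?C. v z = m" ..
  have "x \<in> closure ?C" by (rule subsetD[OF closure_subset xC])
  with m have "v x = m" ..
  have "y \<in> closure ?C" using y unfolding frontier_def by blast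
  with m have "v y = m" ..
  then show ?thesis using zero[OF ymb] \<open>v x = m\<close> by simp
qed (rule zero)

text \<open>
With \<open>d\<close> the broken gradient of \<open>w - v\<close>, the pointwise inequality
\<open>grad w \<bullet> grad v \<ge> 3/4 \<bar>grad w\<bar>\<^sup>2 - \<bar>d\<bar>\<^sup>2\<close> bounds the form from below by half of the energy \<open>G\<close> of \<open>w\<close>, and
\<open>\<bar>grad v\<bar>\<^sup>2 \<le> 2 \<bar>grad w\<bar>\<^sup>2 + 2 \<bar>d\<bar>\<^sup>2\<close> bounds the energy of \<open>v\<close> by \<open>4 G\<close>.  The same inequality with \<open>w\<close> and \<open>v\<close>
exchanged shows that the energy of \<open>v\<close> is positive, without which the quotient would be zero by
convention.
\<close>

lemma inf_sup_quotient:
  assumes k: "0 < k" and w: "\<And>T. T \<in> \<T> \<Longrightarrow> w T \<in> polys k" and w0: "\<And>T. T \<notin> \<T> \<Longrightarrow> w T = (\<lambda>_. 0)"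
    and nz: "w \<noteq> (\<lambda>_ _. 0)"
    and agree: "\<And>T T' x. T \<in> \<T> \<Longrightarrow> T' \<in> \<T> \<Longrightarrow> x \<in> T \<Longrightarrow> x \<in> T' \<Longrightarrow> clipped k \<T> w T x = clipped k \<T> w T' x"
    and est: "\<And>T. T \<in> \<T> \<Longrightarrow> energy T (\<lambda>x. w T x - clipped k \<T> w T x) \<le> energy T (w T) / 4"
    and null: "\<And>T. T \<in> \<T> \<Longrightarrow> energy T (w T) = 0 \<Longrightarrow> clipped k \<T> w T = w T \<and> (\<exists>m. \<forall>x. w T x = m)"
  shows "\<exists>v \<in> V_space k \<T> - {\<lambda>_. 0}. 1 / 4 \<le> a_form \<T> w v /
      (L2_norm_on (mesh_domain \<T>) (broken_gradient \<T> w) * L2_norm_on (mesh_domain \<T>) (gradient v))"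
proof -
  define z where "z = clipped k \<T> w"
  define v where "v = glue \<T> z"
  have zp: "z T \<in> polys k" if "T \<in> \<T>" for T using clipped_polys[OF that] by (simp add: z_def)
  have v_eq: "v x = z T x" if "T \<in> \<T>" "x \<in> T" for T x
    unfolding v_def by (rule glue_eq[OF agree[folded z_def] that])
  have vV: "v \<in> V_space k \<T>"
    unfolding v_def
    by (rule glue_V_space[OF zp agree[folded z_def] clipped_zero[OF k, where w = w, folded z_def]])
  have gv: "gradient v x = gradient (z T) x" if "T \<in> \<T>" "x \<in> interior T" for T x
    using that v_eq[OF that(1)] interior_subset[of T]
    by (intro gradient_cong_open[OF open_interior that(2) _ polys_GDERIV[OF zp[OF that(1)]]]) auto
  have cw: "continuous_on A (gradient (w T))" if "T \<in> \<T>" for A T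
    by (rule continuous_gradient[OF that k w[OF that]])
  have cz: "continuous_on A (gradient (z T))" if "T \<in> \<T>" for A T
    by (rule continuous_gradient[OF that k zp[OF that]])
  define G where "G = (\<Sum>T\<in>\<T>. energy T (w T))"
  define H where "H = (\<Sum>T\<in>\<T>. energy T (z T))"
  have int_w: "(\<lambda>x. (norm (gradient (w T) x))\<^sup>2) integrable_on T" if "T \<in> \<T>" for T
    by (intro integrable_on_compact_continuous compact_element that continuous_intros cw[OF that])
  have int_z: "(\<lambda>x. (norm (gradient (z T) x))\<^sup>2) integrable_on T" if "T \<in> \<T>" for T
    by (intro integrable_on_compact_continuous compact_element that continuous_intros cz[OF that])
  have int_wz: "(\<lambda>x. gradient (w T) x \<bullet> gradient (z T) x) integrable_on T" if "T \<in> \<T>" for T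
    by (intro integrable_on_compact_continuous compact_element that continuous_intros cz[OF that] cw[OF that])
  have dp: "(\<lambda>x. w T x - z T x) \<in> polys k" if "T \<in> \<T>" for T
    using polys_add[OF w[OF that] polys_cmult[OF zp[OF that], of "-1"]] by simp
  have gd: "gradient (\<lambda>x. w T x - z T x) x = gradient (w T) x - gradient (z T) x" if "T \<in> \<T>" for T x
    by (intro gradient_eqI GDERIV_diff polys_GDERIV[OF w[OF that]] polys_GDERIV[OF zp[OF that]])
  have int_d: "(\<lambda>x. (norm (gradient (w T) x - gradient (z T) x))\<^sup>2) integrable_on T" if "T \<in> \<T>" for T
    by (intro integrable_on_compact_continuous compact_element that continuous_intros cz[OF that] cw[OF that])
  have est': "integral T (\<lambda>x. (norm (gradient (w T) x - gradient (z T) x))\<^sup>2) \<le> energy T (w T) / 4"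
    if "T \<in> \<T>" for T using est[OF that] gd[OF that] by (simp add: z_def)
  have E0: "0 \<le> energy T (w T)" if "T \<in> \<T>" for T by (rule integral_nonneg[OF int_w[OF that]]) simp
  have "3 / 4 * energy T (w T) - integral T (\<lambda>x. (norm (gradient (w T) x - gradient (z T) x))\<^sup>2)
      \<le> integral T (\<lambda>x. gradient (w T) x \<bullet> gradient (z T) x)" if T: "T \<in> \<T>" for T
  proof -
    have "3 / 4 * (norm a)\<^sup>2 - (norm (a - b))\<^sup>2 \<le> a \<bullet> b" for a b :: pt
    proof -
      have "0 \<le> (norm ((1 / 2) *\<^sub>R a - (a - b)))\<^sup>2" by simp
      then show ?thesis
        by (simp add: power2_norm_eq_inner inner_diff_left inner_diff_right inner_commute algebra_simps)
    qed
    then have "integral T (\<lambda>x. 3 / 4 * (norm (gradient (w T) x))\<^sup>2 - (norm (gradient (w T) x - gradient (z T) x))\<^sup>2)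
      \<le> integral T (\<lambda>x. gradient (w T) x \<bullet> gradient (z T) x)"
      using int_w[OF T] int_d[OF T] int_wz[OF T]
      by (intro integral_le integrable_diff integrable_on_mult_right) auto
    then show ?thesis
      using int_w[OF T] int_d[OF T] by (simp add: integral_diff integrable_on_mult_right)
  qed
  note lower = this
  have a_lower: "energy T (w T) / 2 \<le> integral T (\<lambda>x. gradient (w T) x \<bullet> gradient (z T) x)" if "T \<in> \<T>" for T
    using lower[OF that] est'[OF that] by linarith
  have sq: "(norm a)\<^sup>2 \<le> 2 * (norm b)\<^sup>2 + 2 * (norm (a - b))\<^sup>2" for a b :: pt
  proof -
    have "0 \<le> (norm (2 *\<^sub>R b - a))\<^sup>2" by simp
    then show ?thesis
      by (simp add: power2_norm_eq_inner inner_diff_left inner_diff_right inner_commute)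
  qed
  have sq': "(norm a)\<^sup>2 \<le> 2 * (norm b)\<^sup>2 + 2 * (norm (b - a))\<^sup>2" for a b :: pt
    using sq[of a b] by (simp add: norm_minus_commute)
  have z_upper: "energy T (z T) \<le> 4 * energy T (w T)" if T: "T \<in> \<T>" for T
  proof -
    have "energy T (z T) \<le> integral T (\<lambda>x. 2 * (norm (gradient (w T) x))\<^sup>2
        + 2 * (norm (gradient (w T) x - gradient (z T) x))\<^sup>2)"
      by (rule integral_le[OF int_z[OF T] _ sq'])
        (intro integrable_add integrable_on_mult_right int_w[OF T] int_d[OF T])
    also have "\<dots> = 2 * energy T (w T) + 2 * integral T (\<lambda>x. (norm (gradient (w T) x - gradient (z T) x))\<^sup>2)"
      using int_w[OF T] int_d[OF T] by (simp add: integral_add integrable_on_mult_right)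
    finally show ?thesis using est'[OF T] E0[OF T] by linarith
  qed
  have z_lower: "energy T (w T) / 4 \<le> energy T (z T)" if T: "T \<in> \<T>" for T
  proof -
    have "energy T (w T) \<le> integral T (\<lambda>x. 2 * (norm (gradient (z T) x))\<^sup>2
        + 2 * (norm (gradient (w T) x - gradient (z T) x))\<^sup>2)"
      by (rule integral_le[OF int_w[OF T] _ sq])
        (intro integrable_add integrable_on_mult_right int_z[OF T] int_d[OF T])
    also have "\<dots> = 2 * energy T (z T) + 2 * integral T (\<lambda>x. (norm (gradient (w T) x - gradient (z T) x))\<^sup>2)"
      using int_z[OF T] int_d[OF T] by (simp add: integral_add integrable_on_mult_right)
    finally show ?thesis using est'[OF T] E0[OF T] by linarith
  qed
  have "G \<noteq> 0"
  proof
    assume "G = 0"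
    then have e0: "energy T (w T) = 0" if "T \<in> \<T>" for T
      using that sum_nonneg_eq_0_iff[OF finite_mesh, of "\<lambda>T. energy T (w T)"] E0 by (auto simp: G_def)
    have vw: "v x = w T x" if "T \<in> \<T>" "x \<in> T" for T x
      using v_eq[OF that] null[OF that(1) e0[OF that(1)]] by (simp add: z_def)
    have v0: "v x = 0" if "x \<in> \<Union>\<T>" for x
    proof (rule piecewise_constant_zero[OF _ _ _ that])
      show "continuous_on (\<Union>\<T>) v" "\<And>x. x \<in> mesh_boundary \<T> \<Longrightarrow> v x = 0"
        using vV by (auto simp: V_space_def)
      show "\<exists>m. \<forall>x\<in>T. v x = m" if "T \<in> \<T>" for T using vw[OF that] null[OF that e0[OF that]] by auto
    qed
    have "w T = (\<lambda>_. 0)" for T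
    proof (cases "T \<in> \<T>")
      case True
      obtain m where m: "\<And>x. w T x = m" using null[OF True e0[OF True]] by blast
      obtain x where x: "x \<in> T" using interior_element_nonempty[OF True] interior_subset by blast
      have "m = 0" using vw[OF True x] v0[of x] m x True by auto
      then show ?thesis using m by auto
    qed (rule w0)
    then show False using nz by auto
  qed
  moreover have "0 \<le> G" using E0 by (auto simp: G_def intro: sum_nonneg)
  ultimately have G0: "0 < G" by simp
  have HG: "H \<le> 4 * G" "G / 4 \<le> H"
    unfolding G_def H_def sum_distrib_left sum_divide_distrib by (intro sum_mono z_upper z_lower; assumption)+
  have nw: "L2_norm_on (mesh_domain \<T>) (broken_gradient \<T> w) = sqrt G"
    unfolding L2_norm_on_def G_def
    by (subst piecewise_lebesgue_integral[where \<phi> = "\<lambda>T x. (norm (gradient (w T) x))\<^sup>2"])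
      (auto intro!: continuous_intros cw simp: broken_gradient_interior)
  have nv: "L2_norm_on (mesh_domain \<T>) (gradient v) = sqrt H"
    unfolding L2_norm_on_def H_def
    by (subst piecewise_lebesgue_integral[where \<phi> = "\<lambda>T x. (norm (gradient (z T) x))\<^sup>2"])
      (auto intro!: continuous_intros cz simp: gv)
  have "a_form \<T> w v = (\<Sum>T\<in>\<T>. integral T (\<lambda>x. gradient (w T) x \<bullet> gradient (z T) x))"
    unfolding a_form_def
    by (rule piecewise_lebesgue_integral) (auto intro!: continuous_intros cz cw simp: broken_gradient_interior gv)
  also have "\<dots> \<ge> G / 2"
    unfolding G_def sum_divide_distrib by (intro sum_mono a_lower)
  finally have av: "G / 2 \<le> a_form \<T> w v" .
  have "v \<noteq> (\<lambda>_. 0)"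
  proof
    assume "v = (\<lambda>_. 0)"
    then have "gradient v = (\<lambda>_. 0)" using gradient_eqI[OF GDERIV_const] by auto
    then have "a_form \<T> w v = 0" by (simp add: a_form_def set_lebesgue_integral_def)
    then show False using av G0 by simp
  qed
  moreover have "1 / 4 \<le> a_form \<T> w v / (sqrt G * sqrt H)"
  proof -
    have H0: "0 < H" using HG G0 by linarith
    have "sqrt H \<le> 2 * sqrt G" using real_sqrt_le_mono[OF HG(1)] by (simp add: real_sqrt_mult)
    then have "sqrt G * sqrt H \<le> sqrt G * (2 * sqrt G)" using G0 by (intro mult_left_mono) auto
    also have "\<dots> = 2 * G" using G0 by simp
    finally have "1 / 4 * (sqrt G * sqrt H) \<le> a_form \<T> w v" using av by linarith
    moreover have "0 < sqrt G * sqrt H" using G0 H0 by simp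
    ultimately show ?thesis by (simp only: pos_le_divide_eq)
  qed
  ultimately have "v \<in> V_space k \<T> - {\<lambda>_. 0}" "1 / 4 \<le> a_form \<T> w v /
      (L2_norm_on (mesh_domain \<T>) (broken_gradient \<T> w) * L2_norm_on (mesh_domain \<T>) (gradient v))"
    using vV unfolding nw nv by simp_all
  then show ?thesis by blast
qed

end

section \<open>The inf-sup condition\<close>

text \<open>
The supremum in \<open>inball_diameter\<close> is taken over diameters; some ball has at least half of it, which gives
the factor \<open>4\<close> in terms of radii.
\<close>

lemma shape_regular_inball:
  assumes T: "3 simplex T" and \<sigma>: "diameter T \<le> \<sigma> * inball_diameter T"
  shows "\<exists>c r. 0 < r \<and> cball c r \<subseteq> T \<and> diameter T \<le> max 1 (4 * \<sigma>) * r"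
proof -
  note V = tetrahedron_verts[OF T]
  let ?S = "{2 * r | r. 0 \<le> r \<and> (\<exists>c. cball c r \<subseteq> T)}"
  have VT: "verts T \<subseteq> T" using V(4) hull_subset[of "verts T" convex] by simp
  have "\<not> card (verts T) \<le> Suc 0" using V(3) by simp
  then obtain x y where xy: "x \<in> verts T" "y \<in> verts T" "x \<noteq> y"
    using card_le_Suc0_iff_eq[OF V(1)] by blast
  have "0 < dist x y" using xy by simp
  also have "dist x y \<le> diameter T"
    using xy VT by (intro diameter_bounded_bound compact_imp_bounded compact_simplex[OF T]) auto
  finally have d0: "0 < diameter T" .
  have "cball x 0 \<subseteq> T" using xy VT by auto
  then have S0: "0 \<in> ?S" by force
  have "0 < \<sigma> * inball_diameter T" using d0 \<sigma> by linarith
  moreover have "0 \<le> inball_diameter T"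
    unfolding inball_diameter_def
  proof (rule cSup_upper[OF S0])
    show "bdd_above ?S"
    proof (rule bdd_aboveI)
      fix t assume "t \<in> ?S"
      then obtain r c where r: "t = 2 * r" "0 \<le> r" "cball c r \<subseteq> T" by blast
      obtain u :: pt where u: "norm u = 1" using vector_choose_size[of 1] by auto
      have "c + r *\<^sub>R u \<in> T" "c - r *\<^sub>R u \<in> T" using r u by (auto intro!: subsetD[OF r(3)] simp: dist_norm)
      then have "dist (c + r *\<^sub>R u) (c - r *\<^sub>R u) \<le> diameter T"
        by (intro diameter_bounded_bound compact_imp_bounded compact_simplex[OF T])
      moreover have "dist (c + r *\<^sub>R u) (c - r *\<^sub>R u) = norm (2 *\<^sub>R (r *\<^sub>R u))"
        by (simp only: dist_norm scaleR_2) (simp add: algebra_simps)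
      ultimately show "t \<le> diameter T" using r u by simp
    qed
  qed
  ultimately have \<sigma>0: "0 < \<sigma>" and i0: "0 < inball_diameter T"
    by (auto simp: zero_less_mult_iff)
  then have "inball_diameter T / 2 < Sup ?S" by (simp add: inball_diameter_def)
  then obtain t where "t \<in> ?S" "inball_diameter T / 2 < t" using less_cSupE[of _ ?S] S0 by blast
  then obtain r c where r: "inball_diameter T / 2 < 2 * r" "cball c r \<subseteq> T" by blast
  have r0: "0 < r" using r i0 by linarith
  note \<sigma>
  also have "\<sigma> * inball_diameter T \<le> \<sigma> * (4 * r)" using r(1) \<sigma>0 by (intro mult_left_mono) auto
  also have "\<dots> = (4 * \<sigma>) * r" by simp
  also have "\<dots> \<le> max 1 (4 * \<sigma>) * r" using r0 by (intro mult_right_mono) auto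
  finally show ?thesis using r0 r by blast
qed

context mesh
begin

text \<open>
The interpolant of \<open>w\<^sub>T\<close> with all its nodal values is \<open>w\<^sub>T\<close>.
\<close>

lemma clipped_correction:
  assumes k: "0 < k" and T: "T \<in> \<T>" and p: "w T \<in> polys k"
  shows "w T x - clipped k \<T> w T x =
    (\<Sum>a\<in>{a \<in> multi_indices (verts T) k. node k (verts T) a \<in> mesh_boundary \<T>}.
       w T (node k (verts T) a) * lagrange k (verts T) a x)"
proof -
  note V = tetrahedron_verts[OF tetrahedra[OF T]]
  have "w T x = (\<Sum>a\<in>multi_indices (verts T) k. w T (node k (verts T) a) * lagrange k (verts T) a x)"
    using polys_reproduction[OF V(2,3) k p, of 0 1 x] by simp
  then have "w T x - clipped k \<T> w T x = (\<Sum>a\<in>multi_indices (verts T) k.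
      if node k (verts T) a \<in> mesh_boundary \<T> then w T (node k (verts T) a) * lagrange k (verts T) a x else 0)"
    unfolding clipped_def by (simp only: sum_subtractf[symmetric]) (intro sum.cong, auto)
  also have "\<dots> = (\<Sum>a\<in>{a \<in> multi_indices (verts T) k. node k (verts T) a \<in> mesh_boundary \<T>}.
       w T (node k (verts T) a) * lagrange k (verts T) a x)"
    by (rule sum.inter_filter[symmetric, OF finite_multi_indices[OF V(1)]])
  finally show ?thesis .
qed

text \<open>
In the second claim the estimate degenerates: with zero energy the values at the boundary nodes
vanish, so nothing is clipped.
\<close>

lemma clipped_close:
  assumes k: "0 < k" and T: "T \<in> \<T>" and p: "w T \<in> polys k"
    and r: "0 < r" "cball c r \<subseteq> T" "diameter T \<le> K * r"
    and \<eta>: "\<eta> \<le> 1"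
    and P: "\<And>a. a \<in> multi_indices (verts T) k \<Longrightarrow> node k (verts T) a \<in> mesh_boundary \<T> \<Longrightarrow>
      \<exists>P. dist (node k (verts T) a) P \<le> \<eta> * r \<and> w T P = 0"
  shows "energy T (\<lambda>x. w T x - clipped k \<T> w T x) \<le> correction_const k K * \<eta>\<^sup>2 * energy T (w T)"
    and "energy T (w T) = 0 \<Longrightarrow> clipped k \<T> w T = w T \<and> (\<exists>m. \<forall>x. w T x = m)"
proof -
  let ?A = "{a \<in> multi_indices (verts T) k. node k (verts T) a \<in> mesh_boundary \<T>}"
  note V = tetrahedron_verts[OF tetrahedra[OF T]]
  have c: "c \<in> T" using r by auto
  then have h: "T \<subseteq> cball c (diameter T)" using diameter_bound[OF T] by auto
  have eq: "(\<lambda>x. w T x - clipped k \<T> w T x) = (\<lambda>x. \<Sum>a\<in>?A. w T (node k (verts T) a) * lagrange k (verts T) a x)"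
    by (rule ext) (rule clipped_correction[where w = w, OF k T p])
  show "energy T (\<lambda>x. w T x - clipped k \<T> w T x) \<le> correction_const k K * \<eta>\<^sup>2 * energy T (w T)"
    unfolding eq
    by (rule correction_estimate[OF V(2,3) k p r(1), unfolded V(4), OF r(2) h r(3) _ \<eta>]) (use P in auto)
  assume e0: "energy T (w T) = 0"
  have "w T (node k (verts T) a) = 0" if a: "a \<in> ?A" for a
  proof -
    obtain P where P: "dist (node k (verts T) a) P \<le> \<eta> * r" "w T P = 0" using P a by blast
    have "node k (verts T) a \<in> T" using node_in_hull[OF k V(1), of a] a V(4) by simp
    from polys_nodal_value_le[OF V(2,3) k p r(1), unfolded V(4), OF r(2) h r(3) this P(1) \<eta> P(2)]
    show ?thesis using e0 by simp
  qed
  then have "w T x - clipped k \<T> w T x = 0" for x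
    unfolding clipped_correction[where w = w, OF k T p] by (intro sum.neutral) auto
  moreover have "\<exists>m. \<forall>x. w T x = m"
  proof -
    have "gradient (w T) x = 0" if x: "x \<in> T" for x
    proof -
      have "dist c x \<le> diameter T" using diameter_bound[OF T c x] .
      then have "dist c x \<le> 2 * diameter T" using zero_le_dist[of c x] by linarith
      from inverse_estimate[OF V(2,3) k p r(1), unfolded V(4), OF r(2) h r(3) this]
      show ?thesis using e0 by simp
    qed
    then obtain m where "\<And>x. w T x = m"
      using polys_eq_const[OF V(2,3) k p, unfolded V(4)] by blast
    then show ?thesis by blast
  qed
  ultimately show "clipped k \<T> w T = w T \<and> (\<exists>m. \<forall>x. w T x = m)" by auto
qed

end

theorem proposition4p1:
  fixes \<Omega> :: "pt set" and k :: nat and I :: "'i set" and \<T> :: "'i \<Rightarrow> mesh"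
    and \<Delta> :: "'i \<Rightarrow> pt set \<Rightarrow> pt set" and \<theta> :: real
  assumes "curved_domain \<Omega>" and "2 \<le> k"
    and "regular_family I \<T>"
    and "\<And>i. i \<in> I \<Longrightarrow> fitted_mesh \<Omega> (\<T> i)"
    and "0 \<le> \<theta>" and "\<theta> < pi / 2"
    and "\<And>i. i \<in> I \<Longrightarrow> admissible_planes \<Omega> (\<T> i) \<theta> (\<Delta> i)"
  shows "\<exists>h0>0. \<exists>\<alpha>>0. \<forall>i\<in>I. mesh_size (\<T> i) \<le> h0 \<longrightarrow>
    (\<forall>w \<in> W_space k \<Omega> (\<T> i) (\<Delta> i) (\<lambda>_. 0) - {\<lambda>_ _. 0}.
      (SUP v \<in> V_space k (\<T> i) - {\<lambda>_. 0}.
         ereal (a_form (\<T> i) w v /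
                (L2_norm_on (mesh_domain (\<T> i)) (broken_gradient (\<T> i) w) *
                 L2_norm_on (mesh_domain (\<T> i)) (gradient v)))) \<ge> ereal \<alpha>)"
proof -
  have k: "0 < k" using assms(2) by simp
  have \<Omega>: "C1_boundary \<Omega>" "open \<Omega>" "bounded \<Omega>" using assms(1) by (auto simp: curved_domain_def)
  obtain \<sigma> where \<sigma>: "\<And>i T. i \<in> I \<Longrightarrow> T \<in> \<T> i \<Longrightarrow> diameter T \<le> \<sigma> * inball_diameter T"
    using assms(3) by (auto simp: regular_family_def)
  have cos: "0 < cos \<theta>" using assms(5,6) by (intro cos_gt_zero_pi) auto
  define K where "K = max 1 (4 * \<sigma>)"
  have K: "1 \<le> K" by (simp add: K_def)
  define C where "C = correction_const k K"
  have C0: "0 \<le> C" using K by (simp add: C_def correction_const_def inverse_const_def)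
  \<comment> \<open>the relative distance of node and zero that makes the correction factor at most \<open>1 / 4\<close>\<close>
  define \<epsilon> where "\<epsilon> = 1 / (4 * (C + 1))"
  have \<epsilon>: "0 < \<epsilon>" "\<epsilon> \<le> 1" "C * \<epsilon>\<^sup>2 \<le> 1 / 4"
  proof -
    show "0 < \<epsilon>" using C0 by (simp add: \<epsilon>_def)
    show e1: "\<epsilon> \<le> 1" using C0 by (simp add: \<epsilon>_def)
    have "C * \<epsilon>\<^sup>2 \<le> C * \<epsilon>"
      using e1 \<open>0 < \<epsilon>\<close> C0 by (intro mult_left_mono) (auto simp: power2_eq_square mult_left_le)
    also have "\<dots> \<le> 1 / 4" using C0 by (simp add: \<epsilon>_def field_simps)
    finally show "C * \<epsilon>\<^sup>2 \<le> 1 / 4" .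
  qed
  \<comment> \<open>the flatness for which \<open>boundary_node_zero_nearby\<close> gives the relative distance \<open>\<epsilon>\<close>\<close>
  define \<eta> where "\<eta> = \<epsilon> * cos \<theta> / (8 * K\<^sup>2)"
  have \<eta>: "0 < \<eta>" using \<epsilon> cos K by (simp add: \<eta>_def)
  have \<eta>K: "8 * (\<eta> * K) \<le> cos \<theta>"
  proof -
    have "8 * (\<eta> * K) = \<epsilon> / K * cos \<theta>" using K by (simp add: \<eta>_def power2_eq_square)
    also have "\<dots> \<le> 1 * cos \<theta>" using \<epsilon> K cos by (intro mult_right_mono) auto
    finally show ?thesis by simp
  qed
  have \<eta>\<epsilon>: "8 * \<eta> * K\<^sup>2 / cos \<theta> = \<epsilon>" using K cos by (simp add: \<eta>_def)
  obtain \<delta> where \<delta>: "0 < \<delta>" and charts: "\<And>p. p \<in> frontier \<Omega> \<Longrightarrow> \<exists>f g. local_chart \<Omega> \<eta> (ball p \<delta>) f g"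
    using uniform_local_chart[OF \<Omega> \<eta>] by metis
  have "ereal (1 / 4) \<le> (SUP v \<in> V_space k (\<T> i) - {\<lambda>_. 0}.
         ereal (a_form (\<T> i) w v /
                (L2_norm_on (mesh_domain (\<T> i)) (broken_gradient (\<T> i) w) *
                 L2_norm_on (mesh_domain (\<T> i)) (gradient v))))"
    if i: "i \<in> I" and size: "mesh_size (\<T> i) \<le> \<delta> / 4"
      and w: "w \<in> W_space k \<Omega> (\<T> i) (\<Delta> i) (\<lambda>_. 0)" and nz: "w \<noteq> (\<lambda>_ _. 0)" for i w
  proof -
    interpret mesh \<Omega> "\<T> i" using \<Omega>(2) assms(4)[OF i] by unfold_locales
    have small: "2 * diameter T < \<delta>" if "T \<in> \<T> i" for T
    proof -
      have "diameter T \<le> mesh_size (\<T> i)"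
        unfolding mesh_size_def using finite_mesh that by (intro Max_ge) auto
      then show ?thesis using size \<delta> by linarith
    qed
    have shape: "\<exists>c r. 0 < r \<and> cball c r \<subseteq> T \<and> diameter T \<le> K * r" if "T \<in> \<T> i" for T
      unfolding K_def by (rule shape_regular_inball[OF tetrahedra[OF that] \<sigma>[OF i that]])
    interpret resolved_mesh \<Omega> "\<T> i" \<theta> "\<Delta> i" \<eta> \<delta> K
      using assms(7)[OF i] cos charts shape K \<eta> \<eta>K small by unfold_locales auto
    have w0: "\<forall>T. T \<notin> \<T> i \<longrightarrow> w T = (\<lambda>_. 0)" and wp: "\<forall>T\<in>\<T> i. w T \<in> polys k"
      and single: "\<forall>N \<in> (\<Union>T\<in>\<T> i. lattice_points k T) - (mesh_boundary (\<T> i) - boundary_vertices (\<T> i)).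
          \<forall>T\<in>\<T> i. \<forall>T'\<in>\<T> i. N \<in> T \<and> N \<in> T' \<longrightarrow> w T N = w T' N"
      using w unfolding W_space_def mem_Collect_eq by - (elim conjE, assumption)+
    have near: "\<exists>P. dist (node k (verts T) a) P \<le> \<epsilon> * r \<and> w T P = 0"
      if "T \<in> \<T> i" "0 < r" "cball c r \<subseteq> T" "diameter T \<le> K * r"
        "a \<in> multi_indices (verts T) k" "node k (verts T) a \<in> mesh_boundary (\<T> i)" for T c r a
      using boundary_node_zero_nearby[OF k w that]
      unfolding \<eta>\<epsilon> .
    have "\<exists>v \<in> V_space k (\<T> i) - {\<lambda>_. 0}. 1 / 4 \<le> a_form (\<T> i) w v /
      (L2_norm_on (mesh_domain (\<T> i)) (broken_gradient (\<T> i) w) * L2_norm_on (mesh_domain (\<T> i)) (gradient v))"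
    proof (rule inf_sup_quotient[OF k])
      show "w T \<in> polys k" if "T \<in> \<T> i" for T using wp that by blast
      show "w T = (\<lambda>_. 0)" if "T \<notin> \<T> i" for T using w0 that by blast
      show "w \<noteq> (\<lambda>_ _. 0)" by (rule nz)
      show "clipped k (\<T> i) w T x = clipped k (\<T> i) w T' x"
        if "T \<in> \<T> i" "T' \<in> \<T> i" "x \<in> T" "x \<in> T'" for T T' x
        using single by (intro clipped_agree[OF k _ that]) blast
      fix T assume T: "T \<in> \<T> i"
      obtain c r where r: "0 < r" "cball c r \<subseteq> T" "diameter T \<le> K * r" using shape[OF T] by blast
      note close = clipped_close[where w = w, OF k T bspec[OF wp T] r \<epsilon>(2) near[OF T r]]
      have "0 \<le> energy T (w T)"
        using continuous_gradient[OF T k bspec[OF wp T]] compact_element[OF T]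
        by (intro integral_nonneg integrable_on_compact_continuous continuous_intros) auto
      then have "C * \<epsilon>\<^sup>2 * energy T (w T) \<le> 1 / 4 * energy T (w T)"
        using \<epsilon>(3) by (rule mult_right_mono[rotated])
      then show "energy T (\<lambda>x. w T x - clipped k (\<T> i) w T x) \<le> energy T (w T) / 4"
        using close(1) by (simp add: C_def)
      show "energy T (w T) = 0 \<Longrightarrow> clipped k (\<T> i) w T = w T \<and> (\<exists>m. \<forall>x. w T x = m)"
        by (rule close(2))
    qed
    then obtain v where v: "v \<in> V_space k (\<T> i) - {\<lambda>_. 0}" "1 / 4 \<le> a_form (\<T> i) w v /
      (L2_norm_on (mesh_domain (\<T> i)) (broken_gradient (\<T> i) w) * L2_norm_on (mesh_domain (\<T> i)) (gradient v))"
      by blast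
    show ?thesis by (rule SUP_upper2[OF v(1)]) (use v(2) in simp)
  qed
  then show ?thesis
    using \<delta> by (intro exI[of _ "\<delta> / 4"] conjI exI[of _ "1 / 4"]) auto
qed

end
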